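(* Set replacement is logically equivalent to the existence of small set quotients.
   Context: Work in intensional Martin-Löf type theory with universes \(\mathcal U,\mathcal V,\dots\) (with joins \(\mathcal U\sqcup\mathcal V\)), function extensionality, propositional extensionality, and propositional truncations \(\|X\|:\mathcal U\) for \(X:\mathcal U\), with \(\exists_{x:X}Y(x):=\|\Sigma_{x:X}Y(x)\|\). A type is \(\mathcal U\)-small if equivalent to a type in \(\mathcal U\); it is locally \(\mathcal V\)-small if all its identity types are \(\mathcal V\)-small. The image of \(f:X\to Y\) is \(\Sigma_{y:Y}\exists_{x:X}(f(x)=y)\). Set replacement: for all universes \(\mathcal U,\mathcal V\), for every map \(f:X\to Y\) with \(X\) \(\mathcal U\)-small and \(Y\) a locally \(\mathcal V\)-small set, the image of \(f\) is \((\mathcal U\sqcup\mathcal V)\)-small. An equivalence relation is a proposition-valued reflexive, symmetric, transitive relation. Small set quotients exist: for every type \(X:\mathcal U\) and every equivalence relation \(\approx:X\to X\to\mathcal V\) there is a type \(X/{\approx}:\mathcal U\sqcup\mathcal V\) and a map \(\eta:X\to X/{\approx}\) respecting \(\approx\), such that for every set \(A\) in any universe and \(f:X\to A\) respecting \(\approx\) there is a unique \(\bar f:X/{\approx}\to A\) with \(\bar f\circ\eta=f\), and for every proposition-valued family \(P\) over \(X/{\approx}\) in any universe, if \(P(\eta(x))\) for all \(x\) then \(P(q)\) for all \(q\).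
   Formalization: The quotient X/≈ is additionally required to be a set; the other listed clauses do not force this (for X = 1 the circle satisfies them all), so they alone do not define a set quotient. *)

theory Defs
  imports Main
begin

section \<open>Raw terms\<close>

text \<open>
  Intensional Martin-Loef type theory with universes a la Russell is represented by raw terms
  with de Bruijn indices.  The universes are \<open>Univ 0, Univ 1, ...\<close>, with
  successor universe \<open>Univ (Suc i)\<close> and join \<open>Univ (max i j)\<close>.  They are not cumulative.

  The constants \<open>Cst c\<close> are postulates without computation rules: function extensionality,
  propositional extensionality, propositional truncation, and further postulates \<open>Extra n\<close>,
  whose types are supplied by a parameter of the theory (see \<open>cst_type\<close> below).
\<close>

datatype cst =
    FunExt nat nat
  | PropExt nat
  | Trunc nat
  | TruncIn nat
  | TruncProp nat
  | TruncRec nat nat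
  | Extra nat

text \<open>
  Binding structure: the second argument of \<open>Pi\<close>, \<open>Lam\<close> and \<open>Sg\<close> binds one variable.  In the
  eliminators the first argument is the motive; it binds the scrutinee (for \<open>J\<close>: the right
  end point and, innermost, the identification).  In \<open>Split C c p\<close> the branch \<open>c\<close> binds the two
  components (the second one innermost), in \<open>PlusInd C l r s\<close> each of \<open>l\<close>, \<open>r\<close> binds one
  variable, and in \<open>NatInd C z s n\<close> the branch \<open>s\<close> binds the predecessor and, innermost, the
  induction hypothesis.
\<close>

datatype tm =
    Var nat
  | Cst cst
  | Univ nat
  | Pi tm tm | Lam tm tm | App tm tm
  | Sg tm tm | Pr tm tm | Split tm tm tm
  | Eq tm tm tm | Refl tm | J tm tm tm
  | Empty nat | EmptyInd tm tm
  | Unit nat | Star nat | UnitInd tm tm tm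
  | Plus tm tm | Inj1 tm | Inj2 tm | PlusInd tm tm tm tm
  | NatT | Zero | Succ tm | NatInd tm tm tm tm

definition scons :: "'a \<Rightarrow> (nat \<Rightarrow> 'a) \<Rightarrow> nat \<Rightarrow> 'a" (infixr ".:" 65) where
  "a .: s = (\<lambda>n. case n of 0 \<Rightarrow> a | Suc m \<Rightarrow> s m)"

definition upr :: "(nat \<Rightarrow> nat) \<Rightarrow> nat \<Rightarrow> nat" where
  "upr r = 0 .: (\<lambda>n. Suc (r n))"

primrec ren :: "(nat \<Rightarrow> nat) \<Rightarrow> tm \<Rightarrow> tm" where
  "ren r (Var n) = Var (r n)"
| "ren r (Cst c) = Cst c"
| "ren r (Univ i) = Univ i"
| "ren r (Pi A B) = Pi (ren r A) (ren (upr r) B)"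
| "ren r (Lam A t) = Lam (ren r A) (ren (upr r) t)"
| "ren r (App t u) = App (ren r t) (ren r u)"
| "ren r (Sg A B) = Sg (ren r A) (ren (upr r) B)"
| "ren r (Pr t u) = Pr (ren r t) (ren r u)"
| "ren r (Split C c p) = Split (ren (upr r) C) (ren (upr (upr r)) c) (ren r p)"
| "ren r (Eq A t u) = Eq (ren r A) (ren r t) (ren r u)"
| "ren r (Refl t) = Refl (ren r t)"
| "ren r (J C d p) = J (ren (upr (upr r)) C) (ren r d) (ren r p)"
| "ren r (Empty i) = Empty i"
| "ren r (EmptyInd C e) = EmptyInd (ren (upr r) C) (ren r e)"
| "ren r (Unit i) = Unit i"
| "ren r (Star i) = Star i"
| "ren r (UnitInd C c u) = UnitInd (ren (upr r) C) (ren r c) (ren r u)"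
| "ren r (Plus A B) = Plus (ren r A) (ren r B)"
| "ren r (Inj1 t) = Inj1 (ren r t)"
| "ren r (Inj2 t) = Inj2 (ren r t)"
| "ren r (PlusInd C t u s) = PlusInd (ren (upr r) C) (ren (upr r) t) (ren (upr r) u) (ren r s)"
| "ren r NatT = NatT"
| "ren r Zero = Zero"
| "ren r (Succ t) = Succ (ren r t)"
| "ren r (NatInd C z s n) = NatInd (ren (upr r) C) (ren r z) (ren (upr (upr r)) s) (ren r n)"

definition up :: "(nat \<Rightarrow> tm) \<Rightarrow> nat \<Rightarrow> tm" where
  "up s = Var 0 .: (\<lambda>n. ren Suc (s n))"

primrec sub :: "(nat \<Rightarrow> tm) \<Rightarrow> tm \<Rightarrow> tm" where
  "sub s (Var n) = s n"
| "sub s (Cst c) = Cst c"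
| "sub s (Univ i) = Univ i"
| "sub s (Pi A B) = Pi (sub s A) (sub (up s) B)"
| "sub s (Lam A t) = Lam (sub s A) (sub (up s) t)"
| "sub s (App t u) = App (sub s t) (sub s u)"
| "sub s (Sg A B) = Sg (sub s A) (sub (up s) B)"
| "sub s (Pr t u) = Pr (sub s t) (sub s u)"
| "sub s (Split C c p) = Split (sub (up s) C) (sub (up (up s)) c) (sub s p)"
| "sub s (Eq A t u) = Eq (sub s A) (sub s t) (sub s u)"
| "sub s (Refl t) = Refl (sub s t)"
| "sub s (J C d p) = J (sub (up (up s)) C) (sub s d) (sub s p)"
| "sub s (Empty i) = Empty i"
| "sub s (EmptyInd C e) = EmptyInd (sub (up s) C) (sub s e)"
| "sub s (Unit i) = Unit i"
| "sub s (Star i) = Star i"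
| "sub s (UnitInd C c u) = UnitInd (sub (up s) C) (sub s c) (sub s u)"
| "sub s (Plus A B) = Plus (sub s A) (sub s B)"
| "sub s (Inj1 t) = Inj1 (sub s t)"
| "sub s (Inj2 t) = Inj2 (sub s t)"
| "sub s (PlusInd C t u v) = PlusInd (sub (up s) C) (sub (up s) t) (sub (up s) u) (sub s v)"
| "sub s NatT = NatT"
| "sub s Zero = Zero"
| "sub s (Succ t) = Succ (sub s t)"
| "sub s (NatInd C z t n) = NatInd (sub (up s) C) (sub s z) (sub (up (up s)) t) (sub s n)"

abbreviation inst :: "tm \<Rightarrow> tm \<Rightarrow> tm" where
  "inst u t \<equiv> sub (u .: Var) t"

abbreviation inst2 :: "tm \<Rightarrow> tm \<Rightarrow> tm \<Rightarrow> tm" where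
  "inst2 v u t \<equiv> sub (v .: u .: Var) t"


section \<open>Conversion\<close>

text \<open>
  Judgemental equality is the congruence on raw terms generated by the computation rules and
  the uniqueness rule for functions; as usual for pure type systems and their extensions,
  it enters the typing relation through the rule \<open>t_Conv\<close> below.
\<close>

inductive conv :: "tm \<Rightarrow> tm \<Rightarrow> bool" (infix "\<simeq>" 50) where
  c_refl: "t \<simeq> t"
| c_sym: "t \<simeq> u \<Longrightarrow> u \<simeq> t"
| c_trans: "t \<simeq> u \<Longrightarrow> u \<simeq> v \<Longrightarrow> t \<simeq> v"
| c_beta: "App (Lam A t) u \<simeq> inst u t"
| c_eta: "Lam A (App (ren Suc t) (Var 0)) \<simeq> t"
| c_Split_Pr: "Split C c (Pr t u) \<simeq> inst2 u t c"
| c_J_Refl: "J C d (Refl t) \<simeq> d"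
| c_UnitInd_Star: "UnitInd C c (Star i) \<simeq> c"
| c_PlusInd_Inj1: "PlusInd C l r (Inj1 t) \<simeq> inst t l"
| c_PlusInd_Inj2: "PlusInd C l r (Inj2 t) \<simeq> inst t r"
| c_NatInd_Zero: "NatInd C z s Zero \<simeq> z"
| c_NatInd_Succ: "NatInd C z s (Succ n) \<simeq> inst2 (NatInd C z s n) n s"
| c_Pi: "A \<simeq> A' \<Longrightarrow> B \<simeq> B' \<Longrightarrow> Pi A B \<simeq> Pi A' B'"
| c_Lam: "A \<simeq> A' \<Longrightarrow> t \<simeq> t' \<Longrightarrow> Lam A t \<simeq> Lam A' t'"
| c_App: "t \<simeq> t' \<Longrightarrow> u \<simeq> u' \<Longrightarrow> App t u \<simeq> App t' u'"
| c_Sg: "A \<simeq> A' \<Longrightarrow> B \<simeq> B' \<Longrightarrow> Sg A B \<simeq> Sg A' B'"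
| c_Pr: "t \<simeq> t' \<Longrightarrow> u \<simeq> u' \<Longrightarrow> Pr t u \<simeq> Pr t' u'"
| c_Split: "C \<simeq> C' \<Longrightarrow> c \<simeq> c' \<Longrightarrow> p \<simeq> p' \<Longrightarrow> Split C c p \<simeq> Split C' c' p'"
| c_Eq: "A \<simeq> A' \<Longrightarrow> t \<simeq> t' \<Longrightarrow> u \<simeq> u' \<Longrightarrow> Eq A t u \<simeq> Eq A' t' u'"
| c_Refl: "t \<simeq> t' \<Longrightarrow> Refl t \<simeq> Refl t'"
| c_J: "C \<simeq> C' \<Longrightarrow> d \<simeq> d' \<Longrightarrow> p \<simeq> p' \<Longrightarrow> J C d p \<simeq> J C' d' p'"
| c_EmptyInd: "C \<simeq> C' \<Longrightarrow> e \<simeq> e' \<Longrightarrow> EmptyInd C e \<simeq> EmptyInd C' e'"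
| c_UnitInd: "C \<simeq> C' \<Longrightarrow> c \<simeq> c' \<Longrightarrow> u \<simeq> u' \<Longrightarrow> UnitInd C c u \<simeq> UnitInd C' c' u'"
| c_Plus: "A \<simeq> A' \<Longrightarrow> B \<simeq> B' \<Longrightarrow> Plus A B \<simeq> Plus A' B'"
| c_Inj1: "t \<simeq> t' \<Longrightarrow> Inj1 t \<simeq> Inj1 t'"
| c_Inj2: "t \<simeq> t' \<Longrightarrow> Inj2 t \<simeq> Inj2 t'"
| c_PlusInd: "C \<simeq> C' \<Longrightarrow> l \<simeq> l' \<Longrightarrow> r \<simeq> r' \<Longrightarrow> s \<simeq> s' \<Longrightarrow> PlusInd C l r s \<simeq> PlusInd C' l' r' s'"
| c_Succ: "t \<simeq> t' \<Longrightarrow> Succ t \<simeq> Succ t'"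
| c_NatInd: "C \<simeq> C' \<Longrightarrow> z \<simeq> z' \<Longrightarrow> s \<simeq> s' \<Longrightarrow> n \<simeq> n' \<Longrightarrow> NatInd C z s n \<simeq> NatInd C' z' s' n'"


section \<open>Named notation for terms\<close>

text \<open>
  A term in scope is given as a function of the number \<open>d\<close> of variables in scope.  A binder
  introduced at depth \<open>d\<close> is the variable of de Bruijn level \<open>d\<close>, which at depth \<open>d'\<close> has the
  index \<open>d' - Suc d\<close>.  This allows concrete types to be written with HOL-bound variables; the
  raw closed term denoted by \<open>t\<close> is \<open>t 0\<close>.
\<close>

type_synonym stm = "nat \<Rightarrow> tm"

definition bvar :: "nat \<Rightarrow> stm" where
  "bvar d = (\<lambda>d'. Var (d' - Suc d))"

definition PI :: "stm \<Rightarrow> (stm \<Rightarrow> stm) \<Rightarrow> stm" where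
  "PI A B = (\<lambda>d. Pi (A d) (B (bvar d) (Suc d)))"

definition LAM :: "stm \<Rightarrow> (stm \<Rightarrow> stm) \<Rightarrow> stm" where
  "LAM A t = (\<lambda>d. Lam (A d) (t (bvar d) (Suc d)))"

definition SG :: "stm \<Rightarrow> (stm \<Rightarrow> stm) \<Rightarrow> stm" where
  "SG A B = (\<lambda>d. Sg (A d) (B (bvar d) (Suc d)))"

syntax
  "_PI" :: "pttrn \<Rightarrow> stm \<Rightarrow> stm \<Rightarrow> stm" ("(3\<Pi> _\<in>_./ _)" [0, 52, 51] 51)
  "_LAM" :: "pttrn \<Rightarrow> stm \<Rightarrow> stm \<Rightarrow> stm" ("(3\<Lambda> _\<in>_./ _)" [0, 52, 51] 51)
  "_SG" :: "pttrn \<Rightarrow> stm \<Rightarrow> stm \<Rightarrow> stm" ("(3\<Sigma> _\<in>_./ _)" [0, 52, 51] 51)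
translations
  "\<Pi> x\<in>A. B" \<rightleftharpoons> "CONST PI A (\<lambda>x. B)"
  "\<Lambda> x\<in>A. t" \<rightleftharpoons> "CONST LAM A (\<lambda>x. t)"
  "\<Sigma> x\<in>A. B" \<rightleftharpoons> "CONST SG A (\<lambda>x. B)"

definition app :: "stm \<Rightarrow> stm \<Rightarrow> stm" (infixl "\<cdot>" 90) where
  "t \<cdot> u = (\<lambda>d. App (t d) (u d))"

definition ID :: "stm \<Rightarrow> stm \<Rightarrow> stm \<Rightarrow> stm" ("(_ =\<^bsub>_\<^esub>/ _)" [61, 0, 61] 60) where
  "t =\<^bsub>A\<^esub> u = (\<lambda>d. Eq (A d) (t d) (u d))"

definition U :: "nat \<Rightarrow> stm" where
  "U i = (\<lambda>d. Univ i)"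

definition K :: "cst \<Rightarrow> stm" where
  "K c = (\<lambda>d. Cst c)"

text \<open>A closed raw term, weakened to depth \<open>d\<close>.\<close>

definition wk :: "tm \<Rightarrow> stm" ("\<lceil>_\<rceil>") where
  "\<lceil>t\<rceil> = (\<lambda>d. ren (\<lambda>n. n + d) t)"

abbreviation arrow :: "stm \<Rightarrow> stm \<Rightarrow> stm" (infixr "\<rightarrow>" 53) where
  "A \<rightarrow> B \<equiv> PI A (\<lambda>_. B)"

abbreviation times :: "stm \<Rightarrow> stm \<Rightarrow> stm" (infixr "\<otimes>" 55) where
  "A \<otimes> B \<equiv> SG A (\<lambda>_. B)"

definition isProp :: "stm \<Rightarrow> stm" where
  "isProp A = (\<Pi> x\<in>A. \<Pi> y\<in>A. x =\<^bsub>A\<^esub> y)"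

definition isSet :: "stm \<Rightarrow> stm" where
  "isSet A = (\<Pi> x\<in>A. \<Pi> y\<in>A. isProp (x =\<^bsub>A\<^esub> y))"

definition isContr :: "stm \<Rightarrow> stm" where
  "isContr A = (\<Sigma> c\<in>A. \<Pi> x\<in>A. c =\<^bsub>A\<^esub> x)"


section \<open>Typing\<close>

text \<open>
  The types of the postulates.  \<open>\<Theta>\<close> gives the types of arbitrary further postulates, so that
  \<open>\<Theta>\<close> ranges over the extensions of the base theory by postulates.
\<close>

fun cst_type :: "(nat \<Rightarrow> tm option) \<Rightarrow> cst \<Rightarrow> tm option" where
  "cst_type \<Theta> (FunExt i j) = Some ((
     \<Pi> X\<in>U i. \<Pi> Y\<in>(X \<rightarrow> U j). \<Pi> f\<in>(\<Pi> x\<in>X. Y \<cdot> x). \<Pi> g\<in>(\<Pi> x\<in>X. Y \<cdot> x).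
       (\<Pi> x\<in>X. f \<cdot> x =\<^bsub>Y \<cdot> x\<^esub> g \<cdot> x) \<rightarrow> f =\<^bsub>(\<Pi> x\<in>X. Y \<cdot> x)\<^esub> g) 0)"
| "cst_type \<Theta> (PropExt i) = Some ((
     \<Pi> P\<in>U i. \<Pi> Q\<in>U i. isProp P \<rightarrow> isProp Q \<rightarrow> (P \<rightarrow> Q) \<rightarrow> (Q \<rightarrow> P) \<rightarrow> P =\<^bsub>U i\<^esub> Q) 0)"
| "cst_type \<Theta> (Trunc i) = Some ((U i \<rightarrow> U i) 0)"
| "cst_type \<Theta> (TruncIn i) = Some ((\<Pi> X\<in>U i. X \<rightarrow> K (Trunc i) \<cdot> X) 0)"
| "cst_type \<Theta> (TruncProp i) = Some ((\<Pi> X\<in>U i. isProp (K (Trunc i) \<cdot> X)) 0)"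
| "cst_type \<Theta> (TruncRec i j) = Some ((
     \<Pi> X\<in>U i. \<Pi> P\<in>U j. isProp P \<rightarrow> (X \<rightarrow> P) \<rightarrow> K (Trunc i) \<cdot> X \<rightarrow> P) 0)"
| "cst_type \<Theta> (Extra n) = \<Theta> n"

text \<open>
  Contexts are lists with the most recent variable first.  A postulate can only be used if its
  type is already known to be a closed type, which excludes circular postulates.
\<close>

inductive
  wf :: "(nat \<Rightarrow> tm option) \<Rightarrow> tm list \<Rightarrow> bool" and
  typing :: "(nat \<Rightarrow> tm option) \<Rightarrow> tm list \<Rightarrow> tm \<Rightarrow> tm \<Rightarrow> bool" ("_; _ \<turnstile> _ : _" [51, 51, 51, 51] 50)
  for \<Theta> :: "nat \<Rightarrow> tm option"
where
  wf_Nil: "wf \<Theta> []"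
| wf_Cons: "wf \<Theta> \<Gamma> \<Longrightarrow> \<Theta>; \<Gamma> \<turnstile> A : Univ i \<Longrightarrow> wf \<Theta> (A # \<Gamma>)"
| t_Var: "wf \<Theta> \<Gamma> \<Longrightarrow> n < length \<Gamma> \<Longrightarrow> \<Theta>; \<Gamma> \<turnstile> Var n : ren (\<lambda>m. m + Suc n) (\<Gamma> ! n)"
| t_Cst: "wf \<Theta> \<Gamma> \<Longrightarrow> cst_type \<Theta> c = Some A \<Longrightarrow> \<Theta>; [] \<turnstile> A : Univ i \<Longrightarrow> \<Theta>; \<Gamma> \<turnstile> Cst c : A"
| t_Conv: "\<Theta>; \<Gamma> \<turnstile> t : A \<Longrightarrow> \<Theta>; \<Gamma> \<turnstile> B : Univ i \<Longrightarrow> A \<simeq> B \<Longrightarrow> \<Theta>; \<Gamma> \<turnstile> t : B"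
| t_Univ: "wf \<Theta> \<Gamma> \<Longrightarrow> \<Theta>; \<Gamma> \<turnstile> Univ i : Univ (Suc i)"
| t_Pi: "\<Theta>; \<Gamma> \<turnstile> A : Univ i \<Longrightarrow> \<Theta>; A # \<Gamma> \<turnstile> B : Univ j \<Longrightarrow> \<Theta>; \<Gamma> \<turnstile> Pi A B : Univ (max i j)"
| t_Lam: "\<Theta>; \<Gamma> \<turnstile> A : Univ i \<Longrightarrow> \<Theta>; A # \<Gamma> \<turnstile> B : Univ j \<Longrightarrow> \<Theta>; A # \<Gamma> \<turnstile> t : B \<Longrightarrow>
    \<Theta>; \<Gamma> \<turnstile> Lam A t : Pi A B"
| t_App: "\<Theta>; \<Gamma> \<turnstile> t : Pi A B \<Longrightarrow> \<Theta>; \<Gamma> \<turnstile> u : A \<Longrightarrow> \<Theta>; \<Gamma> \<turnstile> App t u : inst u B"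
| t_Sg: "\<Theta>; \<Gamma> \<turnstile> A : Univ i \<Longrightarrow> \<Theta>; A # \<Gamma> \<turnstile> B : Univ j \<Longrightarrow> \<Theta>; \<Gamma> \<turnstile> Sg A B : Univ (max i j)"
| t_Pr: "\<Theta>; \<Gamma> \<turnstile> A : Univ i \<Longrightarrow> \<Theta>; A # \<Gamma> \<turnstile> B : Univ j \<Longrightarrow> \<Theta>; \<Gamma> \<turnstile> t : A \<Longrightarrow>
    \<Theta>; \<Gamma> \<turnstile> u : inst t B \<Longrightarrow> \<Theta>; \<Gamma> \<turnstile> Pr t u : Sg A B"
| t_Split: "\<Theta>; Sg A B # \<Gamma> \<turnstile> C : Univ k \<Longrightarrow>
    \<Theta>; B # A # \<Gamma> \<turnstile> c : sub (Pr (Var 1) (Var 0) .: (\<lambda>n. Var (n + 2))) C \<Longrightarrow>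
    \<Theta>; \<Gamma> \<turnstile> p : Sg A B \<Longrightarrow> \<Theta>; \<Gamma> \<turnstile> Split C c p : inst p C"
| t_Eq: "\<Theta>; \<Gamma> \<turnstile> A : Univ i \<Longrightarrow> \<Theta>; \<Gamma> \<turnstile> t : A \<Longrightarrow> \<Theta>; \<Gamma> \<turnstile> u : A \<Longrightarrow> \<Theta>; \<Gamma> \<turnstile> Eq A t u : Univ i"
| t_Refl: "\<Theta>; \<Gamma> \<turnstile> A : Univ i \<Longrightarrow> \<Theta>; \<Gamma> \<turnstile> t : A \<Longrightarrow> \<Theta>; \<Gamma> \<turnstile> Refl t : Eq A t t"
| t_J: "\<Theta>; Eq (ren Suc A) (ren Suc t) (Var 0) # A # \<Gamma> \<turnstile> C : Univ k \<Longrightarrow>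
    \<Theta>; \<Gamma> \<turnstile> d : inst2 (Refl t) t C \<Longrightarrow> \<Theta>; \<Gamma> \<turnstile> u : A \<Longrightarrow> \<Theta>; \<Gamma> \<turnstile> p : Eq A t u \<Longrightarrow>
    \<Theta>; \<Gamma> \<turnstile> J C d p : inst2 p u C"
| t_Empty: "wf \<Theta> \<Gamma> \<Longrightarrow> \<Theta>; \<Gamma> \<turnstile> Empty i : Univ i"
| t_EmptyInd: "\<Theta>; Empty i # \<Gamma> \<turnstile> C : Univ k \<Longrightarrow> \<Theta>; \<Gamma> \<turnstile> e : Empty i \<Longrightarrow>
    \<Theta>; \<Gamma> \<turnstile> EmptyInd C e : inst e C"
| t_Unit: "wf \<Theta> \<Gamma> \<Longrightarrow> \<Theta>; \<Gamma> \<turnstile> Unit i : Univ i"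
| t_Star: "wf \<Theta> \<Gamma> \<Longrightarrow> \<Theta>; \<Gamma> \<turnstile> Star i : Unit i"
| t_UnitInd: "\<Theta>; Unit i # \<Gamma> \<turnstile> C : Univ k \<Longrightarrow> \<Theta>; \<Gamma> \<turnstile> c : inst (Star i) C \<Longrightarrow>
    \<Theta>; \<Gamma> \<turnstile> u : Unit i \<Longrightarrow> \<Theta>; \<Gamma> \<turnstile> UnitInd C c u : inst u C"
| t_Plus: "\<Theta>; \<Gamma> \<turnstile> A : Univ i \<Longrightarrow> \<Theta>; \<Gamma> \<turnstile> B : Univ j \<Longrightarrow> \<Theta>; \<Gamma> \<turnstile> Plus A B : Univ (max i j)"
| t_Inj1: "\<Theta>; \<Gamma> \<turnstile> A : Univ i \<Longrightarrow> \<Theta>; \<Gamma> \<turnstile> B : Univ j \<Longrightarrow> \<Theta>; \<Gamma> \<turnstile> t : A \<Longrightarrow> \<Theta>; \<Gamma> \<turnstile> Inj1 t : Plus A B"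
| t_Inj2: "\<Theta>; \<Gamma> \<turnstile> A : Univ i \<Longrightarrow> \<Theta>; \<Gamma> \<turnstile> B : Univ j \<Longrightarrow> \<Theta>; \<Gamma> \<turnstile> t : B \<Longrightarrow> \<Theta>; \<Gamma> \<turnstile> Inj2 t : Plus A B"
| t_PlusInd: "\<Theta>; Plus A B # \<Gamma> \<turnstile> C : Univ k \<Longrightarrow>
    \<Theta>; A # \<Gamma> \<turnstile> l : sub (Inj1 (Var 0) .: (\<lambda>n. Var (n + 1))) C \<Longrightarrow>
    \<Theta>; B # \<Gamma> \<turnstile> r : sub (Inj2 (Var 0) .: (\<lambda>n. Var (n + 1))) C \<Longrightarrow>
    \<Theta>; \<Gamma> \<turnstile> s : Plus A B \<Longrightarrow> \<Theta>; \<Gamma> \<turnstile> PlusInd C l r s : inst s C"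
| t_NatT: "wf \<Theta> \<Gamma> \<Longrightarrow> \<Theta>; \<Gamma> \<turnstile> NatT : Univ 0"
| t_Zero: "wf \<Theta> \<Gamma> \<Longrightarrow> \<Theta>; \<Gamma> \<turnstile> Zero : NatT"
| t_Succ: "\<Theta>; \<Gamma> \<turnstile> n : NatT \<Longrightarrow> \<Theta>; \<Gamma> \<turnstile> Succ n : NatT"
| t_NatInd: "\<Theta>; NatT # \<Gamma> \<turnstile> C : Univ k \<Longrightarrow> \<Theta>; \<Gamma> \<turnstile> z : inst Zero C \<Longrightarrow>
    \<Theta>; C # NatT # \<Gamma> \<turnstile> s : sub (Succ (Var 1) .: (\<lambda>n. Var (n + 2))) C \<Longrightarrow>
    \<Theta>; \<Gamma> \<turnstile> n : NatT \<Longrightarrow> \<Theta>; \<Gamma> \<turnstile> NatInd C z s n : inst n C"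

definition closed_of_type :: "(nat \<Rightarrow> tm option) \<Rightarrow> tm \<Rightarrow> stm \<Rightarrow> bool" ("_ \<tturnstile> _ : _" [51, 51, 51] 50) where
  "\<Theta> \<tturnstile> t : A \<longleftrightarrow> \<Theta>; [] \<turnstile> t : A 0"

definition inhabited :: "(nat \<Rightarrow> tm option) \<Rightarrow> stm \<Rightarrow> bool" where
  "inhabited \<Theta> A \<longleftrightarrow> (\<exists>t. \<Theta> \<tturnstile> t : A)"


section \<open>Set replacement\<close>

text \<open>Equivalences are maps with a right inverse and a left inverse.\<close>

definition isEquiv :: "stm \<Rightarrow> stm \<Rightarrow> stm \<Rightarrow> stm" where
  "isEquiv A B f =
     (\<Sigma> g\<in>(B \<rightarrow> A). \<Pi> y\<in>B. f \<cdot> (g \<cdot> y) =\<^bsub>B\<^esub> y) \<otimes> (\<Sigma> h\<in>(B \<rightarrow> A). \<Pi> x\<in>A. h \<cdot> (f \<cdot> x) =\<^bsub>A\<^esub> x)"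

definition equiv :: "stm \<Rightarrow> stm \<Rightarrow> stm" where
  "equiv A B = (\<Sigma> f\<in>(A \<rightarrow> B). isEquiv A B f)"

definition isSmall :: "nat \<Rightarrow> stm \<Rightarrow> stm" where
  "isSmall i X = (\<Sigma> Z\<in>U i. equiv Z X)"

definition isLocallySmall :: "nat \<Rightarrow> stm \<Rightarrow> stm" where
  "isLocallySmall j Y = (\<Pi> x\<in>Y. \<Pi> y\<in>Y. isSmall j (x =\<^bsub>Y\<^esub> y))"

text \<open>For \<open>X : U k\<close> and \<open>Y : U l\<close>, the truncated type below lives in \<open>U (max k l)\<close>.\<close>

definition image :: "nat \<Rightarrow> nat \<Rightarrow> stm \<Rightarrow> stm \<Rightarrow> stm \<Rightarrow> stm" where
  "image k l X Y f = (\<Sigma> y\<in>Y. K (Trunc (max k l)) \<cdot> (\<Sigma> x\<in>X. f \<cdot> x =\<^bsub>Y\<^esub> y))"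

definition replacement_type :: "nat \<Rightarrow> nat \<Rightarrow> nat \<Rightarrow> nat \<Rightarrow> stm" where
  "replacement_type i j k l =
     (\<Pi> X\<in>U k. \<Pi> Y\<in>U l. \<Pi> f\<in>(X \<rightarrow> Y).
        isSmall i X \<rightarrow> isLocallySmall j Y \<rightarrow> isSet Y \<rightarrow> isSmall (max i j) (image k l X Y f))"

text \<open>
  The type theory cannot quantify over universes internally, so that statements about all
  universes are schemes: each instance is required to be derivable.
\<close>

definition set_replacement :: "(nat \<Rightarrow> tm option) \<Rightarrow> bool" where
  "set_replacement \<Theta> \<longleftrightarrow> (\<forall>i j k l. inhabited \<Theta> (replacement_type i j k l))"


section \<open>Small set quotients\<close>

definition isEqRel :: "stm \<Rightarrow> stm \<Rightarrow> stm" where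
  "isEqRel X R =
     (\<Pi> x\<in>X. \<Pi> y\<in>X. isProp (R \<cdot> x \<cdot> y)) \<otimes>
     (\<Pi> x\<in>X. R \<cdot> x \<cdot> x) \<otimes>
     (\<Pi> x\<in>X. \<Pi> y\<in>X. R \<cdot> x \<cdot> y \<rightarrow> R \<cdot> y \<cdot> x) \<otimes>
     (\<Pi> x\<in>X. \<Pi> y\<in>X. \<Pi> z\<in>X. R \<cdot> x \<cdot> y \<rightarrow> R \<cdot> y \<cdot> z \<rightarrow> R \<cdot> x \<cdot> z)"

definition identifies :: "stm \<Rightarrow> stm \<Rightarrow> stm \<Rightarrow> stm \<Rightarrow> stm" where
  "identifies X R A f = (\<Pi> x\<in>X. \<Pi> y\<in>X. R \<cdot> x \<cdot> y \<rightarrow> f \<cdot> x =\<^bsub>A\<^esub> f \<cdot> y)"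

text \<open>In the next two definitions \<open>Q\<close> is the quotient of \<open>X\<close> by \<open>R\<close>, and \<open>h : X \<rightarrow> Q\<close> the
  quotient map.\<close>

definition quotient_universal :: "nat \<Rightarrow> stm \<Rightarrow> stm \<Rightarrow> stm \<Rightarrow> stm \<Rightarrow> stm" where
  "quotient_universal w X R Q h =
     (\<Pi> A\<in>U w. isSet A \<rightarrow> (\<Pi> f\<in>(X \<rightarrow> A). identifies X R A f \<rightarrow>
        isContr (\<Sigma> g\<in>(Q \<rightarrow> A). (\<Lambda> x\<in>X. g \<cdot> (h \<cdot> x)) =\<^bsub>X \<rightarrow> A\<^esub> f)))"

definition quotient_induction :: "nat \<Rightarrow> stm \<Rightarrow> stm \<Rightarrow> stm \<Rightarrow> stm" where
  "quotient_induction w X Q h =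
     (\<Pi> P\<in>(Q \<rightarrow> U w). (\<Pi> q\<in>Q. isProp (P \<cdot> q)) \<rightarrow> (\<Pi> x\<in>X. P \<cdot> (h \<cdot> x)) \<rightarrow> (\<Pi> q\<in>Q. P \<cdot> q))"

definition for_eqrels :: "nat \<Rightarrow> nat \<Rightarrow> (stm \<Rightarrow> stm \<Rightarrow> stm \<Rightarrow> stm) \<Rightarrow> stm" where
  "for_eqrels i j T = (\<Pi> X\<in>U i. \<Pi> R\<in>(X \<rightarrow> X \<rightarrow> U j). \<Pi> e\<in>isEqRel X R. T X R e)"

text \<open>
  The universal property and the induction principle range over all universes \<open>U w\<close>, whereas
  the quotient itself must not depend on \<open>w\<close>.  Hence the quotient types and the
  quotient maps are given by closed terms \<open>Q\<close> and \<open>h\<close> that take the type, the relation and the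
  proof that it is an equivalence relation as arguments, and \<open>w\<close> is quantified after them.
  As the quotient is a set quotient, it is required to be a set; neither the universal property
  (for maps into sets) nor the induction principle (for propositions) implies this.
\<close>

definition small_set_quotients :: "(nat \<Rightarrow> tm option) \<Rightarrow> bool" where
  "small_set_quotients \<Theta> \<longleftrightarrow> (\<forall>i j. \<exists>Q h.
     \<Theta> \<tturnstile> Q : for_eqrels i j (\<lambda>X R e. U (max i j)) \<and>
     \<Theta> \<tturnstile> h : for_eqrels i j (\<lambda>X R e. X \<rightarrow> \<lceil>Q\<rceil> \<cdot> X \<cdot> R \<cdot> e) \<and>
     inhabited \<Theta> (for_eqrels i j (\<lambda>X R e. isSet (\<lceil>Q\<rceil> \<cdot> X \<cdot> R \<cdot> e))) \<and>
     inhabited \<Theta> (for_eqrels i j (\<lambda>X R e. identifies X R (\<lceil>Q\<rceil> \<cdot> X \<cdot> R \<cdot> e) (\<lceil>h\<rceil> \<cdot> X \<cdot> R \<cdot> e))) \<and>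
     (\<forall>w. inhabited \<Theta> (for_eqrels i j (\<lambda>X R e.
        quotient_universal w X R (\<lceil>Q\<rceil> \<cdot> X \<cdot> R \<cdot> e) (\<lceil>h\<rceil> \<cdot> X \<cdot> R \<cdot> e)))) \<and>
     (\<forall>w. inhabited \<Theta> (for_eqrels i j (\<lambda>X R e.
        quotient_induction w X (\<lceil>Q\<rceil> \<cdot> X \<cdot> R \<cdot> e) (\<lceil>h\<rceil> \<cdot> X \<cdot> R \<cdot> e)))))"

end

(*
  Set replacement gives quotients: for an equivalence relation R on X, the map x |-> R x from X to
  the set of subsets of X has a locally small codomain (by function and propositional
  extensionality, S = T is equivalent to a pointwise logical equivalence), so its image is small,
  and the corestriction of the map to its image is the quotient of X by R.

  Conversely, if f : X -> Y is a map from a small type to a locally small set, then f x = f y is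
  equivalent to a small relation on a small copy of X, and the map from the quotient by this
  relation to the image of f is injective and surjective, hence an equivalence.

  Both directions are statements about derivability.  The derivations are found by an elaborator
  that is proved sound and is run by rewriting: it takes terms without annotations of abstractions
  and projections and produces a typing derivation.
*)
theory Submission
  imports Defs
begin

section \<open>Substitution\<close>

text \<open>Universes cannot be quantified internally, and the quotient must not depend on the
  universe \<open>w\<close> of the targets. Replacement is therefore first turned into
  \<open>quotient_props\<close>: the quotient is a set, and its map respects \<open>R\<close>, is
  effective and is surjective. None of this mentions \<open>w\<close>, yet it implies the universal
  property and the induction principle at every \<open>w\<close>; \<open>closed_choice\<close>
  splits the resulting closed term into closed terms for \<open>Q\<close>, for \<open>h\<close> and
  for these properties. Inside a derivation the earlier lemmas are variables, replaced by closed
  terms only at the end. They do not compute, so a path induction whose reduction matters is written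
  out again. Levels decide which relation to use: predicates valued in \<open>U j\<close> form a
  type in \<open>U (max i (Suc j))\<close>, and \<open>same_members\<close> avoids identity types of
  \<open>U j\<close>, which are too large. That products, pair types and subset types are sets comes
  from one criterion, \<open>ty_hedberg\<close>, each time with another relation. In the converse
  direction no choice is used to invert the comparison map: its fibres are propositions, so a
  truncation can be eliminated into the fibre itself.\<close>

lemma scons_0 [simp]: "(a .: s) 0 = a"
  and scons_Suc [simp]: "(a .: s) (Suc n) = s n"
  by (simp_all add: scons_def)

lemma upr_0 [simp]: "upr r 0 = 0"
  and upr_Suc [simp]: "upr r (Suc n) = Suc (r n)"
  by (simp_all add: upr_def)

lemma up_0 [simp]: "up s 0 = Var 0"
  and up_Suc [simp]: "up s (Suc n) = ren Suc (s n)"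
  by (simp_all add: up_def)

lemma nat_fun_eqI: "f 0 = g 0 \<Longrightarrow> (\<And>n. f (Suc n) = g (Suc n)) \<Longrightarrow> f = g"
  by (metis ext not0_implies_Suc)

lemma up_Var_comp: "up (\<lambda>n. Var (r n)) = (\<lambda>n. Var (upr r n))"
  by (rule nat_fun_eqI) simp_all

text \<open>Renamings are special substitutions, so conversion and typing need only be studied under
  \<open>sub\<close>.\<close>

lemma ren_eq_sub: "ren r t = sub (\<lambda>n. Var (r n)) t"
  by (induction t arbitrary: r) (simp_all add: up_Var_comp)

lemma up_Var [simp]: "up Var = Var"
  by (rule nat_fun_eqI) simp_all

lemma sub_Var [simp]: "sub Var t = t"
  by (induction t) simp_all

lemma up_comp_upr: "(\<lambda>n. up s (upr r n)) = up (\<lambda>n. s (r n))"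
  by (rule nat_fun_eqI) simp_all

lemma sub_ren: "sub s (ren r t) = sub (\<lambda>n. s (r n)) t"
  by (induction t arbitrary: s r) (simp_all add: up_comp_upr)

lemma ren_ren: "ren r (ren q t) = ren (\<lambda>n. r (q n)) t"
  by (simp add: ren_eq_sub[of r] sub_ren) (simp add: ren_eq_sub)

lemma ren_up: "(\<lambda>n. ren (upr r) (up s n)) = up (\<lambda>n. ren r (s n))"
  by (rule nat_fun_eqI) (simp_all add: ren_ren)

lemma ren_sub: "ren r (sub s t) = sub (\<lambda>n. ren r (s n)) t"
  by (induction t arbitrary: s r) (simp_all add: ren_up)

lemma sub_up: "(\<lambda>n. sub (up s) (up q n)) = up (\<lambda>n. sub s (q n))"
  by (rule nat_fun_eqI) (simp_all add: sub_ren ren_sub)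

lemma sub_sub: "sub s (sub q t) = sub (\<lambda>n. sub s (q n)) t"
  by (induction t arbitrary: s q) (simp_all add: sub_up)

lemma sub_cong: "(\<And>n. s n = s' n) \<Longrightarrow> sub s t = sub s' t"
  by (metis ext)

lemmas sub_simps = sub_ren ren_sub sub_sub ren_ren

lemma sub_inst: "sub s (inst u B) = inst (sub s u) (sub (up s) B)"
  unfolding sub_simps by (rule sub_cong, case_tac n) (simp_all add: sub_simps)

lemma sub_inst2: "sub s (inst2 v u B) = inst2 (sub s v) (sub s u) (sub (up (up s)) B)"
  unfolding sub_simps
  by (rule sub_cong, case_tac n, simp, case_tac nat) (simp_all add: sub_simps)

lemma sub_up_Suc: "sub (up r) (ren Suc t) = ren Suc (sub r t)"
  by (simp add: sub_simps)

lemma inst_Suc [simp]: "inst u (ren Suc t) = t"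
  by (simp add: sub_ren)

text \<open>A branch of an eliminator is typed by the motive at a constructor applied to the \<open>m\<close>
  variables that the branch binds.\<close>

lemma branch_sub_1:
  "sub (up s) (sub (c .: (\<lambda>n. Var (n + 1))) C) = sub (sub (up s) c .: (\<lambda>n. Var (n + 1))) (sub (up s) C)"
  unfolding sub_simps
  by (rule sub_cong, case_tac n) (simp_all add: sub_simps, simp add: ren_eq_sub)

lemma branch_sub_2:
  "sub (up (up s)) (sub (c .: (\<lambda>n. Var (n + 2))) C) =
   sub (sub (up (up s)) c .: (\<lambda>n. Var (n + 2))) (sub (up s) C)"
  unfolding sub_simps
  by (rule sub_cong, case_tac n) (simp_all add: sub_simps, simp add: ren_eq_sub)


section \<open>Conversion\<close>

lemma conv_sub: "t \<simeq> u \<Longrightarrow> sub s t \<simeq> sub s u"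
proof (induction arbitrary: s rule: conv.induct)
  case (c_eta A t)
  then show ?case by (simp add: sub_up_Suc conv.c_eta)
qed (auto simp: sub_inst sub_inst2 intro: conv.intros)

lemma conv_ren: "t \<simeq> u \<Longrightarrow> ren r t \<simeq> ren r u"
  by (simp add: ren_eq_sub conv_sub)

lemmas conv_congs = c_refl c_Pi c_Lam c_App c_Sg c_Pr c_Split c_Eq c_Refl c_J c_EmptyInd c_UnitInd
  c_Plus c_Inj1 c_Inj2 c_PlusInd c_Succ c_NatInd

lemma conv_up: "(\<And>n. s n \<simeq> s' n) \<Longrightarrow> up s n \<simeq> up s' n"
  by (cases n) (auto intro: conv_ren c_refl)

text \<open>Covers substitutions that agree only up to a computation rule, such as a component of a
  pair and its projection in \<open>typing_snd\<close>.\<close>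

lemma conv_sub_pointwise: "(\<And>n. s n \<simeq> s' n) \<Longrightarrow> sub s t \<simeq> sub s' t"
  by (induction t arbitrary: s s') (simp_all add: conv_congs conv_up)

lemma conv_inst: "u \<simeq> u' \<Longrightarrow> inst u t \<simeq> inst u' t"
  by (rule conv_sub_pointwise, case_tac n) (auto intro: c_refl)

text \<open>By \<open>\<eta>\<close>, the annotation of an abstraction is irrelevant for conversion.\<close>

lemma conv_Lam_any: "t \<simeq> t' \<Longrightarrow> Lam A t \<simeq> Lam A' t'"
proof -
  assume "t \<simeq> t'"
  have "App (ren Suc (Lam A' t')) (Var 0) \<simeq> t'"
  proof -
    have "inst (Var 0) (ren (upr Suc) t') = t'"
      unfolding sub_ren by (rule trans[OF sub_cong sub_Var], case_tac n) simp_all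
    then show ?thesis using c_beta[of "ren Suc A'" "ren (upr Suc) t'" "Var 0"] by simp
  qed
  then have "Lam A t' \<simeq> Lam A' t'"
    by (meson c_Lam c_eta c_refl c_sym c_trans)
  then show ?thesis using \<open>t \<simeq> t'\<close> by (meson c_Lam c_refl c_trans)
qed


section \<open>Stability of typing\<close>

lemma typing_wf: "\<Theta>; \<Gamma> \<turnstile> t : A \<Longrightarrow> wf \<Theta> \<Gamma>"
  by (induction rule: wf_typing.inducts(2)[where ?P1.0="\<lambda>_. True"])
    (auto intro: wf_typing.intros elim: wf.cases)

text \<open>Serves to show that closed terms are invariant under substitution
  (\<open>sub_closed\<close>), which is applied to the types of postulates and to the types of
  lemmas in a context.\<close>

primrec scoped :: "nat \<Rightarrow> tm \<Rightarrow> bool" where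
  "scoped d (Var n) = (n < d)"
| "scoped d (Cst c) = True"
| "scoped d (Univ i) = True"
| "scoped d (Pi A B) = (scoped d A \<and> scoped (Suc d) B)"
| "scoped d (Lam A t) = (scoped d A \<and> scoped (Suc d) t)"
| "scoped d (App t u) = (scoped d t \<and> scoped d u)"
| "scoped d (Sg A B) = (scoped d A \<and> scoped (Suc d) B)"
| "scoped d (Pr t u) = (scoped d t \<and> scoped d u)"
| "scoped d (Split C c p) = (scoped (Suc d) C \<and> scoped (Suc (Suc d)) c \<and> scoped d p)"
| "scoped d (Eq A t u) = (scoped d A \<and> scoped d t \<and> scoped d u)"
| "scoped d (Refl t) = scoped d t"
| "scoped d (J C e p) = (scoped (Suc (Suc d)) C \<and> scoped d e \<and> scoped d p)"
| "scoped d (Empty i) = True"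
| "scoped d (EmptyInd C e) = (scoped (Suc d) C \<and> scoped d e)"
| "scoped d (Unit i) = True"
| "scoped d (Star i) = True"
| "scoped d (UnitInd C c u) = (scoped (Suc d) C \<and> scoped d c \<and> scoped d u)"
| "scoped d (Plus A B) = (scoped d A \<and> scoped d B)"
| "scoped d (Inj1 t) = scoped d t"
| "scoped d (Inj2 t) = scoped d t"
| "scoped d (PlusInd C l r s) = (scoped (Suc d) C \<and> scoped (Suc d) l \<and> scoped (Suc d) r \<and> scoped d s)"
| "scoped d NatT = True"
| "scoped d Zero = True"
| "scoped d (Succ t) = scoped d t"
| "scoped d (NatInd C z s n) = (scoped (Suc d) C \<and> scoped d z \<and> scoped (Suc (Suc d)) s \<and> scoped d n)"

lemma typing_scoped: "\<Theta>; \<Gamma> \<turnstile> t : A \<Longrightarrow> scoped (length \<Gamma>) t"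
  by (induction rule: wf_typing.inducts(2)[where ?P1.0="\<lambda>_. True"]) auto

lemma up_agree: "\<forall>n<d. s n = s' n \<Longrightarrow> \<forall>n<Suc d. up s n = up s' n"
  by (auto simp: less_Suc_eq_0_disj)

lemma sub_cong_scoped: "scoped d t \<Longrightarrow> \<forall>n<d. s n = s' n \<Longrightarrow> sub s t = sub s' t"
proof (induction t arbitrary: d s s')
  case (Pi A B)
  note p = Pi.prems(2)
  show ?case using Pi.prems(1) by (simp add: Pi.IH(1)[OF _ p] Pi.IH(2)[OF _ up_agree[OF p]])
next
  case (Lam A B)
  note p = Lam.prems(2)
  show ?case using Lam.prems(1) by (simp add: Lam.IH(1)[OF _ p] Lam.IH(2)[OF _ up_agree[OF p]])
next
  case (Sg A B)
  note p = Sg.prems(2)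
  show ?case using Sg.prems(1) by (simp add: Sg.IH(1)[OF _ p] Sg.IH(2)[OF _ up_agree[OF p]])
next
  case (Split A B C)
  note p = Split.prems(2)
  show ?case using Split.prems(1) by (simp add: Split.IH(1)[OF _ up_agree[OF p]] Split.IH(2)[OF _ up_agree[OF up_agree[OF p]]] Split.IH(3)[OF _ p])
next
  case (J A B C)
  note p = J.prems(2)
  show ?case using J.prems(1) by (simp add: J.IH(1)[OF _ up_agree[OF up_agree[OF p]]] J.IH(2)[OF _ p] J.IH(3)[OF _ p])
next
  case (EmptyInd A B)
  note p = EmptyInd.prems(2)
  show ?case using EmptyInd.prems(1) by (simp add: EmptyInd.IH(1)[OF _ up_agree[OF p]] EmptyInd.IH(2)[OF _ p])
next
  case (UnitInd A B C)
  note p = UnitInd.prems(2)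
  show ?case using UnitInd.prems(1) by (simp add: UnitInd.IH(1)[OF _ up_agree[OF p]] UnitInd.IH(2)[OF _ p] UnitInd.IH(3)[OF _ p])
next
  case (PlusInd A B C D)
  note p = PlusInd.prems(2)
  show ?case using PlusInd.prems(1) by (simp add: PlusInd.IH(1)[OF _ up_agree[OF p]] PlusInd.IH(2)[OF _ up_agree[OF p]] PlusInd.IH(3)[OF _ up_agree[OF p]] PlusInd.IH(4)[OF _ p])
next
  case (NatInd A B C D)
  note p = NatInd.prems(2)
  show ?case using NatInd.prems(1) by (simp add: NatInd.IH(1)[OF _ up_agree[OF p]] NatInd.IH(2)[OF _ p] NatInd.IH(3)[OF _ up_agree[OF up_agree[OF p]]] NatInd.IH(4)[OF _ p])
qed (simp_all, metis+)

lemma sub_scoped: "scoped d t \<Longrightarrow> (\<And>n. n < d \<Longrightarrow> s n = Var n) \<Longrightarrow> sub s t = t"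
  using sub_cong_scoped[of d t s Var] by simp

lemma sub_closed: "\<Theta>; [] \<turnstile> t : A \<Longrightarrow> sub s t = t"
  using typing_scoped sub_scoped by fastforce

lemma ren_closed: "\<Theta>; [] \<turnstile> t : A \<Longrightarrow> ren r t = t"
  by (simp add: ren_eq_sub sub_closed)

text \<open>Weakening and substitution are proved at once, for a class \<open>Ok\<close> of context morphisms that
  can be extended along binders.\<close>

definition stable_ctx :: "(nat \<Rightarrow> tm option) \<Rightarrow> ((nat \<Rightarrow> tm) \<Rightarrow> tm list \<Rightarrow> tm list \<Rightarrow> bool) \<Rightarrow> tm list \<Rightarrow> bool" where
  "stable_ctx \<Theta> Ok \<Gamma> \<longleftrightarrow> (\<forall>\<Gamma>\<^sub>1 A \<Gamma>\<^sub>2 \<Delta> s. \<Gamma> = \<Gamma>\<^sub>1 @ A # \<Gamma>\<^sub>2 \<longrightarrow> Ok s \<Gamma>\<^sub>2 \<Delta> \<longrightarrow> (\<exists>i. \<Theta>; \<Delta> \<turnstile> sub s A : Univ i))"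

lemma stable_ctx_ConsD:
  assumes "stable_ctx \<Theta> Ok (A # \<Gamma>)"
  shows "stable_ctx \<Theta> Ok \<Gamma>" "Ok s \<Gamma> \<Delta> \<Longrightarrow> \<exists>i. \<Theta>; \<Delta> \<turnstile> sub s A : Univ i"
proof -
  show "stable_ctx \<Theta> Ok \<Gamma>"
    unfolding stable_ctx_def
    using assms[unfolded stable_ctx_def, rule_format, of "A # _"] by (metis append_Cons)
  show "Ok s \<Gamma> \<Delta> \<Longrightarrow> \<exists>i. \<Theta>; \<Delta> \<turnstile> sub s A : Univ i"
    using assms[unfolded stable_ctx_def, rule_format, of "[]"] by simp
qed

text \<open>Rules such as \<open>t_Split\<close> and \<open>t_J\<close> have premises in extended
  contexts without a premise that the added types are types. That fact is hidden in the derivation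
  that the context is well-formed, so \<open>stable_ctx\<close> is carried through a simultaneous
  induction over both judgements; it supplies the typing required to lift \<open>s\<close> under
  binders.\<close>

lemma typing_stable:
  assumes Var: "\<And>s \<Gamma> \<Delta> n. Ok s \<Gamma> \<Delta> \<Longrightarrow> n < length \<Gamma> \<Longrightarrow> \<Theta>; \<Delta> \<turnstile> s n : sub s (ren (\<lambda>m. m + Suc n) (\<Gamma> ! n))"
    and wf: "\<And>s \<Gamma> \<Delta>. Ok s \<Gamma> \<Delta> \<Longrightarrow> wf \<Theta> \<Delta>"
    and up: "\<And>s \<Gamma> \<Delta> A i. Ok s \<Gamma> \<Delta> \<Longrightarrow> \<Theta>; \<Delta> \<turnstile> sub s A : Univ i \<Longrightarrow> Ok (up s) (A # \<Gamma>) (sub s A # \<Delta>)"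
  shows "wf \<Theta> \<Gamma> \<Longrightarrow> stable_ctx \<Theta> Ok \<Gamma>"
    and "\<Theta>; \<Gamma> \<turnstile> t : A \<Longrightarrow> stable_ctx \<Theta> Ok \<Gamma> \<and> (\<forall>s \<Delta>. Ok s \<Gamma> \<Delta> \<longrightarrow> \<Theta>; \<Delta> \<turnstile> sub s t : sub s A)"
proof (induction rule: wf_typing.inducts)
  have ext1: "Ok (up s) (A # \<Gamma>) (sub s A # \<Delta>)" if "stable_ctx \<Theta> Ok (A # \<Gamma>)" "Ok s \<Gamma> \<Delta>" for s \<Gamma> \<Delta> A
    using stable_ctx_ConsD(2)[OF that] up[OF that(2)] by blast
  have ext2: "Ok (up (up s)) (B # A # \<Gamma>) (sub (up s) B # sub s A # \<Delta>)"
    if "stable_ctx \<Theta> Ok (B # A # \<Gamma>)" "Ok s \<Gamma> \<Delta>" for s \<Gamma> \<Delta> A B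
    using ext1[OF that(1) ext1[OF stable_ctx_ConsD(1)[OF that(1)] that(2)]] .
  {
    case wf_Nil then show ?case by (simp add: stable_ctx_def)
  next
    case (wf_Cons \<Gamma> A i)
    have "\<exists>i. \<Theta>; \<Delta> \<turnstile> sub s A : Univ i" if "Ok s \<Gamma> \<Delta>" for s \<Delta>
      using wf_Cons(4)[THEN conjunct2, rule_format, OF that] by (intro exI[of _ i]) simp
    then show ?case using wf_Cons(2) by (auto simp: stable_ctx_def Cons_eq_append_conv)
  next
    case (t_Var \<Gamma> n)
    have "\<Theta>; \<Delta> \<turnstile> sub s (Var n) : sub s (ren (\<lambda>m. m + Suc n) (\<Gamma> ! n))" if "Ok s \<Gamma> \<Delta>" for s \<Delta>
      unfolding sub.simps using that t_Var(3) by (rule Var)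
    then show ?case using t_Var(2) by blast
  next
    case (t_Cst \<Gamma> c A i)
    have "\<Theta>; \<Delta> \<turnstile> sub s (Cst c) : sub s A" if "Ok s \<Gamma> \<Delta>" for s \<Delta>
      unfolding sub.simps sub_closed[OF t_Cst(4)] using wf_typing.t_Cst[OF wf[OF that] t_Cst(3,4)] .
    then show ?case using t_Cst(2) by blast
  next
    case (t_Conv \<Gamma> t A B i)
    note st = t_Conv(2,4)[THEN conjunct1] and IH = t_Conv(2,4)[THEN conjunct2, rule_format]
    show ?case
    proof (intro conjI allI impI st(1))
      fix s \<Delta> assume ok: "Ok s \<Gamma> \<Delta>"
      show "\<Theta>; \<Delta> \<turnstile> sub s t : sub s B"
        unfolding sub.simps sub_inst sub_inst2
        by (rule wf_typing.t_Conv[OF IH(1)[OF ok] IH(2)[OF ok, unfolded sub.simps] conv_sub[OF t_Conv(5)]])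
    qed
  next
    case (t_Univ \<Gamma> i)
    have "\<Theta>; \<Delta> \<turnstile> sub s (Univ i) : sub s (Univ (Suc i))" if "Ok s \<Gamma> \<Delta>" for s \<Delta>
      unfolding sub.simps using wf[OF that] by (rule wf_typing.t_Univ)
    then show ?case using t_Univ(2) by blast
  next
    case (t_Pi \<Gamma> A i B j)
    note st = t_Pi(2,4)[THEN conjunct1] and IH = t_Pi(2,4)[THEN conjunct2, rule_format]
    show ?case
    proof (intro conjI allI impI st(1))
      fix s \<Delta> assume ok: "Ok s \<Gamma> \<Delta>"
      note ok1 = ext1[OF st(2) ok]
      show "\<Theta>; \<Delta> \<turnstile> sub s (Pi A B) : sub s (Univ (max i j))"
        unfolding sub.simps sub_inst sub_inst2
        by (rule wf_typing.t_Pi[OF IH(1)[OF ok, unfolded sub.simps] IH(2)[OF ok1, unfolded sub.simps]])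
    qed
  next
    case (t_Lam \<Gamma> A i B j t)
    note st = t_Lam(2,4,6)[THEN conjunct1] and IH = t_Lam(2,4,6)[THEN conjunct2, rule_format]
    show ?case
    proof (intro conjI allI impI st(1))
      fix s \<Delta> assume ok: "Ok s \<Gamma> \<Delta>"
      note ok1 = ext1[OF st(2) ok]
      show "\<Theta>; \<Delta> \<turnstile> sub s (Lam A t) : sub s (Pi A B)"
        unfolding sub.simps sub_inst sub_inst2
        by (rule wf_typing.t_Lam[OF IH(1)[OF ok, unfolded sub.simps] IH(2)[OF ok1, unfolded sub.simps] IH(3)[OF ok1]])
    qed
  next
    case (t_App \<Gamma> t A B u)
    note st = t_App(2,4)[THEN conjunct1] and IH = t_App(2,4)[THEN conjunct2, rule_format]
    show ?case
    proof (intro conjI allI impI st(1))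
      fix s \<Delta> assume ok: "Ok s \<Gamma> \<Delta>"
      show "\<Theta>; \<Delta> \<turnstile> sub s (App t u) : sub s (inst u B)"
        unfolding sub.simps sub_inst sub_inst2
        by (rule wf_typing.t_App[OF IH(1)[OF ok, unfolded sub.simps] IH(2)[OF ok]])
    qed
  next
    case (t_Sg \<Gamma> A i B j)
    note st = t_Sg(2,4)[THEN conjunct1] and IH = t_Sg(2,4)[THEN conjunct2, rule_format]
    show ?case
    proof (intro conjI allI impI st(1))
      fix s \<Delta> assume ok: "Ok s \<Gamma> \<Delta>"
      note ok1 = ext1[OF st(2) ok]
      show "\<Theta>; \<Delta> \<turnstile> sub s (Sg A B) : sub s (Univ (max i j))"
        unfolding sub.simps sub_inst sub_inst2
        by (rule wf_typing.t_Sg[OF IH(1)[OF ok, unfolded sub.simps] IH(2)[OF ok1, unfolded sub.simps]])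
    qed
  next
    case (t_Pr \<Gamma> A i B j t u)
    note st = t_Pr(2,4,6,8)[THEN conjunct1] and IH = t_Pr(2,4,6,8)[THEN conjunct2, rule_format]
    show ?case
    proof (intro conjI allI impI st(1))
      fix s \<Delta> assume ok: "Ok s \<Gamma> \<Delta>"
      note ok1 = ext1[OF st(2) ok]
      show "\<Theta>; \<Delta> \<turnstile> sub s (Pr t u) : sub s (Sg A B)"
        unfolding sub.simps sub_inst sub_inst2
        by (rule wf_typing.t_Pr[OF IH(1)[OF ok, unfolded sub.simps] IH(2)[OF ok1, unfolded sub.simps] IH(3)[OF ok] IH(4)[OF ok, unfolded sub_inst]])
    qed
  next
    case (t_Split A B \<Gamma> C k c p)
    note st = t_Split(2,4,6)[THEN conjunct1] and IH = t_Split(2,4,6)[THEN conjunct2, rule_format]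
    show ?case
    proof (intro conjI allI impI st(3))
      fix s \<Delta> assume ok: "Ok s \<Gamma> \<Delta>"
      note ok1 = ext1[OF st(1) ok]
      note ok2 = ext2[OF st(2) ok]
      show "\<Theta>; \<Delta> \<turnstile> sub s (Split C c p) : sub s (inst p C)"
        unfolding sub.simps sub_inst sub_inst2
        by (rule wf_typing.t_Split[OF IH(1)[OF ok1[unfolded sub.simps], unfolded sub.simps] _ IH(3)[OF ok, unfolded sub.simps]])
          (use IH(2)[OF ok2] in \<open>simp add: branch_sub_2[simplified]\<close>)
    qed
  next
    case (t_Eq \<Gamma> A i t u)
    note st = t_Eq(2,4,6)[THEN conjunct1] and IH = t_Eq(2,4,6)[THEN conjunct2, rule_format]
    show ?case
    proof (intro conjI allI impI st(1))
      fix s \<Delta> assume ok: "Ok s \<Gamma> \<Delta>"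
      show "\<Theta>; \<Delta> \<turnstile> sub s (Eq A t u) : sub s (Univ i)"
        unfolding sub.simps sub_inst sub_inst2
        by (rule wf_typing.t_Eq[OF IH(1)[OF ok, unfolded sub.simps] IH(2)[OF ok] IH(3)[OF ok]])
    qed
  next
    case (t_Refl \<Gamma> A i t)
    note st = t_Refl(2,4)[THEN conjunct1] and IH = t_Refl(2,4)[THEN conjunct2, rule_format]
    show ?case
    proof (intro conjI allI impI st(1))
      fix s \<Delta> assume ok: "Ok s \<Gamma> \<Delta>"
      show "\<Theta>; \<Delta> \<turnstile> sub s (Refl t) : sub s (Eq A t t)"
        unfolding sub.simps sub_inst sub_inst2
        by (rule wf_typing.t_Refl[OF IH(1)[OF ok, unfolded sub.simps] IH(2)[OF ok]])
    qed
  next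
    case (t_J A t \<Gamma> C k d u p)
    note st = t_J(2,4,6,8)[THEN conjunct1] and IH = t_J(2,4,6,8)[THEN conjunct2, rule_format]
    show ?case
    proof (intro conjI allI impI st(2))
      fix s \<Delta> assume ok: "Ok s \<Gamma> \<Delta>"
      note ok2 = ext2[OF st(1) ok]
      show "\<Theta>; \<Delta> \<turnstile> sub s (J C d p) : sub s (inst2 p u C)"
        unfolding sub.simps sub_inst sub_inst2
        by (rule wf_typing.t_J[OF _ _ IH(3)[OF ok] IH(4)[OF ok, unfolded sub.simps]])
          (use IH(1)[OF ok2] IH(2)[OF ok] in \<open>simp_all add: sub_up_Suc sub_inst2\<close>)
    qed
  next
    case (t_Empty \<Gamma> i)
    have "\<Theta>; \<Delta> \<turnstile> sub s (Empty i) : sub s (Univ i)" if "Ok s \<Gamma> \<Delta>" for s \<Delta>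
      unfolding sub.simps using wf[OF that] by (rule wf_typing.t_Empty)
    then show ?case using t_Empty(2) by blast
  next
    case (t_EmptyInd i \<Gamma> C k e)
    note st = t_EmptyInd(2,4)[THEN conjunct1] and IH = t_EmptyInd(2,4)[THEN conjunct2, rule_format]
    show ?case
    proof (intro conjI allI impI st(2))
      fix s \<Delta> assume ok: "Ok s \<Gamma> \<Delta>"
      note ok1 = ext1[OF st(1) ok]
      show "\<Theta>; \<Delta> \<turnstile> sub s (EmptyInd C e) : sub s (inst e C)"
        unfolding sub.simps sub_inst sub_inst2
        by (rule wf_typing.t_EmptyInd[OF IH(1)[OF ok1, unfolded sub.simps] IH(2)[OF ok, unfolded sub.simps]])
    qed
  next
    case (t_Unit \<Gamma> i)
    have "\<Theta>; \<Delta> \<turnstile> sub s (Unit i) : sub s (Univ i)" if "Ok s \<Gamma> \<Delta>" for s \<Delta>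
      unfolding sub.simps using wf[OF that] by (rule wf_typing.t_Unit)
    then show ?case using t_Unit(2) by blast
  next
    case (t_Star \<Gamma> i)
    have "\<Theta>; \<Delta> \<turnstile> sub s (Star i) : sub s (Unit i)" if "Ok s \<Gamma> \<Delta>" for s \<Delta>
      unfolding sub.simps using wf[OF that] by (rule wf_typing.t_Star)
    then show ?case using t_Star(2) by blast
  next
    case (t_UnitInd i \<Gamma> C k c u)
    note st = t_UnitInd(2,4,6)[THEN conjunct1] and IH = t_UnitInd(2,4,6)[THEN conjunct2, rule_format]
    show ?case
    proof (intro conjI allI impI st(2))
      fix s \<Delta> assume ok: "Ok s \<Gamma> \<Delta>"
      note ok1 = ext1[OF st(1) ok]
      show "\<Theta>; \<Delta> \<turnstile> sub s (UnitInd C c u) : sub s (inst u C)"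
        unfolding sub.simps sub_inst sub_inst2
        by (rule wf_typing.t_UnitInd[OF IH(1)[OF ok1, unfolded sub.simps] IH(2)[OF ok, unfolded sub_inst sub.simps] IH(3)[OF ok, unfolded sub.simps]])
    qed
  next
    case (t_Plus \<Gamma> A i B j)
    note st = t_Plus(2,4)[THEN conjunct1] and IH = t_Plus(2,4)[THEN conjunct2, rule_format]
    show ?case
    proof (intro conjI allI impI st(1))
      fix s \<Delta> assume ok: "Ok s \<Gamma> \<Delta>"
      show "\<Theta>; \<Delta> \<turnstile> sub s (Plus A B) : sub s (Univ (max i j))"
        unfolding sub.simps sub_inst sub_inst2
        by (rule wf_typing.t_Plus[OF IH(1)[OF ok, unfolded sub.simps] IH(2)[OF ok, unfolded sub.simps]])
    qed
  next
    case (t_Inj1 \<Gamma> A i B j t)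
    note st = t_Inj1(2,4,6)[THEN conjunct1] and IH = t_Inj1(2,4,6)[THEN conjunct2, rule_format]
    show ?case
    proof (intro conjI allI impI st(1))
      fix s \<Delta> assume ok: "Ok s \<Gamma> \<Delta>"
      show "\<Theta>; \<Delta> \<turnstile> sub s (Inj1 t) : sub s (Plus A B)"
        unfolding sub.simps sub_inst sub_inst2
        by (rule wf_typing.t_Inj1[OF IH(1)[OF ok, unfolded sub.simps] IH(2)[OF ok, unfolded sub.simps] IH(3)[OF ok]])
    qed
  next
    case (t_Inj2 \<Gamma> A i B j t)
    note st = t_Inj2(2,4,6)[THEN conjunct1] and IH = t_Inj2(2,4,6)[THEN conjunct2, rule_format]
    show ?case
    proof (intro conjI allI impI st(1))
      fix s \<Delta> assume ok: "Ok s \<Gamma> \<Delta>"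
      show "\<Theta>; \<Delta> \<turnstile> sub s (Inj2 t) : sub s (Plus A B)"
        unfolding sub.simps sub_inst sub_inst2
        by (rule wf_typing.t_Inj2[OF IH(1)[OF ok, unfolded sub.simps] IH(2)[OF ok, unfolded sub.simps] IH(3)[OF ok]])
    qed
  next
    case (t_PlusInd A B \<Gamma> C k l r p)
    note st = t_PlusInd(2,4,6,8)[THEN conjunct1] and IH = t_PlusInd(2,4,6,8)[THEN conjunct2, rule_format]
    show ?case
    proof (intro conjI allI impI st(4))
      fix s \<Delta> assume ok: "Ok s \<Gamma> \<Delta>"
      note ok1 = ext1[OF st(1) ok]
      note okl = ext1[OF st(2) ok]
      note okr = ext1[OF st(3) ok]
      show "\<Theta>; \<Delta> \<turnstile> sub s (PlusInd C l r p) : sub s (inst p C)"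
        unfolding sub.simps sub_inst sub_inst2
        by (rule wf_typing.t_PlusInd[OF IH(1)[OF ok1, unfolded sub.simps] _ _ IH(4)[OF ok, unfolded sub.simps]])
          (use IH(2)[OF okl] IH(3)[OF okr] in \<open>simp_all add: branch_sub_1[simplified]\<close>)
    qed
  next
    case (t_NatT \<Gamma>)
    have "\<Theta>; \<Delta> \<turnstile> sub s (NatT) : sub s (Univ 0)" if "Ok s \<Gamma> \<Delta>" for s \<Delta>
      unfolding sub.simps using wf[OF that] by (rule wf_typing.t_NatT)
    then show ?case using t_NatT(2) by blast
  next
    case (t_Zero \<Gamma>)
    have "\<Theta>; \<Delta> \<turnstile> sub s (Zero) : sub s (NatT)" if "Ok s \<Gamma> \<Delta>" for s \<Delta>
      unfolding sub.simps using wf[OF that] by (rule wf_typing.t_Zero)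
    then show ?case using t_Zero(2) by blast
  next
    case (t_Succ \<Gamma> n)
    note st = t_Succ(2)[THEN conjunct1] and IH = t_Succ(2)[THEN conjunct2, rule_format]
    show ?case
    proof (intro conjI allI impI st(1))
      fix s \<Delta> assume ok: "Ok s \<Gamma> \<Delta>"
      show "\<Theta>; \<Delta> \<turnstile> sub s (Succ n) : sub s NatT"
        unfolding sub.simps sub_inst sub_inst2
        by (rule wf_typing.t_Succ[OF IH(1)[OF ok, unfolded sub.simps]])
    qed
  next
    case (t_NatInd \<Gamma> C k z t n)
    note st = t_NatInd(2,4,6,8)[THEN conjunct1] and IH = t_NatInd(2,4,6,8)[THEN conjunct2, rule_format]
    show ?case
    proof (intro conjI allI impI st(2))
      fix s \<Delta> assume ok: "Ok s \<Gamma> \<Delta>"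
      note ok1 = ext1[OF st(1) ok]
      note ok2 = ext2[OF st(3) ok]
      show "\<Theta>; \<Delta> \<turnstile> sub s (NatInd C z t n) : sub s (inst n C)"
        unfolding sub.simps sub_inst sub_inst2
        by (rule wf_typing.t_NatInd[OF IH(1)[OF ok1, unfolded sub.simps] IH(2)[OF ok, unfolded sub_inst sub.simps] _ IH(4)[OF ok, unfolded sub.simps]])
          (use IH(3)[OF ok2] in \<open>simp add: branch_sub_2[simplified]\<close>)
    qed
  }
qed

text \<open>Renamings come before general substitutions: lifting a substitution under a binder
  weakens its terms, and weakening is the case where \<open>r\<close> is \<open>Suc\<close>. The
  equation compares the types of \<open>r n\<close> and of \<open>n\<close> after both have been
  weakened to their full contexts.\<close>

definition ren_ok :: "(nat \<Rightarrow> tm option) \<Rightarrow> (nat \<Rightarrow> tm) \<Rightarrow> tm list \<Rightarrow> tm list \<Rightarrow> bool" where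
  "ren_ok \<Theta> s \<Gamma> \<Delta> \<longleftrightarrow> wf \<Theta> \<Delta> \<and> (\<exists>r. s = (\<lambda>n. Var (r n)) \<and> (\<forall>n<length \<Gamma>. r n < length \<Delta> \<and>
     ren (\<lambda>m. m + Suc (r n)) (\<Delta> ! r n) = ren r (ren (\<lambda>m. m + Suc n) (\<Gamma> ! n))))"

lemma ren_ok_up:
  assumes "ren_ok \<Theta> s \<Gamma> \<Delta>" "\<Theta>; \<Delta> \<turnstile> sub s A : Univ i"
  shows "ren_ok \<Theta> (up s) (A # \<Gamma>) (sub s A # \<Delta>)"
proof -
  obtain r where r: "s = (\<lambda>n. Var (r n))" and h: "\<And>n. n < length \<Gamma> \<Longrightarrow> r n < length \<Delta> \<and>
     ren (\<lambda>m. m + Suc (r n)) (\<Delta> ! r n) = ren r (ren (\<lambda>m. m + Suc n) (\<Gamma> ! n))"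
    using assms(1) by (auto simp: ren_ok_def)
  have "upr r n < length (ren r A # \<Delta>) \<and>
       ren (\<lambda>m. m + Suc (upr r n)) ((ren r A # \<Delta>) ! upr r n) =
       ren (upr r) (ren (\<lambda>m. m + Suc n) ((A # \<Gamma>) ! n))" if n: "n < length (A # \<Gamma>)" for n
  proof (cases n)
    case 0 then show ?thesis by (simp add: ren_ren)
  next
    case (Suc k)
    then have "ren Suc (ren (\<lambda>m. m + Suc (r k)) (\<Delta> ! r k)) = ren Suc (ren r (ren (\<lambda>m. m + Suc k) (\<Gamma> ! k)))"
      using h n by simp
    then show ?thesis using Suc h n by (simp add: ren_ren)
  qed
  moreover have "wf \<Theta> (sub s A # \<Delta>)" using assms by (auto simp: ren_ok_def intro: wf_Cons)
  moreover have "sub s A = ren r A" by (simp add: r ren_eq_sub)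
  moreover have "up s = (\<lambda>n. Var (upr r n))" by (simp add: r up_Var_comp)
  ultimately show ?thesis unfolding ren_ok_def by metis
qed

lemma ren_ok_Var:
  assumes "ren_ok \<Theta> s \<Gamma> \<Delta>" "n < length \<Gamma>"
  shows "\<Theta>; \<Delta> \<turnstile> s n : sub s (ren (\<lambda>m. m + Suc n) (\<Gamma> ! n))"
proof -
  obtain r where "s = (\<lambda>n. Var (r n))" "r n < length \<Delta>"
     "ren (\<lambda>m. m + Suc (r n)) (\<Delta> ! r n) = ren r (ren (\<lambda>m. m + Suc n) (\<Gamma> ! n))"
    using assms by (auto simp: ren_ok_def)
  moreover have "wf \<Theta> \<Delta>" using assms by (simp add: ren_ok_def)
  ultimately show ?thesis by (metis t_Var ren_eq_sub)
qed

lemma typing_ren_ok: "\<Theta>; \<Gamma> \<turnstile> t : A \<Longrightarrow> ren_ok \<Theta> s \<Gamma> \<Delta> \<Longrightarrow> \<Theta>; \<Delta> \<turnstile> sub s t : sub s A"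
  using typing_stable(2)[of "ren_ok \<Theta>" \<Theta>, OF ren_ok_Var _ ren_ok_up] by (simp add: ren_ok_def)

lemma typing_weaken:
  assumes "\<Theta>; \<Gamma> \<turnstile> t : A" "\<Theta>; \<Gamma> \<turnstile> B : Univ i"
  shows "\<Theta>; B # \<Gamma> \<turnstile> ren Suc t : ren Suc A"
proof -
  have "wf \<Theta> (B # \<Gamma>)" using assms(2) typing_wf wf_Cons by blast
  then have "ren_ok \<Theta> (\<lambda>n. Var (Suc n)) \<Gamma> (B # \<Gamma>)" by (auto simp: ren_ok_def ren_ren intro!: exI[of _ Suc])
  then show ?thesis using typing_ren_ok[OF assms(1)] by (simp add: ren_eq_sub)
qed

lemma typing_closed:
  assumes "\<Theta>; [] \<turnstile> t : A" "wf \<Theta> \<Gamma>"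
  shows "\<Theta>; \<Gamma> \<turnstile> t : A"
proof -
  have "ren_ok \<Theta> Var [] \<Gamma>" using assms(2) by (auto simp: ren_ok_def)
  then show ?thesis using typing_ren_ok[OF assms(1)] by fastforce
qed

definition sub_ok :: "(nat \<Rightarrow> tm option) \<Rightarrow> (nat \<Rightarrow> tm) \<Rightarrow> tm list \<Rightarrow> tm list \<Rightarrow> bool" where
  "sub_ok \<Theta> s \<Gamma> \<Delta> \<longleftrightarrow> wf \<Theta> \<Delta> \<and> (\<forall>n<length \<Gamma>. \<Theta>; \<Delta> \<turnstile> s n : sub s (ren (\<lambda>m. m + Suc n) (\<Gamma> ! n)))"

lemma sub_ok_up:
  assumes "sub_ok \<Theta> s \<Gamma> \<Delta>" "\<Theta>; \<Delta> \<turnstile> sub s A : Univ i"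
  shows "sub_ok \<Theta> (up s) (A # \<Gamma>) (sub s A # \<Delta>)"
  unfolding sub_ok_def
proof (intro conjI allI impI)
  show wf: "wf \<Theta> (sub s A # \<Delta>)" using assms by (auto simp: sub_ok_def intro: wf_Cons)
  fix n assume "n < length (A # \<Gamma>)"
  then show "\<Theta>; sub s A # \<Delta> \<turnstile> up s n : sub (up s) (ren (\<lambda>m. m + Suc n) ((A # \<Gamma>) ! n))"
  proof (cases n)
    case 0 then show ?thesis using t_Var[OF wf, of 0] by (simp add: sub_simps)
  next
    case (Suc k)
    then have "\<Theta>; \<Delta> \<turnstile> s k : sub s (ren (\<lambda>m. m + Suc k) (\<Gamma> ! k))"
      using assms \<open>n < _\<close> by (simp add: sub_ok_def)
    from typing_weaken[OF this assms(2)] show ?thesis using Suc by (simp add: sub_simps)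
  qed
qed

lemma typing_sub: "\<Theta>; \<Gamma> \<turnstile> t : A \<Longrightarrow> sub_ok \<Theta> s \<Gamma> \<Delta> \<Longrightarrow> \<Theta>; \<Delta> \<turnstile> sub s t : sub s A"
  using typing_stable(2)[of "sub_ok \<Theta>" \<Theta>, OF _ _ sub_ok_up] by (simp add: sub_ok_def)

lemma sub_ok_Var: "wf \<Theta> \<Gamma> \<Longrightarrow> sub_ok \<Theta> Var \<Gamma> \<Gamma>"
  using t_Var by (fastforce simp: sub_ok_def)

lemma sub_ok_Cons:
  "sub_ok \<Theta> s \<Gamma> \<Delta> \<Longrightarrow> \<Theta>; \<Delta> \<turnstile> u : sub s A \<Longrightarrow> sub_ok \<Theta> (u .: s) (A # \<Gamma>) \<Delta>"
  unfolding sub_ok_def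
  by (auto simp: sub_simps less_Suc_eq_0_disj)

lemma typing_inst: "\<Theta>; A # \<Gamma> \<turnstile> t : B \<Longrightarrow> \<Theta>; \<Gamma> \<turnstile> u : A \<Longrightarrow> \<Theta>; \<Gamma> \<turnstile> inst u t : inst u B"
  by (rule typing_sub[OF _ sub_ok_Cons[OF sub_ok_Var]]) (auto intro: typing_wf)

lemma typing_inst_Univ: "\<Theta>; A # \<Gamma> \<turnstile> B : Univ k \<Longrightarrow> \<Theta>; \<Gamma> \<turnstile> u : A \<Longrightarrow> \<Theta>; \<Gamma> \<turnstile> inst u B : Univ k"
  using typing_inst by fastforce

lemma typing_inst2:
  "\<Theta>; B # A # \<Gamma> \<turnstile> t : C \<Longrightarrow> \<Theta>; \<Gamma> \<turnstile> u : A \<Longrightarrow> \<Theta>; \<Gamma> \<turnstile> v : inst u B \<Longrightarrow> \<Theta>; \<Gamma> \<turnstile> inst2 v u t : inst2 v u C"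
  by (rule typing_sub[OF _ sub_ok_Cons[OF sub_ok_Cons[OF sub_ok_Var]]]) (auto intro: typing_wf)

text \<open>By induction and not by a mere case split, since \<open>t_Conv\<close> may have been
  applied any number of times; \<open>T\<close> is arbitrary for this reason.\<close>

lemma Pi_inv: "\<Theta>; \<Gamma> \<turnstile> Pi A B : T \<Longrightarrow> (\<exists>i. \<Theta>; \<Gamma> \<turnstile> A : Univ i) \<and> (\<exists>j. \<Theta>; A # \<Gamma> \<turnstile> B : Univ j)"
  by (induction \<Gamma> "Pi A B" T rule: wf_typing.inducts(2)[where ?P1.0="\<lambda>_. True"]) auto

lemma Sg_inv: "\<Theta>; \<Gamma> \<turnstile> Sg A B : T \<Longrightarrow> (\<exists>i. \<Theta>; \<Gamma> \<turnstile> A : Univ i) \<and> (\<exists>j. \<Theta>; A # \<Gamma> \<turnstile> B : Univ j)"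
  by (induction \<Gamma> "Sg A B" T rule: wf_typing.inducts(2)[where ?P1.0="\<lambda>_. True"]) auto

lemma Eq_inv: "\<Theta>; \<Gamma> \<turnstile> Eq A t u : T \<Longrightarrow> (\<exists>i. \<Theta>; \<Gamma> \<turnstile> A : Univ i) \<and> \<Theta>; \<Gamma> \<turnstile> t : A \<and> \<Theta>; \<Gamma> \<turnstile> u : A"
  by (induction \<Gamma> "Eq A t u" T rule: wf_typing.inducts(2)[where ?P1.0="\<lambda>_. True"]) auto

lemma ctx_inv: "wf \<Theta> (A # \<Gamma>) \<Longrightarrow> \<exists>i. \<Theta>; \<Gamma> \<turnstile> A : Univ i"
  by (auto elim: wf.cases)

lemma wf_nth: "wf \<Theta> \<Gamma> \<Longrightarrow> n < length \<Gamma> \<Longrightarrow> \<exists>i. \<Theta>; \<Gamma> \<turnstile> ren (\<lambda>m. m + Suc n) (\<Gamma> ! n) : Univ i"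
proof (induction \<Gamma> arbitrary: n)
  case (Cons A \<Gamma>)
  obtain i where i: "\<Theta>; \<Gamma> \<turnstile> A : Univ i" using ctx_inv[OF Cons.prems(1)] by blast
  show ?case
  proof (cases n)
    case 0
    then show ?thesis using typing_weaken[OF i i] by auto
  next
    case (Suc k)
    then obtain j where "\<Theta>; \<Gamma> \<turnstile> ren (\<lambda>m. m + Suc k) (\<Gamma> ! k) : Univ j"
      using Cons i typing_wf by (metis Suc_less_eq length_Cons)
    from typing_weaken[OF this i] show ?thesis using Suc by (auto simp: ren_ren)
  qed
qed simp

lemma typing_valid: "\<Theta>; \<Gamma> \<turnstile> t : A \<Longrightarrow> \<exists>i. \<Theta>; \<Gamma> \<turnstile> A : Univ i"
proof (induction rule: wf_typing.inducts(2)[where ?P1.0="\<lambda>_. True"])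
  case (t_Var \<Gamma> n) show ?case using wf_nth[OF t_Var(1,3)] .
next
  case (t_Cst \<Gamma> c A i) then show ?case using typing_closed by blast
next
  case (t_Univ \<Gamma> i) then show ?case using wf_typing.t_Univ by blast
next
  case (t_Pi \<Gamma> A i B j) then show ?case using wf_typing.t_Univ typing_wf by blast
next
  case (t_Lam \<Gamma> A i B j t) then show ?case using wf_typing.t_Pi by blast
next
  case (t_App \<Gamma> t A B u)
  then obtain i j where "\<Theta>; \<Gamma> \<turnstile> Pi A B : Univ i" "\<Theta>; A # \<Gamma> \<turnstile> B : Univ j" using Pi_inv by blast
  from typing_inst_Univ[OF this(2) t_App.hyps(2)] show ?case ..
next
  case (t_Sg \<Gamma> A i B j) then show ?case using wf_typing.t_Univ typing_wf by blast
next
  case (t_Pr \<Gamma> A i B j t u) then show ?case using wf_typing.t_Sg by blast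
next
  case (t_Split A B \<Gamma> C k c p)
  from typing_inst_Univ[OF t_Split.hyps(1,3)] show ?case ..
next
  case (t_Eq \<Gamma> A i t u) then show ?case using wf_typing.t_Univ typing_wf by blast
next
  case (t_Refl \<Gamma> A i t) then show ?case using wf_typing.t_Eq by blast
next
  case (t_J A t \<Gamma> C k d u p)
  have "\<Theta>; \<Gamma> \<turnstile> inst2 p u C : inst2 p u (Univ k)"
    by (rule typing_inst2[OF t_J.hyps(1,3)]) (simp add: t_J.hyps(4))
  then show ?case by auto
next
  case (t_Empty \<Gamma> i) then show ?case using wf_typing.t_Univ by blast
next
  case (t_EmptyInd i \<Gamma> C k e)
  from typing_inst_Univ[OF t_EmptyInd.hyps(1,2)] show ?case ..
next
  case (t_Unit \<Gamma> i) then show ?case using wf_typing.t_Univ by blast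
next
  case (t_Star \<Gamma> i) then show ?case using wf_typing.t_Unit by blast
next
  case (t_UnitInd i \<Gamma> C k c u)
  from typing_inst_Univ[OF t_UnitInd.hyps(1,3)] show ?case ..
next
  case (t_Plus \<Gamma> A i B j) then show ?case using wf_typing.t_Univ typing_wf by blast
next
  case (t_Inj1 \<Gamma> A i B j t) then show ?case using wf_typing.t_Plus by blast
next
  case (t_Inj2 \<Gamma> A i B j t) then show ?case using wf_typing.t_Plus by blast
next
  case (t_PlusInd A B \<Gamma> C k l r s)
  from typing_inst_Univ[OF t_PlusInd.hyps(1,4)] show ?case ..
next
  case (t_NatT \<Gamma>) then show ?case using wf_typing.t_Univ by blast
next
  case (t_Zero \<Gamma>) then show ?case using wf_typing.t_NatT by blast
next
  case (t_Succ \<Gamma> n) then show ?case by blast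
next
  case (t_NatInd \<Gamma> C k z s n)
  from typing_inst_Univ[OF t_NatInd.hyps(1,4)] show ?case ..
qed auto


section \<open>Projections\<close>

text \<open>This is \<open>B\<close> at the first projection of the scrutinee \<open>Var 0\<close>.
  The type \<open>A\<close> is weakened twice: past the scrutinee, and past the variable bound by
  the motive of that inner projection.\<close>

definition snd_motive :: "tm \<Rightarrow> tm \<Rightarrow> tm" where
  "snd_motive A B = sub (Split (ren Suc (ren Suc A)) (Var (Suc 0)) (Var 0) .: (\<lambda>n. Var (Suc n))) B"

lemma sub_ok_shift: "\<Theta>; \<Gamma> \<turnstile> B : Univ i \<Longrightarrow> sub_ok \<Theta> (\<lambda>n. Var (Suc n)) \<Gamma> (B # \<Gamma>)"
  unfolding sub_ok_def
proof (intro conjI allI impI)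
  assume B: "\<Theta>; \<Gamma> \<turnstile> B : Univ i"
  then show "wf \<Theta> (B # \<Gamma>)" using typing_wf wf_Cons by blast
  fix n assume "n < length \<Gamma>"
  from typing_weaken[OF t_Var[OF typing_wf[OF B] this] B]
  show "\<Theta>; B # \<Gamma> \<turnstile> Var (Suc n) : sub (\<lambda>n. Var (Suc n)) (ren (\<lambda>m. m + Suc n) (\<Gamma> ! n))"
    by (simp add: ren_eq_sub)
qed

text \<open>This is the substitution by which \<open>t_Split\<close> instantiates the motive in its
  branch: the pair of the two bound variables replaces the scrutinee.\<close>

lemma sub_ok_Pr:
  assumes S: "\<Theta>; \<Gamma> \<turnstile> Sg A B : Univ l"
  shows "sub_ok \<Theta> (Pr (Var (Suc 0)) (Var 0) .: (\<lambda>n. Var (Suc (Suc n)))) (Sg A B # \<Gamma>) (B # A # \<Gamma>)"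
proof -
  obtain i j where A: "\<Theta>; \<Gamma> \<turnstile> A : Univ i" and B: "\<Theta>; A # \<Gamma> \<turnstile> B : Univ j" using Sg_inv[OF S] by blast
  have wf: "wf \<Theta> (B # A # \<Gamma>)" using B typing_wf wf_Cons by blast
  have s: "sub_ok \<Theta> (\<lambda>n. Var (Suc (Suc n))) \<Gamma> (B # A # \<Gamma>)"
    unfolding sub_ok_def
  proof (intro conjI allI impI wf)
    fix n assume n: "n < length \<Gamma>"
    have "ren (\<lambda>m. m + Suc (Suc (Suc n))) ((B # A # \<Gamma>) ! Suc (Suc n)) =
        sub (\<lambda>n. Var (Suc (Suc n))) (ren (\<lambda>m. m + Suc n) (\<Gamma> ! n))"
      by (simp add: sub_ren) (simp add: ren_eq_sub)
    then show "\<Theta>; B # A # \<Gamma> \<turnstile> Var (Suc (Suc n)) : sub (\<lambda>n. Var (Suc (Suc n))) (ren (\<lambda>m. m + Suc n) (\<Gamma> ! n))"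
      using t_Var[OF wf, of "Suc (Suc n)"] n by (metis Suc_less_eq length_Cons)
  qed
  have "\<Theta>; B # A # \<Gamma> \<turnstile> sub (\<lambda>n. Var (Suc (Suc n))) (Sg A B) : Univ l"
    using typing_sub[OF S s] by simp
  then obtain i' j' where A': "\<Theta>; B # A # \<Gamma> \<turnstile> sub (\<lambda>n. Var (Suc (Suc n))) A : Univ i'"
    and B': "\<Theta>; sub (\<lambda>n. Var (Suc (Suc n))) A # B # A # \<Gamma> \<turnstile> sub (up (\<lambda>n. Var (Suc (Suc n)))) B : Univ j'"
    using Sg_inv by (metis sub.simps(7))
  have "\<Theta>; B # A # \<Gamma> \<turnstile> Pr (Var (Suc 0)) (Var 0) : Sg (sub (\<lambda>n. Var (Suc (Suc n))) A) (sub (up (\<lambda>n. Var (Suc (Suc n)))) B)"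
  proof (rule t_Pr[OF A' B'])
    show "\<Theta>; B # A # \<Gamma> \<turnstile> Var (Suc 0) : sub (\<lambda>n. Var (Suc (Suc n))) A"
      using t_Var[OF wf, of "Suc 0"] by (simp add: ren_eq_sub)
    have "(\<lambda>n. inst (Var (Suc 0)) (up (\<lambda>n. Var (Suc (Suc n))) n)) = (\<lambda>n. Var (Suc n))"
      by (rule nat_fun_eqI) simp_all
    then show "\<Theta>; B # A # \<Gamma> \<turnstile> Var 0 : inst (Var (Suc 0)) (sub (up (\<lambda>n. Var (Suc (Suc n)))) B)"
      using t_Var[OF wf, of 0] by (simp add: sub_sub ren_eq_sub)
  qed
  then show ?thesis using sub_ok_Cons[OF s] by simp
qed

lemma typing_fst:
  assumes p: "\<Theta>; \<Gamma> \<turnstile> p : Sg A B"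
  shows "\<Theta>; \<Gamma> \<turnstile> Split (ren Suc A) (Var (Suc 0)) p : A"
proof -
  obtain l where S: "\<Theta>; \<Gamma> \<turnstile> Sg A B : Univ l" using typing_valid[OF p] by blast
  then obtain i j where A: "\<Theta>; \<Gamma> \<turnstile> A : Univ i" and B: "\<Theta>; A # \<Gamma> \<turnstile> B : Univ j" using Sg_inv by blast
  have wf: "wf \<Theta> (B # A # \<Gamma>)" using B typing_wf wf_Cons by blast
  have "\<Theta>; B # A # \<Gamma> \<turnstile> Var (Suc 0) : sub (Pr (Var 1) (Var 0) .: (\<lambda>n. Var (n + 2))) (ren Suc A)"
    using t_Var[OF wf, of "Suc 0"] by (simp add: sub_ren) (simp add: ren_eq_sub)
  from t_Split[OF typing_weaken[OF A S, unfolded ren.simps] this p] show ?thesis by simp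
qed

lemma typing_snd:
  assumes p: "\<Theta>; \<Gamma> \<turnstile> p : Sg A B"
  shows "\<Theta>; \<Gamma> \<turnstile> Split (snd_motive A B) (Var 0) p : inst (Split (ren Suc A) (Var (Suc 0)) p) B"
proof -
  obtain l where S: "\<Theta>; \<Gamma> \<turnstile> Sg A B : Univ l" using typing_valid[OF p] by blast
  then obtain i j where A: "\<Theta>; \<Gamma> \<turnstile> A : Univ i" and B: "\<Theta>; A # \<Gamma> \<turnstile> B : Univ j" using Sg_inv by blast
  have wf: "wf \<Theta> (B # A # \<Gamma>)" using B typing_wf wf_Cons by blast
  have "\<Theta>; Sg A B # \<Gamma> \<turnstile> Var 0 : Sg (ren Suc A) (ren (upr Suc) B)"
    using t_Var[OF wf_Cons[OF typing_wf[OF S] S], of 0] by simp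
  from typing_fst[OF this] have "sub_ok \<Theta> (Split (ren Suc (ren Suc A)) (Var (Suc 0)) (Var 0) .: (\<lambda>n. Var (Suc n))) (A # \<Gamma>) (Sg A B # \<Gamma>)"
    by (intro sub_ok_Cons[OF sub_ok_shift[OF S]]) (simp add: ren_eq_sub)
  from typing_sub[OF B this] have M: "\<Theta>; Sg A B # \<Gamma> \<turnstile> snd_motive A B : Univ j" by (simp add: snd_motive_def)
  \<comment> \<open>The branch has type \<open>B\<close> at its first variable, whereas the motive
    asks for \<open>B\<close> at the first projection of the pair. The two agree by the computation
    rule of \<open>Split\<close>.\<close>
  have "\<Theta>; B # A # \<Gamma> \<turnstile> Var 0 : sub (Pr (Var 1) (Var 0) .: (\<lambda>n. Var (n + 2))) (snd_motive A B)"
  proof (rule t_Conv)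
    show "\<Theta>; B # A # \<Gamma> \<turnstile> Var 0 : sub (\<lambda>n. Var (Suc n)) B" using t_Var[OF wf, of 0] by (simp add: ren_eq_sub)
    show "\<Theta>; B # A # \<Gamma> \<turnstile> sub (Pr (Var 1) (Var 0) .: (\<lambda>n. Var (n + 2))) (snd_motive A B) : Univ j"
      using typing_sub[OF M sub_ok_Pr[OF S]] by simp
    show "sub (\<lambda>n. Var (Suc n)) B \<simeq> sub (Pr (Var 1) (Var 0) .: (\<lambda>n. Var (n + 2))) (snd_motive A B)"
      unfolding snd_motive_def sub_sub
    proof (rule conv_sub_pointwise)
      fix n
      have "Split C (Var (Suc 0)) (Pr t u) \<simeq> t" for C t u
        using c_Split_Pr[of C "Var (Suc 0)" t u] by simp
      from c_sym[OF this]
      show "Var (Suc n) \<simeq> sub (Pr (Var 1) (Var 0) .: (\<lambda>n. Var (n + 2)))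
          ((Split (ren Suc (ren Suc A)) (Var (Suc 0)) (Var 0) .: (\<lambda>n. Var (Suc n))) n)"
        by (cases n) (simp_all add: c_refl)
    qed
  qed
  from t_Split[OF M this p] have "\<Theta>; \<Gamma> \<turnstile> Split (snd_motive A B) (Var 0) p : inst p (snd_motive A B)" .
  moreover have "inst p (snd_motive A B) = inst (Split (ren Suc A) (Var (Suc 0)) p) B"
    unfolding snd_motive_def sub_sub
    by (rule sub_cong, case_tac n) (simp_all add: sub_ren, simp add: ren_eq_sub)
  ultimately show ?thesis by simp
qed


section \<open>A verified elaborator\<close>

fun wh_App :: "(tm \<Rightarrow> tm) \<Rightarrow> tm \<Rightarrow> tm \<Rightarrow> tm" where
  "wh_App f (Lam A t) u = f (inst u t)"
| "wh_App f t u = App t u"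

fun wh_Split :: "(tm \<Rightarrow> tm) \<Rightarrow> tm \<Rightarrow> tm \<Rightarrow> tm \<Rightarrow> tm" where
  "wh_Split f C c (Pr t u) = f (inst2 u t c)"
| "wh_Split f C c p = Split C c p"

fun wh_J :: "(tm \<Rightarrow> tm) \<Rightarrow> tm \<Rightarrow> tm \<Rightarrow> tm \<Rightarrow> tm" where
  "wh_J f C d (Refl t) = f d"
| "wh_J f C d p = J C d p"

fun wh_step :: "(tm \<Rightarrow> tm) \<Rightarrow> tm \<Rightarrow> tm" where
  "wh_step f (App t u) = wh_App f (f t) u"
| "wh_step f (Split C c p) = wh_Split f C c (f p)"
| "wh_step f (J C d p) = wh_J f C d (f p)"
| "wh_step f t = t"

text \<open>Fuel stands in for termination, which raw terms do not offer. Too little fuel yields a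
  less reduced term that is still convertible to the original.\<close>

primrec whnf :: "nat \<Rightarrow> tm \<Rightarrow> tm" where
  "whnf 0 t = t"
| "whnf (Suc n) t = wh_step (whnf n) t"

fun eta_body :: "tm \<Rightarrow> tm" where
  "eta_body (Lam A t) = t"
| "eta_body t = App (ren Suc t) (Var 0)"

fun is_Lam :: "tm \<Rightarrow> bool" where
  "is_Lam (Lam A t) = True"
| "is_Lam t = False"

text \<open>Applied to all weak head normal forms other than abstractions, including type formers
  and pairs. The answer \<open>False\<close> only means that no conversion was found.\<close>

fun cv_neutral :: "(tm \<Rightarrow> tm \<Rightarrow> bool) \<Rightarrow> tm \<Rightarrow> tm \<Rightarrow> bool" where
  "cv_neutral f (Var n) u = (u = Var n)"
| "cv_neutral f (Cst c) u = (u = Cst c)"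
| "cv_neutral f (Univ i) u = (u = Univ i)"
| "cv_neutral f (Pi A B) u = (case u of Pi A' B' \<Rightarrow> f A A' \<and> f B B' | _ \<Rightarrow> False)"
| "cv_neutral f (Sg A B) u = (case u of Sg A' B' \<Rightarrow> f A A' \<and> f B B' | _ \<Rightarrow> False)"
| "cv_neutral f (App t s) u = (case u of App t' s' \<Rightarrow> f t t' \<and> f s s' | _ \<Rightarrow> False)"
| "cv_neutral f (Pr t s) u = (case u of Pr t' s' \<Rightarrow> f t t' \<and> f s s' | _ \<Rightarrow> False)"
| "cv_neutral f (Split C c p) u = (case u of Split C' c' p' \<Rightarrow> f C C' \<and> f c c' \<and> f p p' | _ \<Rightarrow> False)"
| "cv_neutral f (Eq A t s) u = (case u of Eq A' t' s' \<Rightarrow> f A A' \<and> f t t' \<and> f s s' | _ \<Rightarrow> False)"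
| "cv_neutral f (Refl t) u = (case u of Refl t' \<Rightarrow> f t t' | _ \<Rightarrow> False)"
| "cv_neutral f (J C d p) u = (case u of J C' d' p' \<Rightarrow> f C C' \<and> f d d' \<and> f p p' | _ \<Rightarrow> False)"
| "cv_neutral f t u = False"

text \<open>As soon as one side is an abstraction, both sides are compared as bodies of functions,
  which builds in eta. The annotations of abstractions are skipped, as \<open>conv_Lam_any\<close>
  allows.\<close>

definition cv_whnf :: "(tm \<Rightarrow> tm \<Rightarrow> bool) \<Rightarrow> tm \<Rightarrow> tm \<Rightarrow> bool" where
  "cv_whnf f t u = (if is_Lam t then f (eta_body t) (eta_body u)
     else if is_Lam u then f (eta_body t) (eta_body u) else cv_neutral f t u)"

primrec cv :: "nat \<Rightarrow> tm \<Rightarrow> tm \<Rightarrow> bool" where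
  "cv 0 t u = (t = u)"
| "cv (Suc n) t u = (if t = u then True else cv_whnf (cv n) (whnf n t) (whnf n u))"

lemma wh_App_conv: "(\<And>t. f t \<simeq> t) \<Longrightarrow> wh_App f t u \<simeq> App t u"
  by (cases t) (auto intro: c_refl c_trans c_sym[OF c_beta])

lemma wh_Split_conv: "(\<And>t. f t \<simeq> t) \<Longrightarrow> wh_Split f C c p \<simeq> Split C c p"
  by (cases p) (auto intro: c_refl c_trans c_sym[OF c_Split_Pr])

lemma wh_J_conv: "(\<And>t. f t \<simeq> t) \<Longrightarrow> wh_J f C d p \<simeq> J C d p"
  by (cases p) (auto intro: c_refl c_trans c_sym[OF c_J_Refl])

lemma wh_step_conv: "(\<And>t. f t \<simeq> t) \<Longrightarrow> wh_step f t \<simeq> t"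
  by (cases t) (auto intro: c_refl c_trans[OF wh_App_conv] c_trans[OF wh_Split_conv] c_trans[OF wh_J_conv] conv_congs)

lemma whnf_conv: "whnf n t \<simeq> t"
  by (induction n arbitrary: t) (simp_all add: c_refl wh_step_conv)

lemma eta_body_conv: "Lam A (eta_body t) \<simeq> t"
proof (cases "is_Lam t")
  case True
  then show ?thesis by (cases t) (auto intro: conv_Lam_any c_refl)
next
  case False
  then have "eta_body t = App (ren Suc t) (Var 0)" by (cases t) simp_all
  then show ?thesis by (simp add: c_eta)
qed

lemma cv_neutral_conv: "(\<And>t u. f t u \<Longrightarrow> t \<simeq> u) \<Longrightarrow> cv_neutral f t u \<Longrightarrow> t \<simeq> u"
  by (cases t) (auto intro: conv_congs split: tm.splits)

lemma eta_body_eq_conv: "eta_body t \<simeq> eta_body u \<Longrightarrow> t \<simeq> u"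
  by (meson c_Lam c_refl c_sym c_trans eta_body_conv)

lemma cv_whnf_conv: "(\<And>t u. f t u \<Longrightarrow> t \<simeq> u) \<Longrightarrow> cv_whnf f t u \<Longrightarrow> t \<simeq> u"
  by (auto simp: cv_whnf_def intro: cv_neutral_conv eta_body_eq_conv split: if_splits)

lemma cv_conv: "cv n t u \<Longrightarrow> t \<simeq> u"
proof (induction n arbitrary: t u)
  case (Suc n)
  then show ?case
    by (auto split: if_splits intro: c_refl c_trans[OF c_sym[OF whnf_conv] c_trans[OF cv_whnf_conv whnf_conv]])
qed (simp add: c_refl)

section \<open>Bidirectional elaboration\<close>

fun get_Pi :: "tm \<Rightarrow> (tm \<times> tm) option" where
  "get_Pi (Pi A B) = Some (A, B)"
| "get_Pi t = None"

fun get_Sg :: "tm \<Rightarrow> (tm \<times> tm) option" where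
  "get_Sg (Sg A B) = Some (A, B)"
| "get_Sg t = None"

fun get_Eq :: "tm \<Rightarrow> (tm \<times> tm \<times> tm) option" where
  "get_Eq (Eq A t u) = Some (A, t, u)"
| "get_Eq t = None"

fun get_Univ :: "tm \<Rightarrow> nat option" where
  "get_Univ (Univ i) = Some i"
| "get_Univ t = None"

fun is_former :: "tm \<Rightarrow> bool" where
  "is_former (Pi A B) = True"
| "is_former (Sg A B) = True"
| "is_former (Eq A t u) = True"
| "is_former (Univ i) = True"
| "is_former t = False"

fun is_Some :: "'a option \<Rightarrow> bool" where
  "is_Some None = False"
| "is_Some (Some x) = True"

text \<open>Sixty is a budget that suffices for the derivations below; soundness holds for every
  value. It is an iterated \<open>Suc\<close> because \<open>whnf\<close> and \<open>cv\<close>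
  recurse on the constructors of \<open>nat\<close>.\<close>

definition fuel :: nat where "fuel = (Suc ^^ 60) 0"

text \<open>The reduct is an argument so that rewriting computes it before the body duplicates
  it.\<close>

definition expose' :: "(tm list \<Rightarrow> tm \<Rightarrow> bool) \<Rightarrow> tm list \<Rightarrow> tm \<Rightarrow> tm \<Rightarrow> tm" where
  "expose' rc \<Gamma> T T' = (if rc \<Gamma> T' then T' else T)"

definition expose :: "(tm list \<Rightarrow> tm \<Rightarrow> bool) \<Rightarrow> tm list \<Rightarrow> tm \<Rightarrow> tm" where
  "expose rc \<Gamma> T = (if is_former T then T else expose' rc \<Gamma> T (whnf fuel T))"

definition as_type :: "(tm \<times> tm) option \<Rightarrow> (tm \<times> nat) option" where
  "as_type r = Option.bind r (\<lambda>(A, T). Option.bind (get_Univ (whnf fuel T)) (\<lambda>i. Some (A, i)))"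

fun against :: "tm option \<Rightarrow> tm \<Rightarrow> tm \<Rightarrow> (tm \<times> tm) option" where
  "against None t T = Some (t, T)"
| "against (Some T') t T = (if cv fuel T T' then Some (t, T') else None)"

primrec nth_opt :: "'a list \<Rightarrow> nat \<Rightarrow> 'a option" where
  "nth_opt [] n = None"
| "nth_opt (x # xs) n = (case n of 0 \<Rightarrow> Some x | Suc n' \<Rightarrow> nth_opt xs n')"

primrec lookup :: "tm list \<Rightarrow> tm list \<Rightarrow> nat \<Rightarrow> (nat \<Rightarrow> nat) \<Rightarrow> tm option" where
  "lookup G [] n r = nth_opt G n"
| "lookup G (A # \<Gamma>) n r = (case n of 0 \<Rightarrow> Some (ren r A) | Suc n' \<Rightarrow> lookup G \<Gamma> n' (\<lambda>m. Suc (r m)))"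

text \<open>Since \<open>elab\<close> rejects \<open>Star\<close>, this marker cannot be confused
  with a motive or an annotation that could be elaborated.\<close>

definition dummy :: tm where "dummy = Star 0"

text \<open>\<open>elab rc G e \<Gamma> m\<close> infers the type of \<open>e\<close> if \<open>m = None\<close> and checks it against \<open>T\<close> if
  \<open>m = Some T\<close>; the result is the annotated term and its type.  The full context is \<open>\<Gamma> @ G\<close>, where
  the types in \<open>G\<close> are closed, so that they need not be weakened.  The conversion relation on raw terms
  does not obviously satisfy subject reduction; hence a type that had to be reduced in order to expose
  its head is checked again, by \<open>rc\<close>.\<close>

primrec elab :: "(tm list \<Rightarrow> tm \<Rightarrow> bool) \<Rightarrow> tm list \<Rightarrow> tm \<Rightarrow> tm list \<Rightarrow> tm option \<Rightarrow> (tm \<times> tm) option" where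
  "elab rc G (Var n) \<Gamma> m = Option.bind (lookup G \<Gamma> n Suc) (\<lambda>T. against m (Var n) T)"
| "elab rc G (Cst c) \<Gamma> m = (case c of Trunc i \<Rightarrow> against m (Cst (Trunc i)) (Pi (Univ i) (Univ i)) | _ \<Rightarrow> None)"
| "elab rc G (Univ i) \<Gamma> m = against m (Univ i) (Univ (Suc i))"
| "elab rc G (Pi A B) \<Gamma> m = Option.bind (as_type (elab rc G A \<Gamma> None)) (\<lambda>(A', i).
     Option.bind (as_type (elab rc G B (A' # \<Gamma>) None)) (\<lambda>(B', j). against m (Pi A' B') (Univ (max i j))))"
| "elab rc G (Lam A t) \<Gamma> m = (case m of
     None \<Rightarrow> Option.bind (as_type (elab rc G A \<Gamma> None)) (\<lambda>(A', i).
       Option.bind (elab rc G t (A' # \<Gamma>) None) (\<lambda>(t', B). Some (Lam A' t', Pi A' B)))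
   | Some T \<Rightarrow> Option.bind (get_Pi (expose rc \<Gamma> T)) (\<lambda>(A', B).
       Option.bind (elab rc G t (A' # \<Gamma>) (Some B)) (\<lambda>(t', B'). Some (Lam A' t', T))))"
| "elab rc G (App t u) \<Gamma> m = Option.bind (elab rc G t \<Gamma> None) (\<lambda>(t', T).
     Option.bind (get_Pi (expose rc \<Gamma> T)) (\<lambda>(A, B).
       Option.bind (elab rc G u \<Gamma> (Some A)) (\<lambda>(u', A'). against m (App t' u') (inst u' B))))"
| "elab rc G (Sg A B) \<Gamma> m = Option.bind (as_type (elab rc G A \<Gamma> None)) (\<lambda>(A', i).
     Option.bind (as_type (elab rc G B (A' # \<Gamma>) None)) (\<lambda>(B', j). against m (Sg A' B') (Univ (max i j))))"
| "elab rc G (Pr t u) \<Gamma> m = (case m of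
     None \<Rightarrow> None
   | Some T \<Rightarrow> Option.bind (get_Sg (expose rc \<Gamma> T)) (\<lambda>(A, B).
       Option.bind (elab rc G t \<Gamma> (Some A)) (\<lambda>(t', A').
         Option.bind (elab rc G u \<Gamma> (Some (inst t' B))) (\<lambda>(u', B'). Some (Pr t' u', T)))))"
| "elab rc G (Split C c p) \<Gamma> m = Option.bind (elab rc G p \<Gamma> None) (\<lambda>(p', T).
     Option.bind (get_Sg (expose rc \<Gamma> T)) (\<lambda>(A, B).
       if C = dummy \<and> c = Var (Suc 0) then against m (Split (ren Suc A) (Var (Suc 0)) p') A
       else if C = dummy \<and> c = Var 0 then
         against m (Split (snd_motive A B) (Var 0) p')
           (inst (Split (ren Suc A) (Var (Suc 0)) p') B)
       else Option.bind (as_type (elab rc G C (Sg A B # \<Gamma>) None)) (\<lambda>(C', k).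
         Option.bind (elab rc G c (B # A # \<Gamma>) (Some (sub (Pr (Var (Suc 0)) (Var 0) .: (\<lambda>n. Var (Suc (Suc n)))) C')))
           (\<lambda>(c', D). against m (Split C' c' p') (inst p' C')))))"
| "elab rc G (Eq A t u) \<Gamma> m = Option.bind (as_type (elab rc G A \<Gamma> None)) (\<lambda>(A', i).
     Option.bind (elab rc G t \<Gamma> (Some A')) (\<lambda>(t', T).
       Option.bind (elab rc G u \<Gamma> (Some A')) (\<lambda>(u', T'). against m (Eq A' t' u') (Univ i))))"
| "elab rc G (Refl t) \<Gamma> m = (case m of
     None \<Rightarrow> Option.bind (elab rc G t \<Gamma> None) (\<lambda>(t', A). Some (Refl t', Eq A t' t'))
   | Some T \<Rightarrow> Option.bind (get_Eq (expose rc \<Gamma> T)) (\<lambda>(A, a, b).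
       if cv fuel a b then Some (Refl a, T) else None))"
| "elab rc G (J C d p) \<Gamma> m = Option.bind (elab rc G p \<Gamma> None) (\<lambda>(p', T).
     Option.bind (get_Eq (expose rc \<Gamma> T)) (\<lambda>(A, t, u).
       Option.bind (as_type (elab rc G C (Eq (ren Suc A) (ren Suc t) (Var 0) # A # \<Gamma>) None)) (\<lambda>(C', k).
         Option.bind (elab rc G d \<Gamma> (Some (inst2 (Refl t) t C'))) (\<lambda>(d', D).
           against m (J C' d' p') (inst2 p' u C')))))"
| "elab rc G (Empty i) \<Gamma> m = None"
| "elab rc G (EmptyInd C e) \<Gamma> m = None"
| "elab rc G (Unit i) \<Gamma> m = None"
| "elab rc G (Star i) \<Gamma> m = None"
| "elab rc G (UnitInd C c u) \<Gamma> m = None"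
| "elab rc G (Plus A B) \<Gamma> m = None"
| "elab rc G (Inj1 t) \<Gamma> m = None"
| "elab rc G (Inj2 t) \<Gamma> m = None"
| "elab rc G (PlusInd C l r s) \<Gamma> m = None"
| "elab rc G NatT \<Gamma> m = None"
| "elab rc G Zero \<Gamma> m = None"
| "elab rc G (Succ t) \<Gamma> m = None"
| "elab rc G (NatInd C z s n) \<Gamma> m = None"

section \<open>Soundness of the elaborator\<close>

locale elab_sound =
  fixes \<Theta> :: "nat \<Rightarrow> tm option" and G :: "tm list" and rc :: "tm list \<Rightarrow> tm \<Rightarrow> bool"
  assumes closed: "T \<in> set G \<Longrightarrow> ren r T = T"
    and rc_sound: "rc \<Gamma> T \<Longrightarrow> wf \<Theta> (\<Gamma> @ G) \<Longrightarrow> \<exists>i. \<Theta>; \<Gamma> @ G \<turnstile> T : Univ i"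
begin

lemma expose_conv: "expose rc \<Gamma> T \<simeq> T"
  by (simp add: expose_def expose'_def c_refl whnf_conv)

lemma expose_type: "\<Theta>; \<Gamma> @ G \<turnstile> T : Univ i \<Longrightarrow> \<exists>j. \<Theta>; \<Gamma> @ G \<turnstile> expose rc \<Gamma> T : Univ j"
  using rc_sound[of \<Gamma> "whnf fuel T"] typing_wf by (auto simp: expose_def expose'_def)

lemma expose_typing: "\<Theta>; \<Gamma> @ G \<turnstile> t : T \<Longrightarrow> \<Theta>; \<Gamma> @ G \<turnstile> t : expose rc \<Gamma> T"
  proof -
  assume t: "\<Theta>; \<Gamma> @ G \<turnstile> t : T"
  obtain i where "\<Theta>; \<Gamma> @ G \<turnstile> T : Univ i" using typing_valid[OF t] ..
  then obtain j where "\<Theta>; \<Gamma> @ G \<turnstile> expose rc \<Gamma> T : Univ j" using expose_type by blast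
  from t_Conv[OF t this c_sym[OF expose_conv]] show ?thesis .
qed

lemma against_sound:
  assumes "against m t T = Some (t', T')" "\<Theta>; \<Delta> \<turnstile> t : T" "\<And>T. m = Some T \<Longrightarrow> \<exists>i. \<Theta>; \<Delta> \<turnstile> T : Univ i"
  shows "\<Theta>; \<Delta> \<turnstile> t' : T' \<and> (\<forall>T. m = Some T \<longrightarrow> T' = T)"
  using assms by (cases m) (auto split: if_splits dest: cv_conv intro: t_Conv)

text \<open>The reduct is a universe, which is a type in every well-formed context, so the
  conversion rule applies without consulting \<open>rc\<close>.\<close>

lemma as_type_sound:
  assumes "as_type r = Some (A, i)" "\<And>t T. r = Some (t, T) \<Longrightarrow> \<Theta>; \<Delta> \<turnstile> t : T"
  shows "\<Theta>; \<Delta> \<turnstile> A : Univ i"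
proof -
  obtain T where r: "r = Some (A, T)" and "get_Univ (whnf fuel T) = Some i"
    using assms(1) by (auto simp: as_type_def bind_eq_Some_conv)
  then have "whnf fuel T = Univ i" by (cases "whnf fuel T") auto
  then have "T \<simeq> Univ i" by (metis c_sym whnf_conv)
  then show ?thesis using assms(2)[OF r] by (meson t_Conv t_Univ typing_wf)
qed

lemma get_Pi_Some: "get_Pi T = Some (A, B) \<Longrightarrow> T = Pi A B"
  by (cases T) auto

lemma get_Sg_Some: "get_Sg T = Some (A, B) \<Longrightarrow> T = Sg A B"
  by (cases T) auto

lemma get_Eq_Some: "get_Eq T = Some (A, t, u) \<Longrightarrow> T = Eq A t u"
  by (cases T) auto

lemma nth_opt_Some: "nth_opt xs n = Some x \<Longrightarrow> n < length xs \<and> x = xs ! n"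
  by (induction xs arbitrary: n) (auto split: nat.splits)

text \<open>The renaming accumulated by \<open>lookup\<close> is generalised to \<open>k\<close>
  variables already passed. Within \<open>G\<close> it acts trivially because the types there are
  closed.\<close>

lemma lookup_Some:
  "lookup G \<Gamma> n (\<lambda>m. m + Suc k) = Some T \<Longrightarrow>
     n < length (\<Gamma> @ G) \<and> T = ren (\<lambda>m. m + Suc (n + k)) ((\<Gamma> @ G) ! n)"
proof (induction \<Gamma> arbitrary: n k)
  case Nil
  then show ?case using nth_opt_Some[of G n T] closed nth_mem by (metis append_Nil lookup.simps(1))
next
  case (Cons A \<Gamma>)
  show ?case
  proof (cases n)
    case 0 then show ?thesis using Cons.prems by auto
  next
    case (Suc j)
    then have "lookup G \<Gamma> j (\<lambda>m. m + Suc (Suc k)) = Some T" using Cons.prems by simp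
    from Cons.IH[OF this] show ?thesis using Suc by simp
  qed
qed

abbreviation sound :: "tm list \<Rightarrow> tm option \<Rightarrow> (tm \<times> tm) option \<Rightarrow> bool" where
  "sound \<Gamma> m r \<equiv> (\<forall>t T. r = Some (t, T) \<longrightarrow> \<Theta>; \<Gamma> @ G \<turnstile> t : T \<and> (\<forall>T'. m = Some T' \<longrightarrow> T = T'))"

theorem elab_sound:
  "wf \<Theta> (\<Gamma> @ G) \<Longrightarrow> (\<And>T. m = Some T \<Longrightarrow> \<exists>i. \<Theta>; \<Gamma> @ G \<turnstile> T : Univ i) \<Longrightarrow>
   elab rc G e \<Gamma> m = Some (t, T) \<Longrightarrow> \<Theta>; \<Gamma> @ G \<turnstile> t : T \<and> (\<forall>T'. m = Some T' \<longrightarrow> T = T')"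
proof (induction e arbitrary: \<Gamma> m t T)
  case (Var n)
  from Var.prems(3) obtain A where "lookup G \<Gamma> n Suc = Some A" and a: "against m (Var n) A = Some (t, T)"
    by (auto simp: bind_eq_Some_conv)
  then have "n < length (\<Gamma> @ G) \<and> A = ren (\<lambda>m. m + Suc n) ((\<Gamma> @ G) ! n)"
    using lookup_Some[of \<Gamma> n 0 A] by simp
  then have "\<Theta>; \<Gamma> @ G \<turnstile> Var n : A" using t_Var[OF Var.prems(1)] by metis
  from against_sound[OF a this Var.prems(2)] show ?case .
next
  case (Cst c)
  from Cst.prems(3) obtain i where c: "c = Trunc i" and a: "against m (Cst c) (Pi (Univ i) (Univ i)) = Some (t, T)"
    by (auto split: cst.splits)
  have "\<Theta>; [] \<turnstile> Pi (Univ i) (Univ i) : Univ (max (Suc i) (Suc i))"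
    by (intro t_Pi t_Univ wf_Cons[OF _ t_Univ] wf_Nil)
  then have "\<Theta>; \<Gamma> @ G \<turnstile> Cst c : Pi (Univ i) (Univ i)"
    using t_Cst[OF Cst.prems(1), of "Trunc i"] by (simp add: c PI_def U_def)
  from against_sound[OF a this Cst.prems(2)] show ?case .
next
  case (Univ i)
  from against_sound[OF Univ.prems(3)[unfolded elab.simps] t_Univ[OF Univ.prems(1)] Univ.prems(2)]
  show ?case .
next
  case (Pi A B)
  from Pi.prems(3) obtain A' i B' j where A: "as_type (elab rc G A \<Gamma> None) = Some (A', i)"
    and B: "as_type (elab rc G B (A' # \<Gamma>) None) = Some (B', j)"
    and a: "against m (Pi A' B') (Univ (max i j)) = Some (t, T)"
    by (auto simp: bind_eq_Some_conv)
  have A': "\<Theta>; \<Gamma> @ G \<turnstile> A' : Univ i" using as_type_sound[OF A] Pi.IH(1)[OF Pi.prems(1), of None] by simp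
  moreover have "\<Theta>; A' # \<Gamma> @ G \<turnstile> B' : Univ j"
    using as_type_sound[OF B] Pi.IH(2)[of "A' # \<Gamma>" None] wf_Cons[OF Pi.prems(1) A'] by simp
  ultimately have "\<Theta>; \<Gamma> @ G \<turnstile> Pi A' B' : Univ (max i j)" by (rule t_Pi)
  from against_sound[OF a this Pi.prems(2)] show ?case .
next
  case (Sg A B)
  from Sg.prems(3) obtain A' i B' j where A: "as_type (elab rc G A \<Gamma> None) = Some (A', i)"
    and B: "as_type (elab rc G B (A' # \<Gamma>) None) = Some (B', j)"
    and a: "against m (Sg A' B') (Univ (max i j)) = Some (t, T)"
    by (auto simp: bind_eq_Some_conv)
  have A': "\<Theta>; \<Gamma> @ G \<turnstile> A' : Univ i" using as_type_sound[OF A] Sg.IH(1)[OF Sg.prems(1), of None] by simp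
  moreover have "\<Theta>; A' # \<Gamma> @ G \<turnstile> B' : Univ j"
    using as_type_sound[OF B] Sg.IH(2)[of "A' # \<Gamma>" None] wf_Cons[OF Sg.prems(1) A'] by simp
  ultimately have "\<Theta>; \<Gamma> @ G \<turnstile> Sg A' B' : Univ (max i j)" by (rule t_Sg)
  from against_sound[OF a this Sg.prems(2)] show ?case .
next
  case (Lam A b)
  show ?case
  proof (cases m)
    case None
    then obtain A' i t' B where A: "as_type (elab rc G A \<Gamma> None) = Some (A', i)"
      and b: "elab rc G b (A' # \<Gamma>) None = Some (t', B)" and tT: "t = Lam A' t'" "T = Pi A' B"
      using Lam.prems(3) by (auto simp: bind_eq_Some_conv)
    have A': "\<Theta>; \<Gamma> @ G \<turnstile> A' : Univ i" using as_type_sound[OF A] Lam.IH(1)[OF Lam.prems(1), of None] by simp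
    have t': "\<Theta>; A' # \<Gamma> @ G \<turnstile> t' : B" using Lam.IH(2)[OF _ _ b] wf_Cons[OF Lam.prems(1) A'] by simp
    obtain j where "\<Theta>; A' # \<Gamma> @ G \<turnstile> B : Univ j" using typing_valid[OF t'] ..
    from t_Lam[OF A' this t'] have "\<Theta>; \<Gamma> @ G \<turnstile> Lam A' t' : Pi A' B" .
    then show ?thesis using tT None by simp
  next
    case (Some S)
    then obtain A' B t' B' where P: "get_Pi (expose rc \<Gamma> S) = Some (A', B)"
      and b: "elab rc G b (A' # \<Gamma>) (Some B) = Some (t', B')" and tT: "t = Lam A' t'" "T = S"
      using Lam.prems(3) by (auto simp: bind_eq_Some_conv)
    obtain i where S: "\<Theta>; \<Gamma> @ G \<turnstile> S : Univ i" using Lam.prems(2) Some by blast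
    obtain i j where AB: "\<Theta>; \<Gamma> @ G \<turnstile> A' : Univ i" "\<Theta>; A' # \<Gamma> @ G \<turnstile> B : Univ j"
      using expose_type[OF S] get_Pi_Some[OF P] Pi_inv by metis
    then have "\<Theta>; A' # \<Gamma> @ G \<turnstile> t' : B" using Lam.IH(2)[OF _ _ b] wf_Cons[OF Lam.prems(1)] by auto
    from t_Lam[OF AB this] have "\<Theta>; \<Gamma> @ G \<turnstile> Lam A' t' : Pi A' B" .
    moreover have "Pi A' B \<simeq> S" using expose_conv[of \<Gamma> S] get_Pi_Some[OF P] by simp
    ultimately have "\<Theta>; \<Gamma> @ G \<turnstile> Lam A' t' : S" by (rule t_Conv[OF _ S])
    then show ?thesis using tT Some by simp
  qed
next
  case (App f u)
  from App.prems(3) obtain t' S A B u' A' where f: "elab rc G f \<Gamma> None = Some (t', S)"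
    and P: "get_Pi (expose rc \<Gamma> S) = Some (A, B)"
    and u: "elab rc G u \<Gamma> (Some A) = Some (u', A')"
    and a: "against m (App t' u') (inst u' B) = Some (t, T)"
    by (auto simp: bind_eq_Some_conv)
  have "\<Theta>; \<Gamma> @ G \<turnstile> t' : S" using App.IH(1)[OF App.prems(1) _ f] by simp
  then have t': "\<Theta>; \<Gamma> @ G \<turnstile> t' : Pi A B" using expose_typing get_Pi_Some[OF P] by metis
  then obtain i where "\<Theta>; \<Gamma> @ G \<turnstile> A : Univ i" using typing_valid Pi_inv by metis
  then have "\<Theta>; \<Gamma> @ G \<turnstile> u' : A" using App.IH(2)[OF App.prems(1) _ u] by auto
  from against_sound[OF a t_App[OF t' this] App.prems(2)] show ?case .
next
  case (Pr a b)
  from Pr.prems(3) obtain S A B t' A' u' B' where m: "m = Some S" and P: "get_Sg (expose rc \<Gamma> S) = Some (A, B)"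
    and a: "elab rc G a \<Gamma> (Some A) = Some (t', A')"
    and b: "elab rc G b \<Gamma> (Some (inst t' B)) = Some (u', B')" and tT: "t = Pr t' u'" "T = S"
    by (auto simp: bind_eq_Some_conv split: option.splits)
  obtain i where S: "\<Theta>; \<Gamma> @ G \<turnstile> S : Univ i" using Pr.prems(2) m by blast
  obtain i j where AB: "\<Theta>; \<Gamma> @ G \<turnstile> A : Univ i" "\<Theta>; A # \<Gamma> @ G \<turnstile> B : Univ j"
    using expose_type[OF S] get_Sg_Some[OF P] Sg_inv by metis
  have t': "\<Theta>; \<Gamma> @ G \<turnstile> t' : A" using Pr.IH(1)[OF Pr.prems(1) _ a] AB by auto
  have "\<Theta>; \<Gamma> @ G \<turnstile> u' : inst t' B"
    using Pr.IH(2)[OF Pr.prems(1) _ b] typing_inst_Univ[OF AB(2) t'] by auto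
  from t_Pr[OF AB t' this] have "\<Theta>; \<Gamma> @ G \<turnstile> Pr t' u' : Sg A B" .
  moreover have "Sg A B \<simeq> S" using expose_conv[of \<Gamma> S] get_Sg_Some[OF P] by simp
  ultimately have "\<Theta>; \<Gamma> @ G \<turnstile> Pr t' u' : S" by (rule t_Conv[OF _ S])
  then show ?case using tT m by simp
next
  case (Split C c p)
  from Split.prems(3) obtain p' S A B where p: "elab rc G p \<Gamma> None = Some (p', S)"
    and P: "get_Sg (expose rc \<Gamma> S) = Some (A, B)"
    by (auto simp: bind_eq_Some_conv)
  have "\<Theta>; \<Gamma> @ G \<turnstile> p' : S" using Split.IH(3)[OF Split.prems(1) _ p] by simp
  then have p': "\<Theta>; \<Gamma> @ G \<turnstile> p' : Sg A B" using expose_typing get_Sg_Some[OF P] by metis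
  consider (fst) "C = dummy" "c = Var (Suc 0)" | (snd) "C = dummy" "c = Var 0"
    | (general) "\<not> (C = dummy \<and> c = Var (Suc 0))" "\<not> (C = dummy \<and> c = Var 0)" by blast
  then show ?case
  proof cases
    case fst
    then have "against m (Split (ren Suc A) (Var (Suc 0)) p') A = Some (t, T)"
      using Split.prems(3) p P by simp
    from against_sound[OF this typing_fst[OF p'] Split.prems(2)] show ?thesis .
  next
    case snd
    then have "against m (Split (snd_motive A B) (Var 0) p') (inst (Split (ren Suc A) (Var (Suc 0)) p') B) = Some (t, T)"
      using Split.prems(3) p P by simp
    from against_sound[OF this typing_snd[OF p'] Split.prems(2)] show ?thesis .
  next
    case c: general
    obtain C' k c' D where general: "as_type (elab rc G C (Sg A B # \<Gamma>) None) = Some (C', k)"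
      "elab rc G c (B # A # \<Gamma>) (Some (sub (Pr (Var (Suc 0)) (Var 0) .: (\<lambda>n. Var (Suc (Suc n)))) C')) = Some (c', D)"
      "against m (Split C' c' p') (inst p' C') = Some (t, T)"
      using Split.prems(3) p P c by (simp only: elab.simps bind.simps prod.case if_False) (auto simp: bind_eq_Some_conv)
    obtain l where SAB: "\<Theta>; \<Gamma> @ G \<turnstile> Sg A B : Univ l" using typing_valid[OF p'] by blast
    have C': "\<Theta>; Sg A B # \<Gamma> @ G \<turnstile> C' : Univ k"
      using as_type_sound[OF general(1)] Split.IH(1)[of "Sg A B # \<Gamma>" None] wf_Cons[OF Split.prems(1) SAB] by simp
    have "\<Theta>; B # A # \<Gamma> @ G \<turnstile> sub (Pr (Var (Suc 0)) (Var 0) .: (\<lambda>n. Var (Suc (Suc n)))) C' : Univ k"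
      using typing_sub[OF C' sub_ok_Pr[OF SAB]] by simp
    moreover from typing_wf[OF this] have "wf \<Theta> (B # A # \<Gamma> @ G)" .
    ultimately have c': "\<Theta>; B # A # \<Gamma> @ G \<turnstile> c' : sub (Pr (Var (Suc 0)) (Var 0) .: (\<lambda>n. Var (Suc (Suc n)))) C'"
      using Split.IH(2)[OF _ _ general(2)] by auto
    then have "\<Theta>; \<Gamma> @ G \<turnstile> Split C' c' p' : inst p' C'" by (intro t_Split[OF C' _ p']) simp
    from against_sound[OF general(3) this Split.prems(2)] show ?thesis .
  qed
next
  case (Eq A a b)
  from Eq.prems(3) obtain A' i t' T1 u' T2 where A: "as_type (elab rc G A \<Gamma> None) = Some (A', i)"
    and t: "elab rc G a \<Gamma> (Some A') = Some (t', T1)"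
    and u: "elab rc G b \<Gamma> (Some A') = Some (u', T2)"
    and a: "against m (Eq A' t' u') (Univ i) = Some (t, T)"
    by (auto simp: bind_eq_Some_conv)
  have A': "\<Theta>; \<Gamma> @ G \<turnstile> A' : Univ i" using as_type_sound[OF A] Eq.IH(1)[OF Eq.prems(1), of None] by simp
  have "\<Theta>; \<Gamma> @ G \<turnstile> t' : A'" using Eq.IH(2)[OF Eq.prems(1) _ t] A' by auto
  moreover have "\<Theta>; \<Gamma> @ G \<turnstile> u' : A'" using Eq.IH(3)[OF Eq.prems(1) _ u] A' by auto
  ultimately have "\<Theta>; \<Gamma> @ G \<turnstile> Eq A' t' u' : Univ i" by (rule t_Eq[OF A'])
  from against_sound[OF a this Eq.prems(2)] show ?case .
next
  case (Refl a)
  show ?case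
  proof (cases m)
    case None
    with Refl.prems(3) obtain t' A where a: "elab rc G a \<Gamma> None = Some (t', A)" and tT: "t = Refl t'" "T = Eq A t' t'"
      by (auto simp: bind_eq_Some_conv)
    have t': "\<Theta>; \<Gamma> @ G \<turnstile> t' : A" using Refl.IH[OF Refl.prems(1) _ a] by simp
    obtain i where "\<Theta>; \<Gamma> @ G \<turnstile> A : Univ i" using typing_valid[OF t'] ..
    from t_Refl[OF this t'] show ?thesis using tT None by simp
  next
    case (Some S)
    with Refl.prems(3) obtain A x y where P: "get_Eq (expose rc \<Gamma> S) = Some (A, x, y)"
      and c: "cv fuel x y" and tT: "t = Refl x" "T = S"
      unfolding elab.simps by (cases "get_Eq (expose rc \<Gamma> S)") (simp_all split: prod.splits if_splits)
    obtain i where S: "\<Theta>; \<Gamma> @ G \<turnstile> S : Univ i" using Refl.prems(2)[OF Some] ..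
    obtain k where k: "\<Theta>; \<Gamma> @ G \<turnstile> Eq A x y : Univ k"
      using expose_type[OF S] unfolding get_Eq_Some[OF P] ..
    obtain j where A: "\<Theta>; \<Gamma> @ G \<turnstile> A : Univ j" and x: "\<Theta>; \<Gamma> @ G \<turnstile> x : A" using Eq_inv[OF k] by blast
    have "Eq A x x \<simeq> Eq A x y" by (rule c_Eq[OF c_refl c_refl cv_conv[OF c]])
    from c_trans[OF this expose_conv[of \<Gamma> S, unfolded get_Eq_Some[OF P]]]
    have "\<Theta>; \<Gamma> @ G \<turnstile> Refl x : S" by (rule t_Conv[OF t_Refl[OF A x] S])
    then show ?thesis using tT Some by simp
  qed
next
  case (J C d p)
  from J.prems(3) obtain p' S A a b C' k d' D where p: "elab rc G p \<Gamma> None = Some (p', S)"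
    and P: "get_Eq (expose rc \<Gamma> S) = Some (A, a, b)"
    and C: "as_type (elab rc G C (Eq (ren Suc A) (ren Suc a) (Var 0) # A # \<Gamma>) None) = Some (C', k)"
    and d: "elab rc G d \<Gamma> (Some (inst2 (Refl a) a C')) = Some (d', D)"
    and ag: "against m (J C' d' p') (inst2 p' b C') = Some (t, T)"
    by (auto simp: bind_eq_Some_conv)
  have "\<Theta>; \<Gamma> @ G \<turnstile> p' : S" using J.IH(3)[OF J.prems(1) _ p] by simp
  then have p': "\<Theta>; \<Gamma> @ G \<turnstile> p' : Eq A a b" using expose_typing get_Eq_Some[OF P] by metis
  then obtain l where l: "\<Theta>; \<Gamma> @ G \<turnstile> Eq A a b : Univ l" using typing_valid by blast
  obtain i where A: "\<Theta>; \<Gamma> @ G \<turnstile> A : Univ i" and a: "\<Theta>; \<Gamma> @ G \<turnstile> a : A" and b: "\<Theta>; \<Gamma> @ G \<turnstile> b : A"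
    using Eq_inv[OF l] by blast
  have wfA: "wf \<Theta> (A # \<Gamma> @ G)" using wf_Cons[OF J.prems(1) A] .
  have "\<Theta>; A # \<Gamma> @ G \<turnstile> Eq (ren Suc A) (ren Suc a) (Var 0) : Univ i"
    using t_Eq[OF typing_weaken[OF A A, unfolded ren.simps] typing_weaken[OF a A], of "Var 0"] t_Var[OF wfA, of 0] by simp
  then have wf2: "wf \<Theta> (Eq (ren Suc A) (ren Suc a) (Var 0) # A # \<Gamma> @ G)" using wfA wf_Cons by blast
  have C': "\<Theta>; Eq (ren Suc A) (ren Suc a) (Var 0) # A # \<Gamma> @ G \<turnstile> C' : Univ k"
    using as_type_sound[OF C] J.IH(1)[of "Eq (ren Suc A) (ren Suc a) (Var 0) # A # \<Gamma>" None] wf2 by simp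
  have "\<Theta>; \<Gamma> @ G \<turnstile> inst2 (Refl a) a C' : Univ k"
    using typing_inst2[OF C' a, of "Refl a"] t_Refl[OF A a] by simp
  then have "\<Theta>; \<Gamma> @ G \<turnstile> d' : inst2 (Refl a) a C'" using J.IH(2)[OF J.prems(1) _ d] by auto
  from against_sound[OF ag t_J[OF C' this b p'] J.prems(2)] show ?case .
\<comment> \<open>The constructors left are those on which \<open>elab\<close> returns
  \<open>None\<close>.\<close>
qed (unfold elab.simps, (erule option.distinct(1)[THEN notE])+)

end


section \<open>Proving types inhabited\<close>

lemma elab_sound_empty:
  "(\<And>T r. T \<in> set G \<Longrightarrow> ren r T = T) \<Longrightarrow> elab_sound \<Theta> G (\<lambda>\<Gamma> T. False)"
  by unfold_locales auto

text \<open>The inner run uses a checker that refuses everything, so rechecking does not recurse.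
  Its result has to be \<open>T\<close> itself, since otherwise only a differently annotated term
  would have been shown to be a type.\<close>

definition recheck :: "tm list \<Rightarrow> tm list \<Rightarrow> tm \<Rightarrow> bool" where
  "recheck G \<Gamma> T = (case as_type (elab (\<lambda>\<Gamma> T. False) G T \<Gamma> None) of None \<Rightarrow> False | Some (T', i) \<Rightarrow> T' = T)"

lemma elab_sound_recheck:
  assumes "\<And>T r. T \<in> set G \<Longrightarrow> ren r T = T"
  shows "elab_sound \<Theta> G (recheck G)"
proof
  fix \<Gamma> T assume T: "recheck G \<Gamma> T" and wf: "wf \<Theta> (\<Gamma> @ G)"
  interpret elab_sound \<Theta> G "\<lambda>\<Gamma> T. False" using elab_sound_empty[OF assms] .
  obtain i where "as_type (elab (\<lambda>\<Gamma> T. False) G T \<Gamma> None) = Some (T, i)"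
    using T by (auto simp: recheck_def split: option.splits)
  from as_type_sound[OF this] elab_sound[OF wf, of None]
  show "\<exists>i. \<Theta>; \<Gamma> @ G \<turnstile> T : Univ i" by blast
qed (fact assms)

definition closed_type :: "tm \<Rightarrow> bool" where
  "closed_type T = recheck [] [] T"

lemma closed_type_sound: "closed_type T \<Longrightarrow> \<exists>i. \<Theta>; [] \<turnstile> T : Univ i"
  using elab_sound.rc_sound[OF elab_sound_recheck[of "[]" \<Theta>], of "[]" T] wf_Nil
  by (simp add: closed_type_def)

lemma sub_ok_closed:
  assumes "\<And>n. n < length G \<Longrightarrow> \<Theta>; [] \<turnstile> s n : G ! n"
  shows "sub_ok \<Theta> s G []"
  unfolding sub_ok_def
proof (intro conjI allI impI wf_Nil)
  fix n assume n: "n < length G"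
  obtain i where "\<Theta>; [] \<turnstile> G ! n : Univ i" using typing_valid[OF assms[OF n]] ..
  then show "\<Theta>; [] \<turnstile> s n : sub s (ren (\<lambda>m. m + Suc n) (G ! n))"
    using assms[OF n] by (simp add: ren_closed sub_closed)
qed

lemma wf_closed:
  assumes "\<And>T. T \<in> set G \<Longrightarrow> \<exists>i. \<Theta>; [] \<turnstile> T : Univ i"
  shows "wf \<Theta> G"
  using assms
proof (induction G)
  case (Cons T G)
  then have wf: "wf \<Theta> G" by simp
  obtain i where "\<Theta>; [] \<turnstile> T : Univ i" using Cons.prems[of T] by auto
  from wf_Cons[OF wf typing_closed[OF this wf]] show ?case .
qed (rule wf_Nil)

text \<open>The types in \<open>Ts\<close> are the lemmas that the term \<open>e\<close> may use, as variables of levels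
  \<open>0, 1, \<dots>\<close>.\<close>

lemma inhabitedI:
  assumes Ts: "list_all (inhabited \<Theta>) Ts" and T: "closed_type (T 0)"
    and e: "let G = rev (map (\<lambda>T. T 0) Ts) in is_Some (elab (recheck G) G (e (length Ts)) [] (Some (T 0)))"
  shows "inhabited \<Theta> T"
proof -
  define G where "G = rev (map (\<lambda>T. T 0) Ts)"
  have G: "\<exists>t. \<Theta>; [] \<turnstile> t : S" if "S \<in> set G" for S
    using that Ts by (auto simp: G_def list_all_iff inhabited_def closed_of_type_def)
  then have Gt: "\<exists>i. \<Theta>; [] \<turnstile> S : Univ i" if "S \<in> set G" for S using that typing_valid by blast
  interpret elab_sound \<Theta> G "recheck G"
    by (rule elab_sound_recheck) (metis Gt ren_closed)
  obtain i where i: "\<Theta>; [] \<turnstile> T 0 : Univ i" using closed_type_sound[OF T] ..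
  have wf: "wf \<Theta> ([] @ G)" using wf_closed[OF Gt] by simp
  have iG: "\<Theta>; [] @ G \<turnstile> T 0 : Univ i" using typing_closed[OF i wf] .
  obtain t S where tS: "elab (recheck G) G (e (length Ts)) [] (Some (T 0)) = Some (t, S)"
    using e[folded G_def, unfolded Let_def] by (cases "elab (recheck G) G (e (length Ts)) [] (Some (T 0))") auto
  have t: "\<Theta>; G \<turnstile> t : T 0" using elab_sound[OF wf _ tS] iG by auto
  \<comment> \<open>So far the lemmas are free variables of \<open>t\<close>. Closed inhabitants are
    chosen for all of them and substituted; \<open>T 0\<close> is closed and stays as it is.\<close>
  have "\<forall>n<length G. \<exists>t. \<Theta>; [] \<turnstile> t : G ! n" using G by simp
  then obtain s where "\<And>n. n < length G \<Longrightarrow> \<Theta>; [] \<turnstile> s n : G ! n" by metis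
  from typing_sub[OF t sub_ok_closed[OF this]] have "\<Theta>; [] \<turnstile> sub s t : T 0"
    by (simp add: sub_closed[OF i])
  then show ?thesis by (auto simp: inhabited_def closed_of_type_def)
qed

text \<open>Among the constants \<open>elab\<close> handles only \<open>Trunc\<close>. The other
  postulates enter a derivation as lemmas, and this fact provides them.\<close>

lemma inhabited_Cst:
  assumes "cst_type \<Theta> c = Some (T 0)" "closed_type (T 0)"
  shows "inhabited \<Theta> T"
  using closed_type_sound[OF assms(2)] t_Cst[OF wf_Nil assms(1)]
  by (auto simp: inhabited_def closed_of_type_def)

text \<open>The annotation \<open>dummy\<close> of an abstraction and the motive \<open>dummy\<close> of a projection are filled in by
  the elaborator.  Types that are to be proved inhabited must be fully annotated and use \<open>proj1\<close>
  instead of \<open>FST\<close>.\<close>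

definition LM :: "(stm \<Rightarrow> stm) \<Rightarrow> stm" (binder "\<^bold>\<lambda>" 10) where
  "LM t = (\<lambda>d. Lam dummy (t (bvar d) (Suc d)))"

definition PR :: "stm \<Rightarrow> stm \<Rightarrow> stm" where
  "PR t u = (\<lambda>d. Pr (t d) (u d))"

definition FST :: "stm \<Rightarrow> stm" where
  "FST p = (\<lambda>d. Split dummy (Var (Suc 0)) (p d))"

definition SND :: "stm \<Rightarrow> stm" where
  "SND p = (\<lambda>d. Split dummy (Var 0) (p d))"

definition proj1 :: "stm \<Rightarrow> stm \<Rightarrow> stm" where
  "proj1 A p = (\<lambda>d. Split (ren Suc (A d)) (Var (Suc 0)) (p d))"

definition SPLIT :: "(stm \<Rightarrow> stm) \<Rightarrow> (stm \<Rightarrow> stm \<Rightarrow> stm) \<Rightarrow> stm \<Rightarrow> stm" where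
  "SPLIT C c p = (\<lambda>d. Split (C (bvar d) (Suc d)) (c (bvar d) (bvar (Suc d)) (Suc (Suc d))) (p d))"

definition REFL :: "stm \<Rightarrow> stm" where
  "REFL t = (\<lambda>d. Refl (t d))"

definition RFL :: stm where
  "RFL = (\<lambda>d. Refl dummy)"

definition JJ :: "(stm \<Rightarrow> stm \<Rightarrow> stm) \<Rightarrow> stm \<Rightarrow> stm \<Rightarrow> stm" where
  "JJ C t p = (\<lambda>d. J (C (bvar d) (bvar (Suc d)) (Suc (Suc d))) (t d) (p d))"

lemma stm_apply:
  "PI A B d = Pi (A d) (B (bvar d) (Suc d))" "LAM A t d = Lam (A d) (t (bvar d) (Suc d))"
  "SG A B d = Sg (A d) (B (bvar d) (Suc d))" "(f \<cdot> u) d = App (f d) (u d)"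
  "(a =\<^bsub>A\<^esub> b) d = Eq (A d) (a d) (b d)" "U i d = Univ i" "K c d = Cst c" "bvar l d = Var (d - Suc l)"
  "LM t d = Lam dummy (t (bvar d) (Suc d))" "PR f u d = Pr (f d) (u d)"
  "FST p d = Split dummy (Var (Suc 0)) (p d)" "SND p d = Split dummy (Var 0) (p d)"
  "proj1 A p d = Split (ren Suc (A d)) (Var (Suc 0)) (p d)"
  "SPLIT C br p d = Split (C (bvar d) (Suc d)) (br (bvar d) (bvar (Suc d)) (Suc (Suc d))) (p d)"
  "REFL f d = Refl (f d)" "RFL d = Refl dummy"
  "JJ M f p d = J (M (bvar d) (bvar (Suc d)) (Suc (Suc d))) (f d) (p d)"
  by (simp_all add: PI_def LAM_def SG_def app_def ID_def U_def K_def bvar_def LM_def PR_def FST_def SND_def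
      proj1_def SPLIT_def REFL_def RFL_def JJ_def)

text \<open>For \<open>X : U i\<close> this type lies in \<open>U (max i (Suc j))\<close>, above the
  universe wanted for the quotient; replacement has to bring the image of the predicate map
  down.\<close>

definition subsets :: "nat \<Rightarrow> stm \<Rightarrow> stm" where
  "subsets j X = (\<Sigma> S\<in>(X \<rightarrow> U j). \<Pi> x\<in>X. isProp (S \<cdot> x))"

definition member :: "nat \<Rightarrow> stm \<Rightarrow> stm \<Rightarrow> stm \<Rightarrow> stm" where
  "member j X u x = proj1 (X \<rightarrow> U j) u \<cdot> x"

text \<open>Maps in both directions stay in \<open>U (max i j)\<close>, whereas identifications
  between propositions of \<open>U j\<close> would live in \<open>U (Suc j)\<close>.\<close>

definition same_members :: "nat \<Rightarrow> stm \<Rightarrow> stm \<Rightarrow> stm \<Rightarrow> stm" where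
  "same_members j X u v =
     (\<Pi> x\<in>X. (member j X u x \<rightarrow> member j X v x) \<otimes> (member j X v x \<rightarrow> member j X u x))"

definition fibre :: "stm \<Rightarrow> stm \<Rightarrow> stm \<Rightarrow> stm \<Rightarrow> stm" where
  "fibre X Y f y = (\<Sigma> x\<in>X. f \<cdot> x =\<^bsub>Y\<^esub> y)"

definition surjective :: "nat \<Rightarrow> stm \<Rightarrow> stm \<Rightarrow> stm \<Rightarrow> stm" where
  "surjective k X Y f = (\<Pi> y\<in>Y. K (Trunc k) \<cdot> fibre X Y f y)"

definition effective :: "stm \<Rightarrow> stm \<Rightarrow> stm \<Rightarrow> stm \<Rightarrow> stm" where
  "effective X R Y f = (\<Pi> x\<in>X. \<Pi> y\<in>X. f \<cdot> x =\<^bsub>Y\<^esub> f \<cdot> y \<rightarrow> R \<cdot> x \<cdot> y)"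

text \<open>No universe of targets occurs here. Together the four properties yield the universal
  property and the induction principle at every level, so one quotient serves all levels.\<close>

definition quotient_props :: "nat \<Rightarrow> nat \<Rightarrow> stm \<Rightarrow> stm \<Rightarrow> stm \<Rightarrow> stm \<Rightarrow> stm" where
  "quotient_props i j X R Q h =
     isSet Q \<otimes> identifies X R Q h \<otimes> effective X R Q h \<otimes> surjective (max i j) X Q h"

text \<open>The value at \<open>q\<close> of the map on the quotient that \<open>f\<close> induces, with a description that
  makes it unique.\<close>

definition value_at :: "stm \<Rightarrow> stm \<Rightarrow> stm \<Rightarrow> stm \<Rightarrow> stm \<Rightarrow> stm \<Rightarrow> stm" where
  "value_at X Q h A f q = (\<Sigma> a\<in>A. \<Pi> x\<in>X. h \<cdot> x =\<^bsub>Q\<^esub> q \<rightarrow> f \<cdot> x =\<^bsub>A\<^esub> a)"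

text \<open>The existence of quotients as hypotheses inside the type theory, at the two levels
  required: the image, used as a target of the universal property, lies in
  \<open>U (max k l)\<close>; the statement proved by induction, injectivity of the map from the
  quotient to the image, lies in the join with the level of the quotient.\<close>

definition given_quotients :: "nat \<Rightarrow> nat \<Rightarrow> nat \<Rightarrow> nat \<Rightarrow> stm \<Rightarrow> stm" where
  "given_quotients i j k l T =
     (\<Pi> QQ\<in>for_eqrels i j (\<lambda>X R e. U (max i j)). \<Pi> hh\<in>for_eqrels i j (\<lambda>X R e. X \<rightarrow> QQ \<cdot> X \<cdot> R \<cdot> e).
      for_eqrels i j (\<lambda>X R e. isSet (QQ \<cdot> X \<cdot> R \<cdot> e)) \<rightarrow>
      for_eqrels i j (\<lambda>X R e. identifies X R (QQ \<cdot> X \<cdot> R \<cdot> e) (hh \<cdot> X \<cdot> R \<cdot> e)) \<rightarrow>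
      for_eqrels i j (\<lambda>X R e. quotient_universal (max k l) X R (QQ \<cdot> X \<cdot> R \<cdot> e) (hh \<cdot> X \<cdot> R \<cdot> e)) \<rightarrow>
      for_eqrels i j (\<lambda>X R e. quotient_induction (max (max i j) (max k l)) X
        (QQ \<cdot> X \<cdot> R \<cdot> e) (hh \<cdot> X \<cdot> R \<cdot> e)) \<rightarrow> T)"

lemma isProp_apply: "isProp A d = (\<Pi> x\<in>A. \<Pi> y\<in>A. x =\<^bsub>A\<^esub> y) d"
  and isSet_apply: "isSet A d = (\<Pi> x\<in>A. \<Pi> y\<in>A. isProp (x =\<^bsub>A\<^esub> y)) d"
  and isContr_apply: "isContr A d = (\<Sigma> c\<in>A. \<Pi> x\<in>A. c =\<^bsub>A\<^esub> x) d"
  by (simp_all add: isProp_def isSet_def isContr_def)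

lemmas def_apply = isProp_apply isSet_apply isContr_apply isEquiv_def equiv_def isSmall_def isLocallySmall_def
  image_def replacement_type_def[THEN fun_cong] isEqRel_def identifies_def quotient_universal_def quotient_induction_def for_eqrels_def
  subsets_def member_def same_members_def fibre_def surjective_def effective_def value_at_def quotient_props_def given_quotients_def

lemma dummy_simps:
  "(dummy = dummy) = True"
  "(Pi A B = dummy) = False" "(Sg A B = dummy) = False" "(Eq A t u = dummy) = False" "(Univ i = dummy) = False"
  "(App t u = dummy) = False" "(Lam A t = dummy) = False" "(Split A t u = dummy) = False"
  "(J A t u = dummy) = False" "(Var n = dummy) = False"
  by (simp_all add: dummy_def)

lemma fuel_eq: "fuel = Suc (Suc (Suc (Suc (Suc (Suc (Suc (Suc (Suc (Suc (Suc (Suc (Suc (Suc (Suc (Suc (Suc (Suc (Suc (Suc (Suc (Suc (Suc (Suc (Suc (Suc (Suc (Suc (Suc (Suc (Suc (Suc (Suc (Suc (Suc (Suc (Suc (Suc (Suc (Suc (Suc (Suc (Suc (Suc (Suc (Suc (Suc (Suc (Suc (Suc (Suc (Suc (Suc (Suc (Suc (Suc (Suc (Suc (Suc (Suc (0))))))))))))))))))))))))))))))))))))))))))))))))))))))))))))"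
  by (simp add: fuel_def eval_nat_numeral)

text \<open>As a congruence rule it keeps the simplifier out of the continuation \<open>f\<close>
  until the bound result is known, so that rewriting runs the elaborator in order.\<close>

lemma bind_cong_weak: "x = y \<Longrightarrow> Option.bind x f = Option.bind y f"
  by simp

lemma le_Suc_self: "(n::nat) \<le> Suc n"
  by simp

lemma max_left_absorb: "(x::nat) \<le> y \<Longrightarrow> max x y = y"
  by (rule max_absorb2)

lemma max_0: "max 0 (x::nat) = x" "max x (0::nat) = x"
  by simp_all

text \<open>The universe levels of the types to be compared contain variables; they are normalised as
  joins.\<close>

lemmas level_simps = max.assoc max.commute max.left_commute max_left_absorb le_max_iff_disj le_Suc_self
  order.refl max_0

lemma bool_simps:
  "(True \<and> P) = P" "(P \<and> True) = P" "(False \<and> P) = False" "(P \<and> False) = False"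
  "(True \<or> P) = True" "(P \<or> True) = True" "(False \<or> P) = P" "(P \<or> False) = P"
  by simp_all

lemma nat_simps:
  "(Suc m - Suc n) = m - n" "n - 0 = n" "0 - n = (0::nat)" "(Suc m = Suc n) = (m = n)" "(Suc m = 0) = False" "(0 = Suc m) = False"
  "Suc m + n = Suc (m + n)" "0 + n = (n::nat)"
  by simp_all

lemma list_simps:
  "length [] = 0" "length (x # xs) = Suc (length xs)" "rev xs = fold (#) xs []"
  "fold f [] y = y" "fold f (x # xs) y = fold f xs (f x y)" "map h [] = []" "map h (x # xs) = h x # map h xs"
  by (simp_all add: fold_Cons_rev)

lemma list_all_simps: "list_all P []" "list_all P (x # xs) = (P x \<and> list_all P xs)"
  by simp_all

named_theorems inh and ty_apply

text \<open>The evaluation has to be symbolic because the universe levels are free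
  variables.\<close>

lemmas elab_eval = elab.simps against.simps as_type_def recheck_def expose_def expose'_def closed_type_def
  is_former.simps get_Pi.simps get_Sg.simps get_Eq.simps get_Univ.simps is_Some.simps nth_opt.simps lookup.simps
  whnf.simps wh_step.simps wh_App.simps wh_Split.simps wh_J.simps cv.simps cv_whnf_def cv_neutral.simps
  eta_body.simps is_Lam.simps snd_motive_def
  sub.simps ren.simps scons_0 scons_Suc up_0 up_Suc upr_0 upr_Suc
  option.case prod.case bind.simps nat.case cst.case tm.case if_True if_False refl
  tm.inject tm.distinct cst.inject cst.distinct dummy_simps bool_simps nat_simps level_simps list_simps
  stm_apply def_apply fuel_eq numeral_nat list_all_simps Let_def

lemmas elab_cong = bind_cong_weak if_weak_cong option.case_cong_weak prod.case_cong_weak nat.case_cong_weak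
  tm.case_cong_weak cst.case_cong_weak let_weak_cong


section \<open>Lemmas of type theory\<close>

text \<open>Each \<open>ty_x\<close> is the statement of a lemma inside the type theory, and \<open>inh_x\<close> says that it is
  derivable at all universe levels.\<close>

definition ty_funext :: "nat \<Rightarrow> nat \<Rightarrow> stm" where
  "ty_funext i j =
    (\<Pi> X\<in>U i. \<Pi> Y\<in>(X \<rightarrow> U j). \<Pi> f\<in>(\<Pi> x\<in>X. Y \<cdot> x). \<Pi> g\<in>(\<Pi> x\<in>X. Y \<cdot> x). (\<Pi> x\<in>X. f \<cdot> x =\<^bsub>Y \<cdot> x\<^esub> g \<cdot> x) \<rightarrow>
      f =\<^bsub>(\<Pi> x\<in>X. Y \<cdot> x)\<^esub> g)"

lemmas [ty_apply] = ty_funext_def[THEN fun_cong]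

lemma inh_funext [inh]: "inhabited \<Theta> (ty_funext i j)"
  by (rule inhabited_Cst[where c="FunExt i j"])
    (simp_all only: cst_type.simps elab_eval ty_apply cong: elab_cong)

definition ty_tr :: "nat \<Rightarrow> nat \<Rightarrow> stm" where
  "ty_tr i j = (\<Pi> A\<in>U i. \<Pi> P\<in>(A \<rightarrow> U j). \<Pi> x\<in>A. \<Pi> y\<in>A. x =\<^bsub>A\<^esub> y \<rightarrow> P \<cdot> x \<rightarrow> P \<cdot> y)"

lemmas [ty_apply] = ty_tr_def[THEN fun_cong]

lemma inh_tr [inh]: "inhabited \<Theta> (ty_tr i j)"
  by (rule inhabitedI[where
      Ts="[]" and
      e="\<^bold>\<lambda>A P x y p u. JJ (\<lambda>y q. P \<cdot> y) u p"])
    (simp_all only: elab_eval ty_apply inh cong: elab_cong)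

definition ty_sym :: "nat \<Rightarrow> stm" where
  "ty_sym i = (\<Pi> A\<in>U i. \<Pi> x\<in>A. \<Pi> y\<in>A. x =\<^bsub>A\<^esub> y \<rightarrow> y =\<^bsub>A\<^esub> x)"

lemmas [ty_apply] = ty_sym_def[THEN fun_cong]

lemma inh_sym [inh]: "inhabited \<Theta> (ty_sym i)"
  by (rule inhabitedI[where
      Ts="[]" and
      e="\<^bold>\<lambda>A x y p. JJ (\<lambda>y q. y =\<^bsub>A\<^esub> x) RFL p"])
    (simp_all only: elab_eval ty_apply inh cong: elab_cong)

definition ty_trans :: "nat \<Rightarrow> stm" where
  "ty_trans i = (\<Pi> A\<in>U i. \<Pi> x\<in>A. \<Pi> y\<in>A. \<Pi> z\<in>A. x =\<^bsub>A\<^esub> y \<rightarrow> y =\<^bsub>A\<^esub> z \<rightarrow> x =\<^bsub>A\<^esub> z)"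

lemmas [ty_apply] = ty_trans_def[THEN fun_cong]

lemma inh_trans [inh]: "inhabited \<Theta> (ty_trans i)"
  by (rule inhabitedI[where
      Ts="[]" and
      e="\<^bold>\<lambda>A x y z p q. JJ (\<lambda>z q. x =\<^bsub>A\<^esub> z) p q"])
    (simp_all only: elab_eval ty_apply inh cong: elab_cong)

definition ty_ap :: "nat \<Rightarrow> nat \<Rightarrow> stm" where
  "ty_ap i j = (\<Pi> A\<in>U i. \<Pi> B\<in>U j. \<Pi> f\<in>(A \<rightarrow> B). \<Pi> x\<in>A. \<Pi> y\<in>A. x =\<^bsub>A\<^esub> y \<rightarrow> f \<cdot> x =\<^bsub>B\<^esub> f \<cdot> y)"

lemmas [ty_apply] = ty_ap_def[THEN fun_cong]

lemma inh_ap [inh]: "inhabited \<Theta> (ty_ap i j)"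
  by (rule inhabitedI[where
      Ts="[]" and
      e="\<^bold>\<lambda>A B f x y p. JJ (\<lambda>y q. f \<cdot> x =\<^bsub>B\<^esub> f \<cdot> y) RFL p"])
    (simp_all only: elab_eval ty_apply inh cong: elab_cong)

text \<open>Concatenation with \<open>w\<close> has a retraction that maps \<open>w\<close> to reflexivity. Opaque inverses and
  concatenations would not suffice in the next lemma.\<close>

definition ty_cancel :: "nat \<Rightarrow> stm" where
  "ty_cancel i =
    (\<Pi> A\<in>U i. \<Pi> x\<in>A. \<Pi> y\<in>A. \<Pi> w\<in>(x =\<^bsub>A\<^esub> y). \<Sigma> k\<in>(\<Pi> z\<in>A. x =\<^bsub>A\<^esub> z \<rightarrow> y =\<^bsub>A\<^esub> z). k \<cdot> y \<cdot>
      w =\<^bsub>y =\<^bsub>A\<^esub> y\<^esub> REFL y)"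

lemmas [ty_apply] = ty_cancel_def[THEN fun_cong]

lemma inh_cancel [inh]: "inhabited \<Theta> (ty_cancel i)"
  by (rule inhabitedI[where
      Ts="[]" and
      e="\<^bold>\<lambda>A x y w.
           JJ (\<lambda>y w. \<Sigma> k\<in>(\<Pi> z\<in>A. x =\<^bsub>A\<^esub> z \<rightarrow> y =\<^bsub>A\<^esub> z). k \<cdot> y \<cdot> w =\<^bsub>y =\<^bsub>A\<^esub> y\<^esub> REFL y)
             (PR (\<^bold>\<lambda>z r. r) RFL) w"])
    (simp_all only: elab_eval ty_apply inh cong: elab_cong)

text \<open>If a reflexive proposition-valued relation implies identity, then every identification \<open>p\<close> is equal
  to one that depends on \<open>p\<close> only through a proof of the relation.\<close>

definition ty_hedberg :: "nat \<Rightarrow> nat \<Rightarrow> stm" where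
  "ty_hedberg i j =
    (\<Pi> A\<in>U i. \<Pi> C\<in>(A \<rightarrow> A \<rightarrow> U j). (\<Pi> x\<in>A. \<Pi> y\<in>A. isProp (C \<cdot> x \<cdot> y)) \<rightarrow> (\<Pi> x\<in>A. C \<cdot> x \<cdot> x) \<rightarrow>
      (\<Pi> x\<in>A. \<Pi> y\<in>A. C \<cdot> x \<cdot> y \<rightarrow> x =\<^bsub>A\<^esub> y) \<rightarrow> isSet A)"

lemmas [ty_apply] = ty_hedberg_def[THEN fun_cong]

lemma inh_hedberg [inh]: "inhabited \<Theta> (ty_hedberg i j)"
  \<comment> \<open>The term \<open>k y (to p)\<close> depends on \<open>p\<close> only through
    \<open>to p : C x y\<close>, and \<open>key p\<close> identifies it with \<open>p\<close>. At
    reflexivity \<open>to p\<close> must reduce to \<open>rf x\<close>, so that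
    \<open>SND cn\<close> proves the base case of \<open>key\<close>; hence \<open>to\<close> is an
    explicit path induction and not an application of a transport lemma.\<close>
  by (rule inhabitedI[where
      Ts="[ty_trans i, ty_sym i, ty_ap j i, ty_cancel i]" and
      e="let TRANS = bvar 0; SYM = bvar 1; AP = bvar 2; CANCEL = bvar 3 in
         \<^bold>\<lambda>A C pr rf fr x y p q. let w = fr \<cdot> x \<cdot> x \<cdot> (rf \<cdot> x); cn = CANCEL \<cdot> A \<cdot> x \<cdot> x \<cdot> w;
           to = (\<lambda>p. JJ (\<lambda>y p. C \<cdot> x \<cdot> y) (rf \<cdot> x) p); k = (\<lambda>y c. FST cn \<cdot> y \<cdot> (fr \<cdot> x \<cdot> y \<cdot> c));
           key = (\<lambda>p. JJ (\<lambda>y p. k y (to p) =\<^bsub>x =\<^bsub>A\<^esub> y\<^esub> p) (SND cn) p) in TRANS \<cdot> (x =\<^bsub>A\<^esub> y) \<cdot> p \<cdot>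
           (k y (to p)) \<cdot> q \<cdot> (SYM \<cdot> (x =\<^bsub>A\<^esub> y) \<cdot> (k y (to p)) \<cdot> p \<cdot> (key p)) \<cdot>
           (TRANS \<cdot> (x =\<^bsub>A\<^esub> y) \<cdot> (k y (to p)) \<cdot> (k y (to q)) \<cdot> q \<cdot>
             (AP \<cdot> (C \<cdot> x \<cdot> y) \<cdot> (x =\<^bsub>A\<^esub> y) \<cdot> (\<^bold>\<lambda>c. k y c) \<cdot> (to p) \<cdot> (to q) \<cdot>
               (pr \<cdot> x \<cdot> y \<cdot> (to p) \<cdot> (to q))) \<cdot>
             (key q))"])
    (simp_all only: elab_eval ty_apply inh cong: elab_cong)

definition ty_propext :: "nat \<Rightarrow> stm" where
  "ty_propext i = (\<Pi> P\<in>U i. \<Pi> Q\<in>U i. isProp P \<rightarrow> isProp Q \<rightarrow> (P \<rightarrow> Q) \<rightarrow> (Q \<rightarrow> P) \<rightarrow> P =\<^bsub>U i\<^esub> Q)"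

lemmas [ty_apply] = ty_propext_def[THEN fun_cong]

lemma inh_propext [inh]: "inhabited \<Theta> (ty_propext i)"
  by (rule inhabited_Cst[where c="PropExt i"])
    (simp_all only: cst_type.simps elab_eval ty_apply cong: elab_cong)

definition ty_trunc_in :: "nat \<Rightarrow> stm" where
  "ty_trunc_in i = (\<Pi> X\<in>U i. X \<rightarrow> K (Trunc i) \<cdot> X)"

lemmas [ty_apply] = ty_trunc_in_def[THEN fun_cong]

lemma inh_trunc_in [inh]: "inhabited \<Theta> (ty_trunc_in i)"
  by (rule inhabited_Cst[where c="TruncIn i"])
    (simp_all only: cst_type.simps elab_eval ty_apply cong: elab_cong)

definition ty_trunc_prop :: "nat \<Rightarrow> stm" where
  "ty_trunc_prop i = (\<Pi> X\<in>U i. isProp (K (Trunc i) \<cdot> X))"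

lemmas [ty_apply] = ty_trunc_prop_def[THEN fun_cong]

lemma inh_trunc_prop [inh]: "inhabited \<Theta> (ty_trunc_prop i)"
  by (rule inhabited_Cst[where c="TruncProp i"])
    (simp_all only: cst_type.simps elab_eval ty_apply cong: elab_cong)

definition ty_trunc_rec :: "nat \<Rightarrow> nat \<Rightarrow> stm" where
  "ty_trunc_rec i j = (\<Pi> X\<in>U i. \<Pi> P\<in>U j. isProp P \<rightarrow> (X \<rightarrow> P) \<rightarrow> K (Trunc i) \<cdot> X \<rightarrow> P)"

lemmas [ty_apply] = ty_trunc_rec_def[THEN fun_cong]

lemma inh_trunc_rec [inh]: "inhabited \<Theta> (ty_trunc_rec i j)"
  by (rule inhabited_Cst[where c="TruncRec i j"])
    (simp_all only: cst_type.simps elab_eval ty_apply cong: elab_cong)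

text \<open>The relation in \<open>hedberg\<close> is taken to be constantly \<open>A\<close>, which avoids the unit type.\<close>

definition ty_prop_set :: "nat \<Rightarrow> stm" where
  "ty_prop_set i = (\<Pi> A\<in>U i. isProp A \<rightarrow> isSet A)"

lemmas [ty_apply] = ty_prop_set_def[THEN fun_cong]

lemma inh_prop_set [inh]: "inhabited \<Theta> (ty_prop_set i)"
  by (rule inhabitedI[where
      Ts="[ty_hedberg i i]" and
      e="let HED = bvar 0 in
         \<^bold>\<lambda>A h. HED \<cdot> A \<cdot> (\<^bold>\<lambda>x y. A) \<cdot> (\<^bold>\<lambda>x y. h) \<cdot> (\<^bold>\<lambda>x. x) \<cdot> (\<^bold>\<lambda>x y c. h \<cdot> x \<cdot> y)"])
    (simp_all only: elab_eval ty_apply inh cong: elab_cong)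

definition ty_prop_Pi :: "nat \<Rightarrow> nat \<Rightarrow> stm" where
  "ty_prop_Pi i j = (\<Pi> X\<in>U i. \<Pi> Y\<in>(X \<rightarrow> U j). (\<Pi> x\<in>X. isProp (Y \<cdot> x)) \<rightarrow> isProp (\<Pi> x\<in>X. Y \<cdot> x))"

lemmas [ty_apply] = ty_prop_Pi_def[THEN fun_cong]

lemma inh_prop_Pi [inh]: "inhabited \<Theta> (ty_prop_Pi i j)"
  by (rule inhabitedI[where
      Ts="[ty_funext i j]" and
      e="let FE = bvar 0 in
         \<^bold>\<lambda>X Y h f g. FE \<cdot> X \<cdot> Y \<cdot> f \<cdot> g \<cdot> (\<^bold>\<lambda>x. h \<cdot> x \<cdot> (f \<cdot> x) \<cdot> (g \<cdot> x))"])
    (simp_all only: elab_eval ty_apply inh cong: elab_cong)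

definition ty_prop_isProp :: "nat \<Rightarrow> stm" where
  "ty_prop_isProp i = (\<Pi> A\<in>U i. isProp (isProp A))"

lemmas [ty_apply] = ty_prop_isProp_def[THEN fun_cong]

text \<open>The given proof \<open>f\<close> already makes \<open>A\<close> a set, so
  \<open>isProp A\<close> is a product of propositions.\<close>

lemma inh_prop_isProp [inh]: "inhabited \<Theta> (ty_prop_isProp i)"
  by (rule inhabitedI[where
      Ts="[ty_prop_Pi i i, ty_prop_set i]" and
      e="let PPI = bvar 0; PSET = bvar 1 in
         \<^bold>\<lambda>A f g. PPI \<cdot> A \<cdot> (\<^bold>\<lambda>x. \<Pi> y\<in>A. x =\<^bsub>A\<^esub> y) \<cdot>
           (\<^bold>\<lambda>x. PPI \<cdot> A \<cdot> (\<^bold>\<lambda>y. x =\<^bsub>A\<^esub> y) \<cdot> (\<^bold>\<lambda>y. PSET \<cdot> A \<cdot> f \<cdot> x \<cdot> y)) \<cdot> f \<cdot> g"])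
    (simp_all only: elab_eval ty_apply inh cong: elab_cong)

definition ty_set_Pi :: "nat \<Rightarrow> nat \<Rightarrow> stm" where
  "ty_set_Pi i j = (\<Pi> X\<in>U i. \<Pi> Y\<in>(X \<rightarrow> U j). (\<Pi> x\<in>X. isSet (Y \<cdot> x)) \<rightarrow> isSet (\<Pi> x\<in>X. Y \<cdot> x))"

lemmas [ty_apply] = ty_set_Pi_def[THEN fun_cong]

text \<open>By \<open>ty_hedberg\<close> for pointwise identity, which is a product of propositions
  and implies identity by function extensionality.\<close>

lemma inh_set_Pi [inh]: "inhabited \<Theta> (ty_set_Pi i j)"
  by (rule inhabitedI[where
      Ts="[ty_hedberg (max i j) (max i j), ty_prop_Pi i j, ty_funext i j]" and
      e="let HED = bvar 0; PPI = bvar 1; FE = bvar 2 in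
         \<^bold>\<lambda>X Y s. HED \<cdot> (\<Pi> x\<in>X. Y \<cdot> x) \<cdot> (\<^bold>\<lambda>f g. \<Pi> x\<in>X. f \<cdot> x =\<^bsub>Y \<cdot> x\<^esub> g \<cdot> x) \<cdot>
           (\<^bold>\<lambda>f g. PPI \<cdot> X \<cdot> (\<^bold>\<lambda>x. f \<cdot> x =\<^bsub>Y \<cdot> x\<^esub> g \<cdot> x) \<cdot> (\<^bold>\<lambda>x. s \<cdot> x \<cdot> (f \<cdot> x) \<cdot> (g \<cdot> x))) \<cdot>
           (\<^bold>\<lambda>f x. RFL) \<cdot> (\<^bold>\<lambda>f g h. FE \<cdot> X \<cdot> Y \<cdot> f \<cdot> g \<cdot> h)"])
    (simp_all only: elab_eval ty_apply inh cong: elab_cong)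

definition ty_pair_eq :: "nat \<Rightarrow> nat \<Rightarrow> stm" where
  "ty_pair_eq i j =
    (\<Pi> A\<in>U i. \<Pi> B\<in>(A \<rightarrow> U j). (\<Pi> x\<in>A. isProp (B \<cdot> x)) \<rightarrow>
      (\<Pi> a\<in>A. \<Pi> a'\<in>A. \<Pi> b\<in>(B \<cdot> a). \<Pi> b'\<in>(B \<cdot> a'). a =\<^bsub>A\<^esub> a' \<rightarrow> PR a b =\<^bsub>\<Sigma> x\<in>A. B \<cdot> x\<^esub> PR a' b'))"

lemmas [ty_apply] = ty_pair_eq_def[THEN fun_cong]

text \<open>The motive quantifies over \<open>b'\<close> because its type moves with the end point
  \<open>a'\<close>; at reflexivity both second components lie in the same proposition.\<close>

lemma inh_pair_eq [inh]: "inhabited \<Theta> (ty_pair_eq i j)"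
  by (rule inhabitedI[where
      Ts="[ty_ap j (max i j)]" and
      e="let AP = bvar 0 in
         \<^bold>\<lambda>A B h a a' b b' p.
           JJ (\<lambda>a' p. \<Pi> b'\<in>(B \<cdot> a'). PR a b =\<^bsub>\<Sigma> x\<in>A. B \<cdot> x\<^esub> PR a' b')
             (\<^bold>\<lambda>b'. AP \<cdot> (B \<cdot> a) \<cdot> (\<Sigma> x\<in>A. B \<cdot> x) \<cdot> (\<^bold>\<lambda>z. PR a z) \<cdot> b \<cdot> b' \<cdot> (h \<cdot> a \<cdot> b \<cdot> b')) p \<cdot>
           b'"])
    (simp_all only: elab_eval ty_apply inh cong: elab_cong)

definition ty_Sg_eq :: "nat \<Rightarrow> nat \<Rightarrow> stm" where
  "ty_Sg_eq i j =
    (\<Pi> A\<in>U i. \<Pi> B\<in>(A \<rightarrow> U j). (\<Pi> x\<in>A. isProp (B \<cdot> x)) \<rightarrow>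
      (\<Pi> u\<in>(\<Sigma> x\<in>A. B \<cdot> x). \<Pi> v\<in>(\<Sigma> x\<in>A. B \<cdot> x). proj1 A u =\<^bsub>A\<^esub> proj1 A v \<rightarrow> u =\<^bsub>\<Sigma> x\<in>A. B \<cdot> x\<^esub> v))"

lemmas [ty_apply] = ty_Sg_eq_def[THEN fun_cong]

text \<open>Pairs have no judgemental eta rule, so \<open>u\<close> and \<open>v\<close> are both
  split; on pairs the hypothesis reduces to an identification of the first components.\<close>

lemma inh_Sg_eq [inh]: "inhabited \<Theta> (ty_Sg_eq i j)"
  by (rule inhabitedI[where
      Ts="[ty_pair_eq i j]" and
      e="let PEQ = bvar 0 in
         \<^bold>\<lambda>A B h u v.
           SPLIT (\<lambda>u. \<Pi> v\<in>(\<Sigma> x\<in>A. B \<cdot> x). proj1 A u =\<^bsub>A\<^esub> proj1 A v \<rightarrow> u =\<^bsub>\<Sigma> x\<in>A. B \<cdot> x\<^esub> v)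
             (\<lambda>a b. \<^bold>\<lambda>v.
               SPLIT (\<lambda>v. a =\<^bsub>A\<^esub> proj1 A v \<rightarrow> PR a b =\<^bsub>\<Sigma> x\<in>A. B \<cdot> x\<^esub> v)
                 (\<lambda>a' b'. PEQ \<cdot> A \<cdot> B \<cdot> h \<cdot> a \<cdot> a' \<cdot> b \<cdot> b') v) u \<cdot>
           v"])
    (simp_all only: elab_eval ty_apply inh cong: elab_cong)

definition ty_set_Sg :: "nat \<Rightarrow> nat \<Rightarrow> stm" where
  "ty_set_Sg i j =
    (\<Pi> A\<in>U i. \<Pi> B\<in>(A \<rightarrow> U j). isSet A \<rightarrow> (\<Pi> x\<in>A. isProp (B \<cdot> x)) \<rightarrow> isSet (\<Sigma> x\<in>A. B \<cdot> x))"

lemmas [ty_apply] = ty_set_Sg_def[THEN fun_cong]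

text \<open>By \<open>ty_hedberg\<close> for the relation of having identified first
  components.\<close>

lemma inh_set_Sg [inh]: "inhabited \<Theta> (ty_set_Sg i j)"
  by (rule inhabitedI[where
      Ts="[ty_hedberg (max i j) i, ty_Sg_eq i j]" and
      e="let HED = bvar 0; SEQ = bvar 1 in
         \<^bold>\<lambda>A B s h. HED \<cdot> (\<Sigma> x\<in>A. B \<cdot> x) \<cdot> (\<^bold>\<lambda>u v. FST u =\<^bsub>A\<^esub> FST v) \<cdot>
           (\<^bold>\<lambda>u v. s \<cdot> (FST u) \<cdot> (FST v)) \<cdot> (\<^bold>\<lambda>u. RFL) \<cdot> (\<^bold>\<lambda>u v. SEQ \<cdot> A \<cdot> B \<cdot> h \<cdot> u \<cdot> v)"])
    (simp_all only: elab_eval ty_apply inh cong: elab_cong)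

definition ty_prop_Sg :: "nat \<Rightarrow> nat \<Rightarrow> stm" where
  "ty_prop_Sg i j =
    (\<Pi> A\<in>U i. \<Pi> B\<in>(A \<rightarrow> U j). isProp A \<rightarrow> (\<Pi> x\<in>A. isProp (B \<cdot> x)) \<rightarrow> isProp (\<Sigma> x\<in>A. B \<cdot> x))"

lemmas [ty_apply] = ty_prop_Sg_def[THEN fun_cong]

lemma inh_prop_Sg [inh]: "inhabited \<Theta> (ty_prop_Sg i j)"
  by (rule inhabitedI[where
      Ts="[ty_Sg_eq i j]" and
      e="let SEQ = bvar 0 in
         \<^bold>\<lambda>A B p h u v. SEQ \<cdot> A \<cdot> B \<cdot> h \<cdot> u \<cdot> v \<cdot> (p \<cdot> (FST u) \<cdot> (FST v))"])
    (simp_all only: elab_eval ty_apply inh cong: elab_cong)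

definition ty_retract_set :: "nat \<Rightarrow> nat \<Rightarrow> stm" where
  "ty_retract_set i j =
    (\<Pi> A\<in>U i. \<Pi> B\<in>U j. \<Pi> s\<in>(A \<rightarrow> B). \<Pi> r\<in>(B \<rightarrow> A). (\<Pi> a\<in>A. r \<cdot> (s \<cdot> a) =\<^bsub>A\<^esub> a) \<rightarrow> isSet B \<rightarrow> isSet A)"

lemmas [ty_apply] = ty_retract_set_def[THEN fun_cong]

lemma inh_retract_set [inh]: "inhabited \<Theta> (ty_retract_set i j)"
  by (rule inhabitedI[where
      Ts="[ty_hedberg i j, ty_trans i, ty_sym i, ty_ap j i]" and
      e="let HED = bvar 0; TRANS = bvar 1; SYM = bvar 2; AP = bvar 3 in
         \<^bold>\<lambda>A B s r h sB. HED \<cdot> A \<cdot> (\<^bold>\<lambda>a b. s \<cdot> a =\<^bsub>B\<^esub> s \<cdot> b) \<cdot> (\<^bold>\<lambda>a b. sB \<cdot> (s \<cdot> a) \<cdot> (s \<cdot> b)) \<cdot>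
           (\<^bold>\<lambda>a. RFL) \<cdot>
           (\<^bold>\<lambda>a b c. TRANS \<cdot> A \<cdot> a \<cdot> (r \<cdot> (s \<cdot> a)) \<cdot> b \<cdot> (SYM \<cdot> A \<cdot> (r \<cdot> (s \<cdot> a)) \<cdot> a \<cdot> (h \<cdot> a)) \<cdot>
             (TRANS \<cdot> A \<cdot> (r \<cdot> (s \<cdot> a)) \<cdot> (r \<cdot> (s \<cdot> b)) \<cdot> b \<cdot>
               (AP \<cdot> B \<cdot> A \<cdot> r \<cdot> (s \<cdot> a) \<cdot> (s \<cdot> b) \<cdot> c) \<cdot> (h \<cdot> b)))"])
    (simp_all only: elab_eval ty_apply inh cong: elab_cong)

definition ty_retract_prop :: "nat \<Rightarrow> nat \<Rightarrow> stm" where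
  "ty_retract_prop i j =
    (\<Pi> A\<in>U i. \<Pi> B\<in>U j. \<Pi> s\<in>(A \<rightarrow> B). \<Pi> r\<in>(B \<rightarrow> A). (\<Pi> a\<in>A. r \<cdot> (s \<cdot> a) =\<^bsub>A\<^esub> a) \<rightarrow> isProp B \<rightarrow> isProp A)"

lemmas [ty_apply] = ty_retract_prop_def[THEN fun_cong]

lemma inh_retract_prop [inh]: "inhabited \<Theta> (ty_retract_prop i j)"
  by (rule inhabitedI[where
      Ts="[ty_trans i, ty_sym i, ty_ap j i]" and
      e="let TRANS = bvar 0; SYM = bvar 1; AP = bvar 2 in
         \<^bold>\<lambda>A B s r h pB a b. TRANS \<cdot> A \<cdot> a \<cdot> (r \<cdot> (s \<cdot> a)) \<cdot> b \<cdot>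
           (SYM \<cdot> A \<cdot> (r \<cdot> (s \<cdot> a)) \<cdot> a \<cdot> (h \<cdot> a)) \<cdot>
           (TRANS \<cdot> A \<cdot> (r \<cdot> (s \<cdot> a)) \<cdot> (r \<cdot> (s \<cdot> b)) \<cdot> b \<cdot>
             (AP \<cdot> B \<cdot> A \<cdot> r \<cdot> (s \<cdot> a) \<cdot> (s \<cdot> b) \<cdot> (pB \<cdot> (s \<cdot> a) \<cdot> (s \<cdot> b))) \<cdot> (h \<cdot> b))"])
    (simp_all only: elab_eval ty_apply inh cong: elab_cong)

definition ty_prop_equiv :: "nat \<Rightarrow> nat \<Rightarrow> stm" where
  "ty_prop_equiv i j = (\<Pi> A\<in>U i. \<Pi> B\<in>U j. isProp A \<rightarrow> isProp B \<rightarrow> (A \<rightarrow> B) \<rightarrow> (B \<rightarrow> A) \<rightarrow> equiv A B)"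

lemmas [ty_apply] = ty_prop_equiv_def[THEN fun_cong]

lemma inh_prop_equiv [inh]: "inhabited \<Theta> (ty_prop_equiv i j)"
  by (rule inhabitedI[where
      Ts="[]" and
      e="\<^bold>\<lambda>A B pA pB f g.
           PR f (PR (PR g (\<^bold>\<lambda>y. pB \<cdot> (f \<cdot> (g \<cdot> y)) \<cdot> y)) (PR g (\<^bold>\<lambda>x. pA \<cdot> (g \<cdot> (f \<cdot> x)) \<cdot> x)))"])
    (simp_all only: elab_eval ty_apply inh cong: elab_cong)

definition ty_equiv_inverse :: "nat \<Rightarrow> nat \<Rightarrow> stm" where
  "ty_equiv_inverse i j =
    (\<Pi> A\<in>U i. \<Pi> B\<in>U j. equiv A B \<rightarrow>
      (\<Sigma> s\<in>(A \<rightarrow> B). \<Sigma> r\<in>(B \<rightarrow> A). (\<Pi> y\<in>B. s \<cdot> (r \<cdot> y) =\<^bsub>B\<^esub> y) \<otimes> (\<Pi> x\<in>A. r \<cdot> (s \<cdot> x) =\<^bsub>A\<^esub> x)))"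

lemmas [ty_apply] = ty_equiv_inverse_def[THEN fun_cong]

text \<open>The left inverse \<open>r\<close> is also a right inverse: if \<open>g\<close> is the
  given right inverse, then \<open>r y = r (s (g y)) = g y\<close>, and hence
  \<open>s (r y) = s (g y) = y\<close>.\<close>

lemma inh_equiv_inverse [inh]: "inhabited \<Theta> (ty_equiv_inverse i j)"
  by (rule inhabitedI[where
      Ts="[ty_trans i, ty_trans j, ty_sym j, ty_ap i j, ty_ap j i]" and
      e="let TRANSA = bvar 0; TRANSB = bvar 1; SYM = bvar 2; APS = bvar 3; APR = bvar 4 in
         \<^bold>\<lambda>A B e. let s = FST e; g = FST (FST (SND e)); eps = SND (FST (SND e));
           r = FST (SND (SND e)); eta = SND (SND (SND e)) in
           PR s
             (PR r
               (PR
                 (\<^bold>\<lambda>y. TRANSB \<cdot> B \<cdot> (s \<cdot> (r \<cdot> y)) \<cdot> (s \<cdot> (g \<cdot> y)) \<cdot> y \<cdot>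
                   (APS \<cdot> A \<cdot> B \<cdot> s \<cdot> (r \<cdot> y) \<cdot> (g \<cdot> y) \<cdot>
                     (TRANSA \<cdot> A \<cdot> (r \<cdot> y) \<cdot> (r \<cdot> (s \<cdot> (g \<cdot> y))) \<cdot> (g \<cdot> y) \<cdot>
                       (APR \<cdot> B \<cdot> A \<cdot> r \<cdot> y \<cdot> (s \<cdot> (g \<cdot> y)) \<cdot>
                         (SYM \<cdot> B \<cdot> (s \<cdot> (g \<cdot> y)) \<cdot> y \<cdot> (eps \<cdot> y))) \<cdot>
                       (eta \<cdot> (g \<cdot> y)))) \<cdot>
                   (eps \<cdot> y)) eta))"])
    (simp_all only: elab_eval ty_apply inh cong: elab_cong)

section \<open>The type of subsets\<close>

text \<open>Extensionality for \<open>subsets j X\<close>: \<open>same_members\<close> is a small replacement of its identity type.\<close>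

definition ty_same_prop :: "nat \<Rightarrow> nat \<Rightarrow> stm" where
  "ty_same_prop i j = (\<Pi> X\<in>U i. \<Pi> u\<in>subsets j X. \<Pi> v\<in>subsets j X. isProp (same_members j X u v))"

lemmas [ty_apply] = ty_same_prop_def[THEN fun_cong]

lemma inh_same_prop [inh]: "inhabited \<Theta> (ty_same_prop i j)"
  by (rule inhabitedI[where
      Ts="[ty_prop_Pi i j, ty_prop_Pi j j, ty_prop_Sg j j]" and
      e="let PPI = bvar 0; PPJ = bvar 1; PSG = bvar 2 in
         \<^bold>\<lambda>X u v. PPI \<cdot> X \<cdot>
           (\<^bold>\<lambda>x. (member j X u x \<rightarrow> member j X v x) \<otimes> (member j X v x \<rightarrow> member j X u x)) \<cdot>
           (\<^bold>\<lambda>x. PSG \<cdot> (member j X u x \<rightarrow> member j X v x) \<cdot> (\<^bold>\<lambda>z. member j X v x \<rightarrow> member j X u x) \<cdot>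
             (PPJ \<cdot> (member j X u x) \<cdot> (\<^bold>\<lambda>z. member j X v x) \<cdot> (\<^bold>\<lambda>z. SND v \<cdot> x)) \<cdot>
             (\<^bold>\<lambda>z. PPJ \<cdot> (member j X v x) \<cdot> (\<^bold>\<lambda>z. member j X u x) \<cdot> (\<^bold>\<lambda>z. SND u \<cdot> x)))"])
    (simp_all only: elab_eval ty_apply inh cong: elab_cong)

definition ty_subsets_ext :: "nat \<Rightarrow> nat \<Rightarrow> stm" where
  "ty_subsets_ext i j =
    (\<Pi> X\<in>U i. \<Pi> u\<in>subsets j X. \<Pi> v\<in>subsets j X. same_members j X u v \<rightarrow> u =\<^bsub>subsets j X\<^esub> v)"

lemmas [ty_apply] = ty_subsets_ext_def[THEN fun_cong]

text \<open>Being a proposition is itself a proposition, so \<open>ty_Sg_eq\<close> leaves only the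
  underlying predicates to be identified.\<close>

lemma inh_subsets_ext [inh]: "inhabited \<Theta> (ty_subsets_ext i j)"
  by (rule inhabitedI[where
      Ts="[ty_Sg_eq (max i (Suc j)) (max i j), ty_prop_Pi i j, ty_prop_isProp j, ty_funext i (Suc j),
            ty_propext j]" and
      e="let SEQ = bvar 0; PPI = bvar 1; PIP = bvar 2; FE = bvar 3; PE = bvar 4 in
         \<^bold>\<lambda>X u v c. SEQ \<cdot> (X \<rightarrow> U j) \<cdot> (\<^bold>\<lambda>S. \<Pi> x\<in>X. isProp (S \<cdot> x)) \<cdot>
           (\<^bold>\<lambda>S. PPI \<cdot> X \<cdot> (\<^bold>\<lambda>x. isProp (S \<cdot> x)) \<cdot> (\<^bold>\<lambda>x. PIP \<cdot> (S \<cdot> x))) \<cdot> u \<cdot> v \<cdot>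
           (FE \<cdot> X \<cdot> (\<^bold>\<lambda>x. U j) \<cdot> (FST u) \<cdot> (FST v) \<cdot>
             (\<^bold>\<lambda>x. PE \<cdot> (member j X u x) \<cdot> (member j X v x) \<cdot> (SND u \<cdot> x) \<cdot> (SND v \<cdot> x) \<cdot>
               (FST (c \<cdot> x)) \<cdot> (SND (c \<cdot> x))))"])
    (simp_all only: elab_eval ty_apply inh cong: elab_cong)

definition ty_set_subsets :: "nat \<Rightarrow> nat \<Rightarrow> stm" where
  "ty_set_subsets i j = (\<Pi> X\<in>U i. isSet (subsets j X))"

lemmas [ty_apply] = ty_set_subsets_def[THEN fun_cong]

text \<open>With \<open>same_members\<close> as the relation, \<open>ty_hedberg\<close> avoids any
  analysis of the identity types of \<open>U j\<close>.\<close>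

lemma inh_set_subsets [inh]: "inhabited \<Theta> (ty_set_subsets i j)"
  by (rule inhabitedI[where
      Ts="[ty_hedberg (max i (Suc j)) (max i j), ty_same_prop i j, ty_subsets_ext i j]" and
      e="let HED = bvar 0; SP = bvar 1; EXT = bvar 2 in
         \<^bold>\<lambda>X. HED \<cdot> (subsets j X) \<cdot> (\<^bold>\<lambda>u v. same_members j X u v) \<cdot> (SP \<cdot> X) \<cdot>
           (\<^bold>\<lambda>u x. PR (\<^bold>\<lambda>z. z) (\<^bold>\<lambda>z. z)) \<cdot> (EXT \<cdot> X)"])
    (simp_all only: elab_eval ty_apply inh cong: elab_cong)

definition ty_small_subsets :: "nat \<Rightarrow> nat \<Rightarrow> stm" where
  "ty_small_subsets i j = (\<Pi> X\<in>U i. isLocallySmall (max i j) (subsets j X))"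

lemmas [ty_apply] = ty_small_subsets_def[THEN fun_cong]

text \<open>Both \<open>same_members\<close> and the identity type are propositions, so maps in both
  directions form an equivalence. The map out of the identity type transports the reflexive
  case.\<close>

lemma inh_small_subsets [inh]: "inhabited \<Theta> (ty_small_subsets i j)"
  by (rule inhabitedI[where
      Ts="[ty_prop_equiv (max i j) (max i (Suc j)), ty_same_prop i j, ty_set_subsets i j,
            ty_subsets_ext i j, ty_tr (max i (Suc j)) (max i j)]" and
      e="let PEQ = bvar 0; SP = bvar 1; SS = bvar 2; EXT = bvar 3; TR = bvar 4 in
         \<^bold>\<lambda>X u v.
           PR (same_members j X u v)
             (PEQ \<cdot> (same_members j X u v) \<cdot> (u =\<^bsub>subsets j X\<^esub> v) \<cdot> (SP \<cdot> X \<cdot> u \<cdot> v) \<cdot>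
               (SS \<cdot> X \<cdot> u \<cdot> v) \<cdot> (EXT \<cdot> X \<cdot> u \<cdot> v) \<cdot>
               (\<^bold>\<lambda>p. TR \<cdot> (subsets j X) \<cdot> (\<^bold>\<lambda>v. same_members j X u v) \<cdot> u \<cdot> v \<cdot> p \<cdot>
                 (\<^bold>\<lambda>x. PR (\<^bold>\<lambda>z. z) (\<^bold>\<lambda>z. z))))"])
    (simp_all only: elab_eval ty_apply inh cong: elab_cong)

section \<open>Images and their small copies\<close>

definition ty_image_eq :: "nat \<Rightarrow> nat \<Rightarrow> stm" where
  "ty_image_eq i l =
    (\<Pi> X\<in>U i. \<Pi> Y\<in>U l. \<Pi> f\<in>(X \<rightarrow> Y). \<Pi> u\<in>image i l X Y f. \<Pi> v\<in>image i l X Y f.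
      proj1 Y u =\<^bsub>Y\<^esub> proj1 Y v \<rightarrow> u =\<^bsub>image i l X Y f\<^esub> v)"

lemmas [ty_apply] = ty_image_eq_def[THEN fun_cong]

lemma inh_image_eq [inh]: "inhabited \<Theta> (ty_image_eq i l)"
  by (rule inhabitedI[where
      Ts="[ty_Sg_eq l (max i l), ty_trunc_prop (max i l)]" and
      e="let SEQ = bvar 0; TP = bvar 1 in
         \<^bold>\<lambda>X Y f u v. SEQ \<cdot> Y \<cdot> (\<^bold>\<lambda>y. K (Trunc (max i l)) \<cdot> fibre X Y f y) \<cdot>
           (\<^bold>\<lambda>y. TP \<cdot> (fibre X Y f y)) \<cdot> u \<cdot> v"])
    (simp_all only: elab_eval ty_apply inh cong: elab_cong)

definition ty_image_set :: "nat \<Rightarrow> nat \<Rightarrow> stm" where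
  "ty_image_set i l = (\<Pi> X\<in>U i. \<Pi> Y\<in>U l. \<Pi> f\<in>(X \<rightarrow> Y). isSet Y \<rightarrow> isSet (image i l X Y f))"

lemmas [ty_apply] = ty_image_set_def[THEN fun_cong]

lemma inh_image_set [inh]: "inhabited \<Theta> (ty_image_set i l)"
  by (rule inhabitedI[where
      Ts="[ty_set_Sg l (max i l), ty_trunc_prop (max i l)]" and
      e="let SSG = bvar 0; TP = bvar 1 in
         \<^bold>\<lambda>X Y f s. SSG \<cdot> Y \<cdot> (\<^bold>\<lambda>y. K (Trunc (max i l)) \<cdot> fibre X Y f y) \<cdot> s \<cdot>
           (\<^bold>\<lambda>y. TP \<cdot> (fibre X Y f y))"])
    (simp_all only: elab_eval ty_apply inh cong: elab_cong)

text \<open>A small copy \<open>Q\<close> of the image, described without the image: \<open>t\<close> is an embedding through which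
  \<open>f\<close> factors.\<close>

definition ty_factor_retract :: "nat \<Rightarrow> nat \<Rightarrow> nat \<Rightarrow> stm" where
  "ty_factor_retract i l m =
    (\<Pi> X\<in>U i. \<Pi> Y\<in>U l. \<Pi> f\<in>(X \<rightarrow> Y). \<Pi> Q\<in>U m. \<Pi> s\<in>(Q \<rightarrow> image i l X Y f). \<Pi> r\<in>(image i l X Y f \<rightarrow> Q).
      (\<Pi> u\<in>image i l X Y f. s \<cdot> (r \<cdot> u) =\<^bsub>image i l X Y f\<^esub> u) \<rightarrow> (\<Pi> q\<in>Q. r \<cdot> (s \<cdot> q) =\<^bsub>Q\<^esub> q) \<rightarrow>
      (\<Sigma> t\<in>(Q \<rightarrow> Y). \<Sigma> h\<in>(X \<rightarrow> Q). (\<Pi> p\<in>Q. \<Pi> q\<in>Q. t \<cdot> p =\<^bsub>Y\<^esub> t \<cdot> q \<rightarrow> p =\<^bsub>Q\<^esub> q) \<otimes>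
        (\<Pi> x\<in>X. t \<cdot> (h \<cdot> x) =\<^bsub>Y\<^esub> f \<cdot> x) \<otimes> (\<Pi> q\<in>Q. K (Trunc (max i l)) \<cdot> fibre X Y f (t \<cdot> q))))"

lemmas [ty_apply] = ty_factor_retract_def[THEN fun_cong]

lemma inh_factor_retract [inh]: "inhabited \<Theta> (ty_factor_retract i l m)"
  \<comment> \<open>Here \<open>inc\<close> is the corestriction of \<open>f\<close>, and
    \<open>h\<close> is \<open>r\<close> after \<open>inc\<close>. The map \<open>t\<close> is
    injective by \<open>p = r (s p) = r (s q) = q\<close>, because points of the image agree as soon
    as their first components do.\<close>
  by (rule inhabitedI[where
      Ts="[ty_image_eq i l, ty_trunc_in (max i l), ty_trans m, ty_sym m, ty_ap (max i l) l,
            ty_ap (max i l) m]" and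
      e="let IE = bvar 0; TI = bvar 1; TRANS = bvar 2; SYM = bvar 3; APIY = bvar 4; APIQ = bvar 5 in
         \<^bold>\<lambda>X Y f Q s r eps eta. let inc = (\<lambda>x. PR (f \<cdot> x) (TI \<cdot> (fibre X Y f (f \<cdot> x)) \<cdot> (PR x RFL)))
           in
           PR (\<^bold>\<lambda>q. FST (s \<cdot> q))
             (PR (\<^bold>\<lambda>x. r \<cdot> (inc x))
               (PR
                 (\<^bold>\<lambda>p q c. TRANS \<cdot> Q \<cdot> p \<cdot> (r \<cdot> (s \<cdot> p)) \<cdot> q \<cdot>
                   (SYM \<cdot> Q \<cdot> (r \<cdot> (s \<cdot> p)) \<cdot> p \<cdot> (eta \<cdot> p)) \<cdot>
                   (TRANS \<cdot> Q \<cdot> (r \<cdot> (s \<cdot> p)) \<cdot> (r \<cdot> (s \<cdot> q)) \<cdot> q \<cdot>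
                     (APIQ \<cdot> (image i l X Y f) \<cdot> Q \<cdot> r \<cdot> (s \<cdot> p) \<cdot> (s \<cdot> q) \<cdot>
                       (IE \<cdot> X \<cdot> Y \<cdot> f \<cdot> (s \<cdot> p) \<cdot> (s \<cdot> q) \<cdot> c)) \<cdot>
                     (eta \<cdot> q)))
                 (PR
                   (\<^bold>\<lambda>x. APIY \<cdot> (image i l X Y f) \<cdot> Y \<cdot> (\<^bold>\<lambda>u. FST u) \<cdot> (s \<cdot> (r \<cdot> (inc x))) \<cdot>
                     (inc x) \<cdot> (eps \<cdot> (inc x)))
                   (\<^bold>\<lambda>q. SND (s \<cdot> q)))))"])
    (simp_all only: elab_eval ty_apply inh cong: elab_cong)

definition ty_factor_image :: "nat \<Rightarrow> nat \<Rightarrow> nat \<Rightarrow> stm" where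
  "ty_factor_image i l m =
    (\<Pi> X\<in>U i. \<Pi> Y\<in>U l. \<Pi> f\<in>(X \<rightarrow> Y). isSmall m (image i l X Y f) \<rightarrow>
      (\<Sigma> Q\<in>U m. \<Sigma> t\<in>(Q \<rightarrow> Y). \<Sigma> h\<in>(X \<rightarrow> Q). (\<Pi> p\<in>Q. \<Pi> q\<in>Q. t \<cdot> p =\<^bsub>Y\<^esub> t \<cdot> q \<rightarrow> p =\<^bsub>Q\<^esub> q) \<otimes>
        (\<Pi> x\<in>X. t \<cdot> (h \<cdot> x) =\<^bsub>Y\<^esub> f \<cdot> x) \<otimes> (\<Pi> q\<in>Q. K (Trunc (max i l)) \<cdot> fibre X Y f (t \<cdot> q))))"

lemmas [ty_apply] = ty_factor_image_def[THEN fun_cong]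

lemma inh_factor_image [inh]: "inhabited \<Theta> (ty_factor_image i l m)"
  by (rule inhabitedI[where
      Ts="[ty_factor_retract i l m, ty_equiv_inverse m (max i l)]" and
      e="let FR = bvar 0; INV = bvar 1 in
         \<^bold>\<lambda>X Y f sm. let E = INV \<cdot> (FST sm) \<cdot> (image i l X Y f) \<cdot> (SND sm) in
           PR (FST sm)
             (FR \<cdot> X \<cdot> Y \<cdot> f \<cdot> (FST sm) \<cdot> (FST E) \<cdot> (FST (SND E)) \<cdot> (FST (SND (SND E))) \<cdot>
               (SND (SND (SND E))))"])
    (simp_all only: elab_eval ty_apply inh cong: elab_cong)

definition ty_factor_quotient :: "nat \<Rightarrow> nat \<Rightarrow> nat \<Rightarrow> nat \<Rightarrow> stm" where
  "ty_factor_quotient i j l m =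
    (\<Pi> X\<in>U i. \<Pi> R\<in>(X \<rightarrow> X \<rightarrow> U j). \<Pi> Y\<in>U l. \<Pi> f\<in>(X \<rightarrow> Y). isSet Y \<rightarrow> identifies X R Y f \<rightarrow>
      effective X R Y f \<rightarrow>
      (\<Pi> Q\<in>U m. \<Pi> t\<in>(Q \<rightarrow> Y). \<Pi> h\<in>(X \<rightarrow> Q). (\<Pi> p\<in>Q. \<Pi> q\<in>Q. t \<cdot> p =\<^bsub>Y\<^esub> t \<cdot> q \<rightarrow> p =\<^bsub>Q\<^esub> q) \<rightarrow>
        (\<Pi> x\<in>X. t \<cdot> (h \<cdot> x) =\<^bsub>Y\<^esub> f \<cdot> x) \<rightarrow> (\<Pi> q\<in>Q. K (Trunc (max i l)) \<cdot> fibre X Y f (t \<cdot> q)) \<rightarrow>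
        isSet Q \<otimes> identifies X R Q h \<otimes> effective X R Q h \<otimes> surjective (max i m) X Q h))"

lemmas [ty_apply] = ty_factor_quotient_def[THEN fun_cong]

text \<open>Everything is tested after applying the injective map \<open>t\<close>, where
  \<open>t (h x) = f x\<close>: respecting \<open>R\<close> and effectiveness carry over from
  \<open>f\<close>, and a point of the fibre of \<open>f\<close> over \<open>t q\<close> lies in the
  fibre of \<open>h\<close> over \<open>q\<close>. That \<open>Q\<close> is a set is
  \<open>ty_hedberg\<close> for the relation \<open>t p = t q\<close>.\<close>

lemma inh_factor_quotient [inh]: "inhabited \<Theta> (ty_factor_quotient i j l m)"
  by (rule inhabitedI[where
      Ts="[ty_hedberg m l, ty_trunc_in (max i m), ty_trunc_prop (max i m),
            ty_trunc_rec (max i l) (max i m), ty_trans l, ty_sym l, ty_ap m l]" and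
      e="let HED = bvar 0; TI = bvar 1; TP = bvar 2; REC = bvar 3; TRANS = bvar 4; SYM = bvar 5;
           AP = bvar 6 in
         \<^bold>\<lambda>X R Y f sY id ef Q t h emb at cov.
           PR
             (HED \<cdot> Q \<cdot> (\<^bold>\<lambda>p q. t \<cdot> p =\<^bsub>Y\<^esub> t \<cdot> q) \<cdot> (\<^bold>\<lambda>p q. sY \<cdot> (t \<cdot> p) \<cdot> (t \<cdot> q)) \<cdot> (\<^bold>\<lambda>p. RFL) \<cdot>
               emb)
             (PR
               (\<^bold>\<lambda>x y p. emb \<cdot> (h \<cdot> x) \<cdot> (h \<cdot> y) \<cdot>
                 (TRANS \<cdot> Y \<cdot> (t \<cdot> (h \<cdot> x)) \<cdot> (f \<cdot> x) \<cdot> (t \<cdot> (h \<cdot> y)) \<cdot> (at \<cdot> x) \<cdot>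
                   (TRANS \<cdot> Y \<cdot> (f \<cdot> x) \<cdot> (f \<cdot> y) \<cdot> (t \<cdot> (h \<cdot> y)) \<cdot> (id \<cdot> x \<cdot> y \<cdot> p) \<cdot>
                     (SYM \<cdot> Y \<cdot> (t \<cdot> (h \<cdot> y)) \<cdot> (f \<cdot> y) \<cdot> (at \<cdot> y)))))
               (PR
                 (\<^bold>\<lambda>x y p. ef \<cdot> x \<cdot> y \<cdot>
                   (TRANS \<cdot> Y \<cdot> (f \<cdot> x) \<cdot> (t \<cdot> (h \<cdot> x)) \<cdot> (f \<cdot> y) \<cdot>
                     (SYM \<cdot> Y \<cdot> (t \<cdot> (h \<cdot> x)) \<cdot> (f \<cdot> x) \<cdot> (at \<cdot> x)) \<cdot>
                     (TRANS \<cdot> Y \<cdot> (t \<cdot> (h \<cdot> x)) \<cdot> (t \<cdot> (h \<cdot> y)) \<cdot> (f \<cdot> y) \<cdot>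
                       (AP \<cdot> Q \<cdot> Y \<cdot> t \<cdot> (h \<cdot> x) \<cdot> (h \<cdot> y) \<cdot> p) \<cdot> (at \<cdot> y))))
                 (\<^bold>\<lambda>q. REC \<cdot> (fibre X Y f (t \<cdot> q)) \<cdot> (K (Trunc (max i m)) \<cdot> fibre X Q h q) \<cdot>
                   (TP \<cdot> (fibre X Q h q)) \<cdot>
                   (\<^bold>\<lambda>z. TI \<cdot> (fibre X Q h q) \<cdot>
                     (PR (FST z)
                       (emb \<cdot> (h \<cdot> (FST z)) \<cdot> q \<cdot>
                         (TRANS \<cdot> Y \<cdot> (t \<cdot> (h \<cdot> (FST z))) \<cdot> (f \<cdot> (FST z)) \<cdot> (t \<cdot> q) \<cdot>
                           (at \<cdot> (FST z)) \<cdot> (SND z))))) \<cdot>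
                   (cov \<cdot> q))))"])
    (simp_all only: elab_eval ty_apply inh cong: elab_cong)

section \<open>Universal property and induction from effectiveness and surjectivity\<close>

definition ty_induction :: "nat \<Rightarrow> nat \<Rightarrow> nat \<Rightarrow> stm" where
  "ty_induction i m w =
    (\<Pi> X\<in>U i. \<Pi> Q\<in>U m. \<Pi> h\<in>(X \<rightarrow> Q). surjective (max i m) X Q h \<rightarrow> quotient_induction w X Q h)"

lemmas [ty_apply] = ty_induction_def[THEN fun_cong]

text \<open>Since \<open>P q\<close> is a proposition, a point \<open>x\<close> with
  \<open>h x = q\<close> may be extracted from the truncated fibre; transport then carries
  \<open>P (h x)\<close> to \<open>P q\<close>.\<close>

lemma inh_induction [inh]: "inhabited \<Theta> (ty_induction i m w)"
  by (rule inhabitedI[where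
      Ts="[ty_trunc_rec (max i m) w, ty_tr m w]" and
      e="let REC = bvar 0; TR = bvar 1 in
         \<^bold>\<lambda>X Q h su P pp d q. REC \<cdot> (fibre X Q h q) \<cdot> (P \<cdot> q) \<cdot> (pp \<cdot> q) \<cdot>
           (\<^bold>\<lambda>z. TR \<cdot> Q \<cdot> P \<cdot> (h \<cdot> (FST z)) \<cdot> q \<cdot> (SND z) \<cdot> (d \<cdot> (FST z))) \<cdot> (su \<cdot> q)"])
    (simp_all only: elab_eval ty_apply inh cong: elab_cong)

definition ty_value_at_prop :: "nat \<Rightarrow> nat \<Rightarrow> nat \<Rightarrow> stm" where
  "ty_value_at_prop i m w =
    (\<Pi> X\<in>U i. \<Pi> Q\<in>U m. \<Pi> h\<in>(X \<rightarrow> Q). surjective (max i m) X Q h \<rightarrow>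
      (\<Pi> A\<in>U w. isSet A \<rightarrow> (\<Pi> f\<in>(X \<rightarrow> A). \<Pi> q\<in>Q. isProp (value_at X Q h A f q))))"

lemmas [ty_apply] = ty_value_at_prop_def[THEN fun_cong]

text \<open>Two values at \<open>q\<close> both agree with \<open>f x\<close> for any
  \<open>x\<close> in the fibre over \<open>q\<close>. Such an \<open>x\<close> exists only up to
  truncation, which is enough because identity in the set \<open>A\<close> is a proposition.\<close>

lemma inh_value_at_prop [inh]: "inhabited \<Theta> (ty_value_at_prop i m w)"
  by (rule inhabitedI[where
      Ts="[ty_Sg_eq w (max i (max m w)), ty_prop_Pi i (max m w), ty_prop_Pi m w,
            ty_trunc_rec (max i m) w, ty_trans w, ty_sym w]" and
      e="let SEQ = bvar 0; PX = bvar 1; PE = bvar 2; REC = bvar 3; TRANS = bvar 4; SYM = bvar 5 in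
         \<^bold>\<lambda>X Q h su A sA f q u v. SEQ \<cdot> A \<cdot> (\<^bold>\<lambda>a. \<Pi> x\<in>X. h \<cdot> x =\<^bsub>Q\<^esub> q \<rightarrow> f \<cdot> x =\<^bsub>A\<^esub> a) \<cdot>
           (\<^bold>\<lambda>a. PX \<cdot> X \<cdot> (\<^bold>\<lambda>x. h \<cdot> x =\<^bsub>Q\<^esub> q \<rightarrow> f \<cdot> x =\<^bsub>A\<^esub> a) \<cdot>
             (\<^bold>\<lambda>x. PE \<cdot> (h \<cdot> x =\<^bsub>Q\<^esub> q) \<cdot> (\<^bold>\<lambda>p. f \<cdot> x =\<^bsub>A\<^esub> a) \<cdot> (\<^bold>\<lambda>p. sA \<cdot> (f \<cdot> x) \<cdot> a))) \<cdot>
           u \<cdot> v \<cdot>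
           (REC \<cdot> (fibre X Q h q) \<cdot> (FST u =\<^bsub>A\<^esub> FST v) \<cdot> (sA \<cdot> (FST u) \<cdot> (FST v)) \<cdot>
             (\<^bold>\<lambda>z. TRANS \<cdot> A \<cdot> (FST u) \<cdot> (f \<cdot> (FST z)) \<cdot> (FST v) \<cdot>
               (SYM \<cdot> A \<cdot> (f \<cdot> (FST z)) \<cdot> (FST u) \<cdot> (SND u \<cdot> (FST z) \<cdot> (SND z))) \<cdot>
               (SND v \<cdot> (FST z) \<cdot> (SND z))) \<cdot>
             (su \<cdot> q))"])
    (simp_all only: elab_eval ty_apply inh cong: elab_cong)

definition ty_value_at :: "nat \<Rightarrow> nat \<Rightarrow> nat \<Rightarrow> nat \<Rightarrow> stm" where
  "ty_value_at i j m w =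
    (\<Pi> X\<in>U i. \<Pi> R\<in>(X \<rightarrow> X \<rightarrow> U j). \<Pi> Q\<in>U m. \<Pi> h\<in>(X \<rightarrow> Q). effective X R Q h \<rightarrow>
      surjective (max i m) X Q h \<rightarrow>
      (\<Pi> A\<in>U w. isSet A \<rightarrow> (\<Pi> f\<in>(X \<rightarrow> A). identifies X R A f \<rightarrow> (\<Pi> q\<in>Q. value_at X Q h A f q))))"

lemmas [ty_apply] = ty_value_at_def[THEN fun_cong]

text \<open>As the values at \<open>q\<close> form a proposition, induction reduces the claim to
  \<open>q = h x\<close>, where the value is \<open>f x\<close>. Effectiveness is what makes it
  correct: \<open>h x' = h x\<close> gives \<open>R x' x\<close> and thus
  \<open>f x' = f x\<close>.\<close>

lemma inh_value_at [inh]: "inhabited \<Theta> (ty_value_at i j m w)"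
  by (rule inhabitedI[where
      Ts="[ty_induction i m (max i (max m w)), ty_value_at_prop i m w]" and
      e="let IND = bvar 0; VP = bvar 1 in
         \<^bold>\<lambda>X R Q h ef su A sA f id. IND \<cdot> X \<cdot> Q \<cdot> h \<cdot> su \<cdot> (\<^bold>\<lambda>q. value_at X Q h A f q) \<cdot>
           (VP \<cdot> X \<cdot> Q \<cdot> h \<cdot> su \<cdot> A \<cdot> sA \<cdot> f) \<cdot>
           (\<^bold>\<lambda>x. PR (f \<cdot> x) (\<^bold>\<lambda>x' p. id \<cdot> x' \<cdot> x \<cdot> (ef \<cdot> x' \<cdot> x \<cdot> p)))"])
    (simp_all only: elab_eval ty_apply inh cong: elab_cong)

definition ty_extension :: "nat \<Rightarrow> nat \<Rightarrow> nat \<Rightarrow> nat \<Rightarrow> stm" where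
  "ty_extension i j m w =
    (\<Pi> X\<in>U i. \<Pi> R\<in>(X \<rightarrow> X \<rightarrow> U j). \<Pi> Q\<in>U m. \<Pi> h\<in>(X \<rightarrow> Q). effective X R Q h \<rightarrow>
      surjective (max i m) X Q h \<rightarrow>
      (\<Pi> A\<in>U w. isSet A \<rightarrow>
        (\<Pi> f\<in>(X \<rightarrow> A). identifies X R A f \<rightarrow> (\<Sigma> g\<in>(Q \<rightarrow> A). (\<Lambda> x\<in>X. g \<cdot> (h \<cdot> x)) =\<^bsub>X \<rightarrow> A\<^esub> f))))"

lemmas [ty_apply] = ty_extension_def[THEN fun_cong]

lemma inh_extension [inh]: "inhabited \<Theta> (ty_extension i j m w)"
  by (rule inhabitedI[where
      Ts="[ty_value_at i j m w, ty_funext i w, ty_sym w]" and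
      e="let V = bvar 0; FE = bvar 1; SYM = bvar 2 in
         \<^bold>\<lambda>X R Q h ef su A sA f id. let v = V \<cdot> X \<cdot> R \<cdot> Q \<cdot> h \<cdot> ef \<cdot> su \<cdot> A \<cdot> sA \<cdot> f \<cdot> id in
           PR (\<^bold>\<lambda>q. FST (v \<cdot> q))
             (FE \<cdot> X \<cdot> (\<^bold>\<lambda>x. A) \<cdot> (\<^bold>\<lambda>x. FST (v \<cdot> (h \<cdot> x))) \<cdot> f \<cdot>
               (\<^bold>\<lambda>x. SYM \<cdot> A \<cdot> (f \<cdot> x) \<cdot> (FST (v \<cdot> (h \<cdot> x))) \<cdot> (SND (v \<cdot> (h \<cdot> x)) \<cdot> x \<cdot> RFL)))"])
    (simp_all only: elab_eval ty_apply inh cong: elab_cong)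

definition ty_extension_unique :: "nat \<Rightarrow> nat \<Rightarrow> nat \<Rightarrow> stm" where
  "ty_extension_unique i m w =
    (\<Pi> X\<in>U i. \<Pi> Q\<in>U m. \<Pi> h\<in>(X \<rightarrow> Q). surjective (max i m) X Q h \<rightarrow>
      (\<Pi> A\<in>U w. isSet A \<rightarrow>
        (\<Pi> f\<in>(X \<rightarrow> A). \<Pi> g\<in>(Q \<rightarrow> A). \<Pi> k\<in>(Q \<rightarrow> A). (\<Lambda> x\<in>X. g \<cdot> (h \<cdot> x)) =\<^bsub>X \<rightarrow> A\<^esub> f \<rightarrow>
          (\<Lambda> x\<in>X. k \<cdot> (h \<cdot> x)) =\<^bsub>X \<rightarrow> A\<^esub> f \<rightarrow> g =\<^bsub>Q \<rightarrow> A\<^esub> k)))"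

lemmas [ty_apply] = ty_extension_unique_def[THEN fun_cong]

text \<open>The maps agree with \<open>f\<close>, hence with each other, on all points
  \<open>h x\<close>; induction extends this to all of \<open>Q\<close>, as \<open>g q = k q\<close>
  is a proposition.\<close>

lemma inh_extension_unique [inh]: "inhabited \<Theta> (ty_extension_unique i m w)"
  by (rule inhabitedI[where
      Ts="[ty_induction i m w, ty_funext m w, ty_trans w, ty_sym w, ty_ap (max i w) w]" and
      e="let IND = bvar 0; FE = bvar 1; TRANS = bvar 2; SYM = bvar 3; AP = bvar 4 in
         \<^bold>\<lambda>X Q h su A sA f g k p p'. FE \<cdot> Q \<cdot> (\<^bold>\<lambda>q. A) \<cdot> g \<cdot> k \<cdot>
           (IND \<cdot> X \<cdot> Q \<cdot> h \<cdot> su \<cdot> (\<^bold>\<lambda>q. g \<cdot> q =\<^bsub>A\<^esub> k \<cdot> q) \<cdot> (\<^bold>\<lambda>q. sA \<cdot> (g \<cdot> q) \<cdot> (k \<cdot> q)) \<cdot>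
             (\<^bold>\<lambda>x. TRANS \<cdot> A \<cdot> (g \<cdot> (h \<cdot> x)) \<cdot> (f \<cdot> x) \<cdot> (k \<cdot> (h \<cdot> x)) \<cdot>
               (AP \<cdot> (X \<rightarrow> A) \<cdot> A \<cdot> (\<^bold>\<lambda>e. e \<cdot> x) \<cdot> (\<Lambda> x\<in>X. g \<cdot> (h \<cdot> x)) \<cdot> f \<cdot> p) \<cdot>
               (SYM \<cdot> A \<cdot> (k \<cdot> (h \<cdot> x)) \<cdot> (f \<cdot> x) \<cdot>
                 (AP \<cdot> (X \<rightarrow> A) \<cdot> A \<cdot> (\<^bold>\<lambda>e. e \<cdot> x) \<cdot> (\<Lambda> x\<in>X. k \<cdot> (h \<cdot> x)) \<cdot> f \<cdot> p'))))"])
    (simp_all only: elab_eval ty_apply inh cong: elab_cong)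

definition ty_universal :: "nat \<Rightarrow> nat \<Rightarrow> nat \<Rightarrow> nat \<Rightarrow> stm" where
  "ty_universal i j m w =
    (\<Pi> X\<in>U i. \<Pi> R\<in>(X \<rightarrow> X \<rightarrow> U j). \<Pi> Q\<in>U m. \<Pi> h\<in>(X \<rightarrow> Q). effective X R Q h \<rightarrow>
      surjective (max i m) X Q h \<rightarrow> quotient_universal w X R Q h)"

lemmas [ty_apply] = ty_universal_def[THEN fun_cong]

text \<open>Functions from \<open>X\<close> to the set \<open>A\<close> form a set, so the equation
  paired with \<open>g\<close> is a proposition, and contractibility reduces to uniqueness of
  \<open>g\<close>.\<close>

lemma inh_universal [inh]: "inhabited \<Theta> (ty_universal i j m w)"
  by (rule inhabitedI[where
      Ts="[ty_extension i j m w, ty_extension_unique i m w, ty_Sg_eq (max m w) (max i w),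
            ty_set_Pi i w]" and
      e="let EXT = bvar 0; UNIQ = bvar 1; SEQ = bvar 2; SPI = bvar 3 in
         \<^bold>\<lambda>X R Q h ef su A sA f id. let c = EXT \<cdot> X \<cdot> R \<cdot> Q \<cdot> h \<cdot> ef \<cdot> su \<cdot> A \<cdot> sA \<cdot> f \<cdot> id in
           PR c
             (\<^bold>\<lambda>y. SEQ \<cdot> (Q \<rightarrow> A) \<cdot> (\<^bold>\<lambda>g. (\<Lambda> x\<in>X. g \<cdot> (h \<cdot> x)) =\<^bsub>X \<rightarrow> A\<^esub> f) \<cdot>
               (\<^bold>\<lambda>g. SPI \<cdot> X \<cdot> (\<^bold>\<lambda>x. A) \<cdot> (\<^bold>\<lambda>x. sA) \<cdot> (\<Lambda> x\<in>X. g \<cdot> (h \<cdot> x)) \<cdot> f) \<cdot> c \<cdot> y \<cdot>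
               (UNIQ \<cdot> X \<cdot> Q \<cdot> h \<cdot> su \<cdot> A \<cdot> sA \<cdot> f \<cdot> (FST c) \<cdot> (FST y) \<cdot> (SND c) \<cdot> (SND y)))"])
    (simp_all only: elab_eval ty_apply inh cong: elab_cong)

section \<open>The quotient as a small copy of the image of the predicate map\<close>

definition ty_predicate_map :: "nat \<Rightarrow> nat \<Rightarrow> stm" where
  "ty_predicate_map i j =
    (for_eqrels i j
      (\<lambda>X R e. \<Sigma> f\<in>(X \<rightarrow> subsets j X). identifies X R (subsets j X) f \<otimes>
        effective X R (subsets j X) f))"

lemmas [ty_apply] = ty_predicate_map_def[THEN fun_cong]

text \<open>Effectiveness: \<open>y\<close> is a member of \<open>F y\<close> by reflexivity of
  \<open>R\<close>, and transporting this membership along \<open>F y = F x\<close> gives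
  \<open>R x y\<close>. The other direction turns \<open>R x y\<close> into
  \<open>same_members\<close> by symmetry and transitivity.\<close>

lemma inh_predicate_map [inh]: "inhabited \<Theta> (ty_predicate_map i j)"
  by (rule inhabitedI[where
      Ts="[ty_subsets_ext i j, ty_tr (max i (Suc j)) j, ty_sym (max i (Suc j))]" and
      e="let EXT = bvar 0; TR = bvar 1; SYM = bvar 2 in
         \<^bold>\<lambda>X R e. let F = (\<lambda>x. PR (R \<cdot> x) (FST e \<cdot> x)); sy = FST (SND (SND e));
           tr = SND (SND (SND e)) in
           PR (\<^bold>\<lambda>x. F x)
             (PR
               (\<^bold>\<lambda>x y p. EXT \<cdot> X \<cdot> (F x) \<cdot> (F y) \<cdot>
                 (\<^bold>\<lambda>z. PR (tr \<cdot> y \<cdot> x \<cdot> z \<cdot> (sy \<cdot> x \<cdot> y \<cdot> p)) (tr \<cdot> x \<cdot> y \<cdot> z \<cdot> p)))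
               (\<^bold>\<lambda>x y p. TR \<cdot> (subsets j X) \<cdot> (\<^bold>\<lambda>S. member j X S y) \<cdot> (F y) \<cdot> (F x) \<cdot>
                 (SYM \<cdot> (subsets j X) \<cdot> (F x) \<cdot> (F y) \<cdot> p) \<cdot> (FST (SND e) \<cdot> y)))"])
    (simp_all only: elab_eval ty_apply inh cong: elab_cong)

definition ty_quotient_of_factor :: "nat \<Rightarrow> nat \<Rightarrow> stm" where
  "ty_quotient_of_factor i j =
    (\<Pi> X\<in>U i. \<Pi> R\<in>(X \<rightarrow> X \<rightarrow> U j). \<Pi> f\<in>(X \<rightarrow> subsets j X). identifies X R (subsets j X) f \<rightarrow>
      effective X R (subsets j X) f \<rightarrow>
      (\<Sigma> Q\<in>U (max i j). \<Sigma> t\<in>(Q \<rightarrow> subsets j X). \<Sigma> h\<in>(X \<rightarrow> Q).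
        (\<Pi> p\<in>Q. \<Pi> q\<in>Q. t \<cdot> p =\<^bsub>subsets j X\<^esub> t \<cdot> q \<rightarrow> p =\<^bsub>Q\<^esub> q) \<otimes>
        (\<Pi> x\<in>X. t \<cdot> (h \<cdot> x) =\<^bsub>subsets j X\<^esub> f \<cdot> x) \<otimes>
        (\<Pi> q\<in>Q. K (Trunc (max i (Suc j))) \<cdot> fibre X (subsets j X) f (t \<cdot> q))) \<rightarrow>
      (\<Sigma> Q\<in>U (max i j). \<Sigma> h\<in>(X \<rightarrow> Q). quotient_props i j X R Q h))"

lemmas [ty_apply] = ty_quotient_of_factor_def[THEN fun_cong]

text \<open>The data are taken apart by nested \<open>SPLIT\<close>s with constant motive, so that
  \<open>FQ\<close> is applied to variables instead of iterated projections.\<close>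

lemma inh_quotient_of_factor [inh]: "inhabited \<Theta> (ty_quotient_of_factor i j)"
  by (rule inhabitedI[where
      Ts="[ty_factor_quotient i j (max i (Suc j)) (max i j), ty_set_subsets i j]" and
      e="let FQ = bvar 0; SS = bvar 1 in
         \<^bold>\<lambda>X R f id ef D. let Y = subsets j X;
           G = (\<Sigma> Q\<in>U (max i j). \<Sigma> h\<in>(X \<rightarrow> Q). quotient_props i j X R Q h) in
           SPLIT (\<lambda>D. G)
             (\<lambda>Q D.
               SPLIT (\<lambda>D. G)
                 (\<lambda>t D.
                   SPLIT (\<lambda>D. G)
                     (\<lambda>h D.
                       SPLIT (\<lambda>D. G)
                         (\<lambda>emb D.
                           SPLIT (\<lambda>D. G)
                             (\<lambda>at cov.
                               PR Q
                                 (PR h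
                                   (FQ \<cdot> X \<cdot> R \<cdot> Y \<cdot> f \<cdot> (SS \<cdot> X) \<cdot> id \<cdot> ef \<cdot> Q \<cdot> t \<cdot> h \<cdot> emb \<cdot> at \<cdot>
                                     cov))) D) D) D) D) D"])
    (simp_all only: elab_eval ty_apply inh cong: elab_cong)

definition ty_quotient_of_map :: "nat \<Rightarrow> nat \<Rightarrow> stm" where
  "ty_quotient_of_map i j =
    (\<Pi> X\<in>U i. \<Pi> R\<in>(X \<rightarrow> X \<rightarrow> U j). \<Pi> f\<in>(X \<rightarrow> subsets j X). identifies X R (subsets j X) f \<rightarrow>
      effective X R (subsets j X) f \<rightarrow> (\<Sigma> Q\<in>U (max i j). \<Sigma> h\<in>(X \<rightarrow> Q). quotient_props i j X R Q h))"

lemmas [ty_apply] = ty_quotient_of_map_def[THEN fun_cong]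

text \<open>Replacement is instantiated with the identity as smallness of \<open>X : U i\<close> and
  with local smallness of \<open>subsets j X\<close> at level \<open>max i j\<close>. The image then
  becomes small at \<open>max i (max i j)\<close>, which is the level \<open>max i j\<close>
  required of the quotient.\<close>

lemma inh_quotient_of_map [inh]:
  assumes "set_replacement \<Theta>"
  shows "inhabited \<Theta> (ty_quotient_of_map i j)"
  by (rule inhabitedI[where
      Ts="[replacement_type i (max i j) i (max i (Suc j)),
            ty_factor_image i (max i (Suc j)) (max i j), ty_quotient_of_factor i j,
            ty_set_subsets i j, ty_small_subsets i j]" and
      e="let REPL = bvar 0; FI = bvar 1; QF = bvar 2; SS = bvar 3; LS = bvar 4 in
         \<^bold>\<lambda>X R f id ef. QF \<cdot> X \<cdot> R \<cdot> f \<cdot> id \<cdot> ef \<cdot>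
           (FI \<cdot> X \<cdot> (subsets j X) \<cdot> f \<cdot>
             (REPL \<cdot> X \<cdot> (subsets j X) \<cdot> f \<cdot>
               (PR X (PR (\<^bold>\<lambda>x. x) (PR (PR (\<^bold>\<lambda>x. x) (\<^bold>\<lambda>x. RFL)) (PR (\<^bold>\<lambda>x. x) (\<^bold>\<lambda>x. RFL))))) \<cdot>
               (LS \<cdot> X) \<cdot> (SS \<cdot> X)))"])
    (simp_all only: elab_eval ty_apply inh assms assms[unfolded set_replacement_def, rule_format] cong: elab_cong)

definition ty_quotient :: "nat \<Rightarrow> nat \<Rightarrow> stm" where
  "ty_quotient i j =
    (for_eqrels i j (\<lambda>X R e. \<Sigma> Q\<in>U (max i j). \<Sigma> h\<in>(X \<rightarrow> Q). quotient_props i j X R Q h))"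

lemmas [ty_apply] = ty_quotient_def[THEN fun_cong]

lemma inh_quotient [inh]:
  assumes "set_replacement \<Theta>"
  shows "inhabited \<Theta> (ty_quotient i j)"
  by (rule inhabitedI[where
      Ts="[ty_predicate_map i j, ty_quotient_of_map i j]" and
      e="let PM = bvar 0; QM = bvar 1 in
         \<^bold>\<lambda>X R e. let P = PM \<cdot> X \<cdot> R \<cdot> e in QM \<cdot> X \<cdot> R \<cdot> (FST P) \<cdot> (FST (SND P)) \<cdot> (SND (SND P))"])
    (simp_all only: elab_eval ty_apply inh assms assms[unfolded set_replacement_def, rule_format] cong: elab_cong)

text \<open>The quotient and its map are now variables, so that closed terms can be substituted for them.\<close>

definition ty_choice_set :: "nat \<Rightarrow> nat \<Rightarrow> stm" where
  "ty_choice_set i j =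
    (\<Pi> QQ\<in>for_eqrels i j (\<lambda>X R e. U (max i j)). \<Pi> hh\<in>for_eqrels i j (\<lambda>X R e. X \<rightarrow> QQ \<cdot> X \<cdot> R \<cdot> e).
      for_eqrels i j (\<lambda>X R e. quotient_props i j X R (QQ \<cdot> X \<cdot> R \<cdot> e) (hh \<cdot> X \<cdot> R \<cdot> e)) \<rightarrow>
      for_eqrels i j (\<lambda>X R e. isSet (QQ \<cdot> X \<cdot> R \<cdot> e)))"

lemmas [ty_apply] = ty_choice_set_def[THEN fun_cong]

lemma inh_choice_set [inh]: "inhabited \<Theta> (ty_choice_set i j)"
  by (rule inhabitedI[where
      Ts="[]" and
      e="\<^bold>\<lambda>QQ hh pr X R e. FST (pr \<cdot> X \<cdot> R \<cdot> e)"])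
    (simp_all only: elab_eval ty_apply inh cong: elab_cong)

definition ty_choice_identifies :: "nat \<Rightarrow> nat \<Rightarrow> stm" where
  "ty_choice_identifies i j =
    (\<Pi> QQ\<in>for_eqrels i j (\<lambda>X R e. U (max i j)). \<Pi> hh\<in>for_eqrels i j (\<lambda>X R e. X \<rightarrow> QQ \<cdot> X \<cdot> R \<cdot> e).
      for_eqrels i j (\<lambda>X R e. quotient_props i j X R (QQ \<cdot> X \<cdot> R \<cdot> e) (hh \<cdot> X \<cdot> R \<cdot> e)) \<rightarrow>
      for_eqrels i j (\<lambda>X R e. identifies X R (QQ \<cdot> X \<cdot> R \<cdot> e) (hh \<cdot> X \<cdot> R \<cdot> e)))"

lemmas [ty_apply] = ty_choice_identifies_def[THEN fun_cong]

lemma inh_choice_identifies [inh]: "inhabited \<Theta> (ty_choice_identifies i j)"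
  by (rule inhabitedI[where
      Ts="[]" and
      e="\<^bold>\<lambda>QQ hh pr X R e. FST (SND (pr \<cdot> X \<cdot> R \<cdot> e))"])
    (simp_all only: elab_eval ty_apply inh cong: elab_cong)

definition ty_choice_universal :: "nat \<Rightarrow> nat \<Rightarrow> nat \<Rightarrow> stm" where
  "ty_choice_universal i j w =
    (\<Pi> QQ\<in>for_eqrels i j (\<lambda>X R e. U (max i j)). \<Pi> hh\<in>for_eqrels i j (\<lambda>X R e. X \<rightarrow> QQ \<cdot> X \<cdot> R \<cdot> e).
      for_eqrels i j (\<lambda>X R e. quotient_props i j X R (QQ \<cdot> X \<cdot> R \<cdot> e) (hh \<cdot> X \<cdot> R \<cdot> e)) \<rightarrow>
      for_eqrels i j (\<lambda>X R e. quotient_universal w X R (QQ \<cdot> X \<cdot> R \<cdot> e) (hh \<cdot> X \<cdot> R \<cdot> e)))"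

lemmas [ty_apply] = ty_choice_universal_def[THEN fun_cong]

lemma inh_choice_universal [inh]: "inhabited \<Theta> (ty_choice_universal i j w)"
  by (rule inhabitedI[where
      Ts="[ty_universal i j (max i j) w]" and
      e="let UNIV = bvar 0 in
         \<^bold>\<lambda>QQ hh pr X R e. UNIV \<cdot> X \<cdot> R \<cdot> (QQ \<cdot> X \<cdot> R \<cdot> e) \<cdot> (hh \<cdot> X \<cdot> R \<cdot> e) \<cdot>
           (FST (SND (SND (pr \<cdot> X \<cdot> R \<cdot> e)))) \<cdot> (SND (SND (SND (pr \<cdot> X \<cdot> R \<cdot> e))))"])
    (simp_all only: elab_eval ty_apply inh cong: elab_cong)

definition ty_choice_induction :: "nat \<Rightarrow> nat \<Rightarrow> nat \<Rightarrow> stm" where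
  "ty_choice_induction i j w =
    (\<Pi> QQ\<in>for_eqrels i j (\<lambda>X R e. U (max i j)). \<Pi> hh\<in>for_eqrels i j (\<lambda>X R e. X \<rightarrow> QQ \<cdot> X \<cdot> R \<cdot> e).
      for_eqrels i j (\<lambda>X R e. quotient_props i j X R (QQ \<cdot> X \<cdot> R \<cdot> e) (hh \<cdot> X \<cdot> R \<cdot> e)) \<rightarrow>
      for_eqrels i j (\<lambda>X R e. quotient_induction w X (QQ \<cdot> X \<cdot> R \<cdot> e) (hh \<cdot> X \<cdot> R \<cdot> e)))"

lemmas [ty_apply] = ty_choice_induction_def[THEN fun_cong]

lemma inh_choice_induction [inh]: "inhabited \<Theta> (ty_choice_induction i j w)"
  by (rule inhabitedI[where
      Ts="[ty_induction i (max i j) w]" and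
      e="let IND = bvar 0 in
         \<^bold>\<lambda>QQ hh pr X R e. IND \<cdot> X \<cdot> (QQ \<cdot> X \<cdot> R \<cdot> e) \<cdot> (hh \<cdot> X \<cdot> R \<cdot> e) \<cdot>
           (SND (SND (SND (pr \<cdot> X \<cdot> R \<cdot> e))))"])
    (simp_all only: elab_eval ty_apply inh cong: elab_cong)

section \<open>Replacement from quotients\<close>

definition ty_fibre_prop :: "nat \<Rightarrow> nat \<Rightarrow> stm" where
  "ty_fibre_prop i j =
    (\<Pi> A\<in>U i. \<Pi> B\<in>U j. \<Pi> g\<in>(A \<rightarrow> B). isSet B \<rightarrow> (\<Pi> x\<in>A. \<Pi> y\<in>A. g \<cdot> x =\<^bsub>B\<^esub> g \<cdot> y \<rightarrow> x =\<^bsub>A\<^esub> y) \<rightarrow>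
      (\<Pi> y\<in>B. isProp (fibre A B g y)))"

lemmas [ty_apply] = ty_fibre_prop_def[THEN fun_cong]

lemma inh_fibre_prop [inh]: "inhabited \<Theta> (ty_fibre_prop i j)"
  by (rule inhabitedI[where
      Ts="[ty_Sg_eq i j, ty_trans j, ty_sym j]" and
      e="let SEQ = bvar 0; TRANS = bvar 1; SYM = bvar 2 in
         \<^bold>\<lambda>A B g sB inj y u v. SEQ \<cdot> A \<cdot> (\<^bold>\<lambda>x. g \<cdot> x =\<^bsub>B\<^esub> y) \<cdot> (\<^bold>\<lambda>x. sB \<cdot> (g \<cdot> x) \<cdot> y) \<cdot> u \<cdot> v \<cdot>
           (inj \<cdot> (FST u) \<cdot> (FST v) \<cdot>
             (TRANS \<cdot> B \<cdot> (g \<cdot> (FST u)) \<cdot> y \<cdot> (g \<cdot> (FST v)) \<cdot> (SND u) \<cdot>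
               (SYM \<cdot> B \<cdot> (g \<cdot> (FST v)) \<cdot> y \<cdot> (SND v))))"])
    (simp_all only: elab_eval ty_apply inh cong: elab_cong)

definition ty_bijective_equiv :: "nat \<Rightarrow> nat \<Rightarrow> stm" where
  "ty_bijective_equiv i j =
    (\<Pi> A\<in>U i. \<Pi> B\<in>U j. \<Pi> g\<in>(A \<rightarrow> B). isSet B \<rightarrow> (\<Pi> x\<in>A. \<Pi> y\<in>A. g \<cdot> x =\<^bsub>B\<^esub> g \<cdot> y \<rightarrow> x =\<^bsub>A\<^esub> y) \<rightarrow>
      surjective (max i j) A B g \<rightarrow> equiv A B)"

lemmas [ty_apply] = ty_bijective_equiv_def[THEN fun_cong]

text \<open>The fibres of an injective map into a set are propositions, so surjectivity can be
  untruncated with the fibre itself as target of \<open>REC\<close>. This gives a section, and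
  injectivity makes it a left inverse too.\<close>

lemma inh_bijective_equiv [inh]: "inhabited \<Theta> (ty_bijective_equiv i j)"
  by (rule inhabitedI[where
      Ts="[ty_fibre_prop i j, ty_trunc_rec (max i j) (max i j)]" and
      e="let FP = bvar 0; REC = bvar 1 in
         \<^bold>\<lambda>A B g sB inj su.
           let sec =
             (\<lambda>y. REC \<cdot> (fibre A B g y) \<cdot> (fibre A B g y) \<cdot> (FP \<cdot> A \<cdot> B \<cdot> g \<cdot> sB \<cdot> inj \<cdot> y) \<cdot>
               (\<^bold>\<lambda>z. z) \<cdot> (su \<cdot> y))
           in
           PR g
             (PR (PR (\<^bold>\<lambda>y. FST (sec y)) (\<^bold>\<lambda>y. SND (sec y)))
               (PR (\<^bold>\<lambda>y. FST (sec y)) (\<^bold>\<lambda>x. inj \<cdot> (FST (sec (g \<cdot> x))) \<cdot> x \<cdot> (SND (sec (g \<cdot> x))))))"])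
    (simp_all only: elab_eval ty_apply inh cong: elab_cong)

definition ty_pointwise :: "nat \<Rightarrow> nat \<Rightarrow> nat \<Rightarrow> stm" where
  "ty_pointwise i m t =
    (\<Pi> Z\<in>U i. \<Pi> Q\<in>U m. \<Pi> h\<in>(Z \<rightarrow> Q). \<Pi> T\<in>U t. \<Pi> f\<in>(Z \<rightarrow> T).
      (\<Sigma> g\<in>(Q \<rightarrow> T). (\<Lambda> x\<in>Z. g \<cdot> (h \<cdot> x)) =\<^bsub>Z \<rightarrow> T\<^esub> f) \<rightarrow>
      (\<Sigma> g\<in>(Q \<rightarrow> T). \<Pi> z\<in>Z. g \<cdot> (h \<cdot> z) =\<^bsub>T\<^esub> f \<cdot> z))"

lemmas [ty_apply] = ty_pointwise_def[THEN fun_cong]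

lemma inh_pointwise [inh]: "inhabited \<Theta> (ty_pointwise i m t)"
  by (rule inhabitedI[where
      Ts="[ty_ap (max i t) t]" and
      e="let AP = bvar 0 in
         \<^bold>\<lambda>Z Q h T f c.
           PR (FST c)
             (\<^bold>\<lambda>z. AP \<cdot> (Z \<rightarrow> T) \<cdot> T \<cdot> (\<^bold>\<lambda>e. e \<cdot> z) \<cdot> (\<Lambda> x\<in>Z. FST c \<cdot> (h \<cdot> x)) \<cdot> f \<cdot> (SND c))"])
    (simp_all only: elab_eval ty_apply inh cong: elab_cong)

definition ty_image_lift :: "nat \<Rightarrow> nat \<Rightarrow> nat \<Rightarrow> nat \<Rightarrow> nat \<Rightarrow> stm" where
  "ty_image_lift i j k l m =
    (\<Pi> X\<in>U k. \<Pi> Y\<in>U l. \<Pi> f\<in>(X \<rightarrow> Y). isSet Y \<rightarrow>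
      (\<Pi> Z\<in>U i. \<Pi> s\<in>(Z \<rightarrow> X). \<Pi> R\<in>(Z \<rightarrow> Z \<rightarrow> U j).
        (\<Pi> z\<in>Z. \<Pi> z'\<in>Z. R \<cdot> z \<cdot> z' \<rightarrow> f \<cdot> (s \<cdot> z) =\<^bsub>Y\<^esub> f \<cdot> (s \<cdot> z')) \<rightarrow>
        (\<Pi> Q\<in>U m. \<Pi> h\<in>(Z \<rightarrow> Q). quotient_universal (max k l) Z R Q h \<rightarrow>
          (\<Sigma> g\<in>(Q \<rightarrow> image k l X Y f). \<Pi> z\<in>Z. proj1 Y (g \<cdot> (h \<cdot> z)) =\<^bsub>Y\<^esub> f \<cdot> (s \<cdot> z)))))"

lemmas [ty_apply] = ty_image_lift_def[THEN fun_cong]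

text \<open>The point \<open>inc z\<close> of the image lies over \<open>f (s z)\<close>, with
  \<open>s z\<close> as witness. This map respects \<open>R\<close> because points of the image are
  identified through their first components, and the universal property applies as the image is a
  set.\<close>

lemma inh_image_lift [inh]: "inhabited \<Theta> (ty_image_lift i j k l m)"
  by (rule inhabitedI[where
      Ts="[ty_image_set k l, ty_image_eq k l, ty_trunc_in (max k l), ty_pointwise i m (max k l),
            ty_ap (max k l) l]" and
      e="let IS = bvar 0; IE = bvar 1; TI = bvar 2; PW = bvar 3; AP = bvar 4 in
         \<^bold>\<lambda>X Y f sY Z s R to Q h un. let Im = image k l X Y f;
           inc = (\<lambda>z. PR (f \<cdot> (s \<cdot> z)) (TI \<cdot> (fibre X Y f (f \<cdot> (s \<cdot> z))) \<cdot> (PR (s \<cdot> z) RFL)));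
           c = PW \<cdot> Z \<cdot> Q \<cdot> h \<cdot> Im \<cdot> (\<^bold>\<lambda>z. inc z) \<cdot>
           (FST
             (un \<cdot> Im \<cdot> (IS \<cdot> X \<cdot> Y \<cdot> f \<cdot> sY) \<cdot> (\<^bold>\<lambda>z. inc z) \<cdot>
               (\<^bold>\<lambda>z z' p. IE \<cdot> X \<cdot> Y \<cdot> f \<cdot> (inc z) \<cdot> (inc z') \<cdot> (to \<cdot> z \<cdot> z' \<cdot> p))))
           in
           PR (FST c) (\<^bold>\<lambda>z. AP \<cdot> Im \<cdot> Y \<cdot> (\<^bold>\<lambda>u. FST u) \<cdot> (FST c \<cdot> (h \<cdot> z)) \<cdot> (inc z) \<cdot> (SND c \<cdot> z))"])
    (simp_all only: elab_eval ty_apply inh cong: elab_cong)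

definition ty_lift_injective :: "nat \<Rightarrow> nat \<Rightarrow> nat \<Rightarrow> nat \<Rightarrow> nat \<Rightarrow> stm" where
  "ty_lift_injective i j l m t =
    (\<Pi> Z\<in>U i. \<Pi> R\<in>(Z \<rightarrow> Z \<rightarrow> U j). \<Pi> Y\<in>U l. \<Pi> F\<in>(Z \<rightarrow> Y).
      (\<Pi> z\<in>Z. \<Pi> z'\<in>Z. F \<cdot> z =\<^bsub>Y\<^esub> F \<cdot> z' \<rightarrow> R \<cdot> z \<cdot> z') \<rightarrow>
      (\<Pi> Q\<in>U m. \<Pi> h\<in>(Z \<rightarrow> Q). isSet Q \<rightarrow> identifies Z R Q h \<rightarrow> quotient_induction (max m t) Z Q h \<rightarrow>
        (\<Pi> T\<in>U t. \<Pi> p\<in>(T \<rightarrow> Y). \<Pi> g\<in>(Q \<rightarrow> T). (\<Pi> z\<in>Z. p \<cdot> (g \<cdot> (h \<cdot> z)) =\<^bsub>Y\<^esub> F \<cdot> z) \<rightarrow>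
          (\<Pi> q\<in>Q. \<Pi> q'\<in>Q. g \<cdot> q =\<^bsub>T\<^esub> g \<cdot> q' \<rightarrow> q =\<^bsub>Q\<^esub> q'))))"

lemmas [ty_apply] = ty_lift_injective_def[THEN fun_cong]

text \<open>Induction on both points, which is allowed because \<open>Q\<close> is a set. On
  \<open>h z\<close> and \<open>h z'\<close>, an identification of the values of \<open>g\<close>
  gives \<open>F z = F z'\<close>, hence \<open>R z z'\<close>, hence \<open>h z = h z'\<close>. The
  map \<open>p\<close> stands for the projection from the image to \<open>Y\<close>.\<close>

lemma inh_lift_injective [inh]: "inhabited \<Theta> (ty_lift_injective i j l m t)"
  by (rule inhabitedI[where
      Ts="[ty_prop_Pi m (max m t), ty_prop_Pi t m, ty_trans l, ty_sym l, ty_ap t l]" and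
      e="let PQ = bvar 0; PE = bvar 1; TRANS = bvar 2; SYM = bvar 3; AP = bvar 4 in
         \<^bold>\<lambda>Z R Y F fr Q h sQ id ind T p g gh. ind \<cdot> (\<^bold>\<lambda>q. \<Pi> q'\<in>Q. g \<cdot> q =\<^bsub>T\<^esub> g \<cdot> q' \<rightarrow> q =\<^bsub>Q\<^esub> q') \<cdot>
           (\<^bold>\<lambda>q. PQ \<cdot> Q \<cdot> (\<^bold>\<lambda>q'. g \<cdot> q =\<^bsub>T\<^esub> g \<cdot> q' \<rightarrow> q =\<^bsub>Q\<^esub> q') \<cdot>
             (\<^bold>\<lambda>q'. PE \<cdot> (g \<cdot> q =\<^bsub>T\<^esub> g \<cdot> q') \<cdot> (\<^bold>\<lambda>c. q =\<^bsub>Q\<^esub> q') \<cdot> (\<^bold>\<lambda>c. sQ \<cdot> q \<cdot> q'))) \<cdot>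
           (\<^bold>\<lambda>z. ind \<cdot> (\<^bold>\<lambda>q'. g \<cdot> (h \<cdot> z) =\<^bsub>T\<^esub> g \<cdot> q' \<rightarrow> h \<cdot> z =\<^bsub>Q\<^esub> q') \<cdot>
             (\<^bold>\<lambda>q'. PE \<cdot> (g \<cdot> (h \<cdot> z) =\<^bsub>T\<^esub> g \<cdot> q') \<cdot> (\<^bold>\<lambda>c. h \<cdot> z =\<^bsub>Q\<^esub> q') \<cdot>
               (\<^bold>\<lambda>c. sQ \<cdot> (h \<cdot> z) \<cdot> q')) \<cdot>
             (\<^bold>\<lambda>z' c. id \<cdot> z \<cdot> z' \<cdot>
               (fr \<cdot> z \<cdot> z' \<cdot>
                 (TRANS \<cdot> Y \<cdot> (F \<cdot> z) \<cdot> (p \<cdot> (g \<cdot> (h \<cdot> z))) \<cdot> (F \<cdot> z') \<cdot>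
                   (SYM \<cdot> Y \<cdot> (p \<cdot> (g \<cdot> (h \<cdot> z))) \<cdot> (F \<cdot> z) \<cdot> (gh \<cdot> z)) \<cdot>
                   (TRANS \<cdot> Y \<cdot> (p \<cdot> (g \<cdot> (h \<cdot> z))) \<cdot> (p \<cdot> (g \<cdot> (h \<cdot> z'))) \<cdot> (F \<cdot> z') \<cdot>
                     (AP \<cdot> T \<cdot> Y \<cdot> p \<cdot> (g \<cdot> (h \<cdot> z)) \<cdot> (g \<cdot> (h \<cdot> z')) \<cdot> c) \<cdot> (gh \<cdot> z'))))))"])
    (simp_all only: elab_eval ty_apply inh cong: elab_cong)

definition ty_lift_surjective :: "nat \<Rightarrow> nat \<Rightarrow> nat \<Rightarrow> nat \<Rightarrow> stm" where
  "ty_lift_surjective i k l m =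
    (\<Pi> X\<in>U k. \<Pi> Y\<in>U l. \<Pi> f\<in>(X \<rightarrow> Y). \<Pi> Z\<in>U i. \<Pi> s\<in>(Z \<rightarrow> X). \<Pi> r\<in>(X \<rightarrow> Z). (\<Pi> x\<in>X. s \<cdot> (r \<cdot> x) =\<^bsub>X\<^esub> x) \<rightarrow>
      (\<Pi> Q\<in>U m. \<Pi> h\<in>(Z \<rightarrow> Q). \<Pi> g\<in>(Q \<rightarrow> image k l X Y f).
        (\<Pi> z\<in>Z. proj1 Y (g \<cdot> (h \<cdot> z)) =\<^bsub>Y\<^esub> f \<cdot> (s \<cdot> z)) \<rightarrow>
        surjective (max m (max k l)) Q (image k l X Y f) g))"

lemmas [ty_apply] = ty_lift_surjective_def[THEN fun_cong]

text \<open>A point \<open>u\<close> of the image over \<open>f x\<close> is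
  \<open>g (h (r x))\<close>, since both project to \<open>f x\<close> by
  \<open>s (r x) = x\<close>.\<close>

lemma inh_lift_surjective [inh]: "inhabited \<Theta> (ty_lift_surjective i k l m)"
  by (rule inhabitedI[where
      Ts="[ty_image_eq k l, ty_trunc_in (max m (max k l)), ty_trunc_prop (max m (max k l)),
            ty_trunc_rec (max k l) (max m (max k l)), ty_trans l, ty_ap k l]" and
      e="let IE = bvar 0; TI = bvar 1; TP = bvar 2; REC = bvar 3; TRANS = bvar 4; AP = bvar 5 in
         \<^bold>\<lambda>X Y f Z s r eps Q h g gh u. let Im = image k l X Y f; B = fibre Q Im g u in REC \<cdot>
           (fibre X Y f (FST u)) \<cdot> (K (Trunc (max m (max k l))) \<cdot> B) \<cdot> (TP \<cdot> B) \<cdot>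
           (\<^bold>\<lambda>t. TI \<cdot> B \<cdot>
             (PR (h \<cdot> (r \<cdot> (FST t)))
               (IE \<cdot> X \<cdot> Y \<cdot> f \<cdot> (g \<cdot> (h \<cdot> (r \<cdot> (FST t)))) \<cdot> u \<cdot>
                 (TRANS \<cdot> Y \<cdot> (FST (g \<cdot> (h \<cdot> (r \<cdot> (FST t))))) \<cdot> (f \<cdot> (s \<cdot> (r \<cdot> (FST t)))) \<cdot>
                   (FST u) \<cdot> (gh \<cdot> (r \<cdot> (FST t))) \<cdot>
                   (TRANS \<cdot> Y \<cdot> (f \<cdot> (s \<cdot> (r \<cdot> (FST t)))) \<cdot> (f \<cdot> (FST t)) \<cdot> (FST u) \<cdot>
                     (AP \<cdot> X \<cdot> Y \<cdot> f \<cdot> (s \<cdot> (r \<cdot> (FST t))) \<cdot> (FST t) \<cdot> (eps \<cdot> (FST t))) \<cdot>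
                     (SND t)))))) \<cdot>
           (SND u)"])
    (simp_all only: elab_eval ty_apply inh cong: elab_cong)

definition ty_lift_equiv :: "nat \<Rightarrow> nat \<Rightarrow> nat \<Rightarrow> nat \<Rightarrow> nat \<Rightarrow> stm" where
  "ty_lift_equiv i j k l m =
    (\<Pi> X\<in>U k. \<Pi> Y\<in>U l. \<Pi> f\<in>(X \<rightarrow> Y). isSet Y \<rightarrow>
      (\<Pi> Z\<in>U i. \<Pi> s\<in>(Z \<rightarrow> X). \<Pi> r\<in>(X \<rightarrow> Z). (\<Pi> x\<in>X. s \<cdot> (r \<cdot> x) =\<^bsub>X\<^esub> x) \<rightarrow>
        (\<Pi> R\<in>(Z \<rightarrow> Z \<rightarrow> U j). (\<Pi> z\<in>Z. \<Pi> z'\<in>Z. f \<cdot> (s \<cdot> z) =\<^bsub>Y\<^esub> f \<cdot> (s \<cdot> z') \<rightarrow> R \<cdot> z \<cdot> z') \<rightarrow>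
          (\<Pi> Q\<in>U m. \<Pi> h\<in>(Z \<rightarrow> Q). isSet Q \<rightarrow> identifies Z R Q h \<rightarrow>
            quotient_induction (max m (max k l)) Z Q h \<rightarrow>
            (\<Sigma> g\<in>(Q \<rightarrow> image k l X Y f). \<Pi> z\<in>Z. proj1 Y (g \<cdot> (h \<cdot> z)) =\<^bsub>Y\<^esub> f \<cdot> (s \<cdot> z)) \<rightarrow>
            equiv Q (image k l X Y f)))))"

lemmas [ty_apply] = ty_lift_equiv_def[THEN fun_cong]

lemma inh_lift_equiv [inh]: "inhabited \<Theta> (ty_lift_equiv i j k l m)"
  by (rule inhabitedI[where
      Ts="[ty_bijective_equiv m (max k l), ty_image_set k l, ty_lift_injective i j l m (max k l),
            ty_lift_surjective i k l m]" and
      e="let BE = bvar 0; IS = bvar 1; LI = bvar 2; LS = bvar 3 in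
         \<^bold>\<lambda>X Y f sY Z s r eps R fr Q h sQ id ind c. let Im = image k l X Y f in BE \<cdot> Q \<cdot> Im \<cdot>
           (FST c) \<cdot> (IS \<cdot> X \<cdot> Y \<cdot> f \<cdot> sY) \<cdot>
           (LI \<cdot> Z \<cdot> R \<cdot> Y \<cdot> (\<^bold>\<lambda>z. f \<cdot> (s \<cdot> z)) \<cdot> fr \<cdot> Q \<cdot> h \<cdot> sQ \<cdot> id \<cdot> ind \<cdot> Im \<cdot> (\<^bold>\<lambda>u. FST u) \<cdot>
             (FST c) \<cdot> (SND c)) \<cdot>
           (LS \<cdot> X \<cdot> Y \<cdot> f \<cdot> Z \<cdot> s \<cdot> r \<cdot> eps \<cdot> Q \<cdot> h \<cdot> (FST c) \<cdot> (SND c))"])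
    (simp_all only: elab_eval ty_apply inh cong: elab_cong)

definition ty_kernel_eqrel :: "nat \<Rightarrow> nat \<Rightarrow> nat \<Rightarrow> stm" where
  "ty_kernel_eqrel i j l =
    (\<Pi> Z\<in>U i. \<Pi> Y\<in>U l. \<Pi> F\<in>(Z \<rightarrow> Y). isSet Y \<rightarrow>
      (\<Pi> R\<in>(Z \<rightarrow> Z \<rightarrow> U j). \<Pi> to\<in>(\<Pi> z\<in>Z. \<Pi> z'\<in>Z. R \<cdot> z \<cdot> z' \<rightarrow> F \<cdot> z =\<^bsub>Y\<^esub> F \<cdot> z').
        \<Pi> fr\<in>(\<Pi> z\<in>Z. \<Pi> z'\<in>Z. F \<cdot> z =\<^bsub>Y\<^esub> F \<cdot> z' \<rightarrow> R \<cdot> z \<cdot> z').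
        (\<Pi> z\<in>Z. \<Pi> z'\<in>Z. \<Pi> c\<in>R \<cdot> z \<cdot> z'. fr \<cdot> z \<cdot> z' \<cdot> (to \<cdot> z \<cdot> z' \<cdot> c) =\<^bsub>R \<cdot> z \<cdot> z'\<^esub> c) \<rightarrow>
        isEqRel Z R))"

lemmas [ty_apply] = ty_kernel_eqrel_def[THEN fun_cong]

text \<open>The relation \<open>R\<close> is a retract of \<open>F z = F z'\<close>, which is a
  proposition because \<open>Y\<close> is a set; this makes \<open>R\<close> proposition-valued. The
  other laws are those of identity, carried across \<open>to\<close> and \<open>fr\<close>.\<close>

lemma inh_kernel_eqrel [inh]: "inhabited \<Theta> (ty_kernel_eqrel i j l)"
  by (rule inhabitedI[where
      Ts="[ty_retract_prop j l, ty_trans l, ty_sym l]" and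
      e="let RP = bvar 0; TRANS = bvar 1; SYM = bvar 2 in
         \<^bold>\<lambda>Z Y F sY R to fr ret.
           PR
             (\<^bold>\<lambda>x y. RP \<cdot> (R \<cdot> x \<cdot> y) \<cdot> (F \<cdot> x =\<^bsub>Y\<^esub> F \<cdot> y) \<cdot> (to \<cdot> x \<cdot> y) \<cdot> (fr \<cdot> x \<cdot> y) \<cdot>
               (ret \<cdot> x \<cdot> y) \<cdot> (sY \<cdot> (F \<cdot> x) \<cdot> (F \<cdot> y)))
             (PR (\<^bold>\<lambda>x. fr \<cdot> x \<cdot> x \<cdot> RFL)
               (PR (\<^bold>\<lambda>x y c. fr \<cdot> y \<cdot> x \<cdot> (SYM \<cdot> Y \<cdot> (F \<cdot> x) \<cdot> (F \<cdot> y) \<cdot> (to \<cdot> x \<cdot> y \<cdot> c)))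
                 (\<^bold>\<lambda>x y z c d. fr \<cdot> x \<cdot> z \<cdot>
                   (TRANS \<cdot> Y \<cdot> (F \<cdot> x) \<cdot> (F \<cdot> y) \<cdot> (F \<cdot> z) \<cdot> (to \<cdot> x \<cdot> y \<cdot> c) \<cdot>
                     (to \<cdot> y \<cdot> z \<cdot> d)))))"])
    (simp_all only: elab_eval ty_apply inh cong: elab_cong)

definition ty_small_image_quotient :: "nat \<Rightarrow> nat \<Rightarrow> nat \<Rightarrow> nat \<Rightarrow> stm" where
  "ty_small_image_quotient i j k l =
    ((\<Pi> X\<in>U k. \<Pi> Y\<in>U l. \<Pi> f\<in>(X \<rightarrow> Y). isSet Y \<rightarrow>
      (\<Pi> Z\<in>U i. \<Pi> s\<in>(Z \<rightarrow> X). \<Pi> r\<in>(X \<rightarrow> Z). (\<Pi> x\<in>X. s \<cdot> (r \<cdot> x) =\<^bsub>X\<^esub> x) \<rightarrow>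
        (\<Pi> R\<in>(Z \<rightarrow> Z \<rightarrow> U j). \<Pi> to\<in>(\<Pi> z\<in>Z. \<Pi> z'\<in>Z. R \<cdot> z \<cdot> z' \<rightarrow> f \<cdot> (s \<cdot> z) =\<^bsub>Y\<^esub> f \<cdot> (s \<cdot> z')).
          \<Pi> fr\<in>(\<Pi> z\<in>Z. \<Pi> z'\<in>Z. f \<cdot> (s \<cdot> z) =\<^bsub>Y\<^esub> f \<cdot> (s \<cdot> z') \<rightarrow> R \<cdot> z \<cdot> z'). \<Pi> Q\<in>U (max i j).
          \<Pi> h\<in>(Z \<rightarrow> Q). isSet Q \<rightarrow> identifies Z R Q h \<rightarrow> quotient_universal (max k l) Z R Q h \<rightarrow>
          quotient_induction (max (max i j) (max k l)) Z Q h \<rightarrow>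
          isSmall (max i j) (image k l X Y f)))))"

lemmas [ty_apply] = ty_small_image_quotient_def[THEN fun_cong]

lemma inh_small_image_quotient [inh]: "inhabited \<Theta> (ty_small_image_quotient i j k l)"
  by (rule inhabitedI[where
      Ts="[ty_image_lift i j k l (max i j), ty_lift_equiv i j k l (max i j)]" and
      e="let IL = bvar 0; LE = bvar 1 in
         \<^bold>\<lambda>X Y f sY Z s r eps R to fr Q h st id un ind.
           PR Q
             (LE \<cdot> X \<cdot> Y \<cdot> f \<cdot> sY \<cdot> Z \<cdot> s \<cdot> r \<cdot> eps \<cdot> R \<cdot> fr \<cdot> Q \<cdot> h \<cdot> st \<cdot> id \<cdot> ind \<cdot>
               (IL \<cdot> X \<cdot> Y \<cdot> f \<cdot> sY \<cdot> Z \<cdot> s \<cdot> R \<cdot> to \<cdot> Q \<cdot> h \<cdot> un))"])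
    (simp_all only: elab_eval ty_apply inh cong: elab_cong)

definition ty_small_image_eqrel :: "nat \<Rightarrow> nat \<Rightarrow> nat \<Rightarrow> nat \<Rightarrow> stm" where
  "ty_small_image_eqrel i j k l =
    (given_quotients i j k l
      ((\<Pi> X\<in>U k. \<Pi> Y\<in>U l. \<Pi> f\<in>(X \<rightarrow> Y). isSet Y \<rightarrow>
        (\<Pi> Z\<in>U i. \<Pi> s\<in>(Z \<rightarrow> X). \<Pi> r\<in>(X \<rightarrow> Z). (\<Pi> x\<in>X. s \<cdot> (r \<cdot> x) =\<^bsub>X\<^esub> x) \<rightarrow>
          (\<Pi> R\<in>(Z \<rightarrow> Z \<rightarrow> U j). \<Pi> to\<in>(\<Pi> z\<in>Z. \<Pi> z'\<in>Z. R \<cdot> z \<cdot> z' \<rightarrow> f \<cdot> (s \<cdot> z) =\<^bsub>Y\<^esub> f \<cdot> (s \<cdot> z')).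
            \<Pi> fr\<in>(\<Pi> z\<in>Z. \<Pi> z'\<in>Z. f \<cdot> (s \<cdot> z) =\<^bsub>Y\<^esub> f \<cdot> (s \<cdot> z') \<rightarrow> R \<cdot> z \<cdot> z'). isEqRel Z R \<rightarrow>
            isSmall (max i j) (image k l X Y f))))))"

lemmas [ty_apply] = ty_small_image_eqrel_def[THEN fun_cong]

lemma inh_small_image_eqrel [inh]: "inhabited \<Theta> (ty_small_image_eqrel i j k l)"
  by (rule inhabitedI[where
      Ts="[ty_small_image_quotient i j k l]" and
      e="let SIQ = bvar 0 in
         \<^bold>\<lambda>QQ hh st id un ind X Y f sY Z s r eps R to fr e. SIQ \<cdot> X \<cdot> Y \<cdot> f \<cdot> sY \<cdot> Z \<cdot> s \<cdot> r \<cdot> eps \<cdot>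
           R \<cdot> to \<cdot> fr \<cdot> (QQ \<cdot> Z \<cdot> R \<cdot> e) \<cdot> (hh \<cdot> Z \<cdot> R \<cdot> e) \<cdot> (st \<cdot> Z \<cdot> R \<cdot> e) \<cdot> (id \<cdot> Z \<cdot> R \<cdot> e) \<cdot>
           (un \<cdot> Z \<cdot> R \<cdot> e) \<cdot> (ind \<cdot> Z \<cdot> R \<cdot> e)"])
    (simp_all only: elab_eval ty_apply inh cong: elab_cong)

definition ty_small_image_kernel :: "nat \<Rightarrow> nat \<Rightarrow> nat \<Rightarrow> nat \<Rightarrow> stm" where
  "ty_small_image_kernel i j k l =
    (given_quotients i j k l
      ((\<Pi> X\<in>U k. \<Pi> Y\<in>U l. \<Pi> f\<in>(X \<rightarrow> Y). isSet Y \<rightarrow>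
        (\<Pi> Z\<in>U i. \<Pi> s\<in>(Z \<rightarrow> X). \<Pi> r\<in>(X \<rightarrow> Z). (\<Pi> x\<in>X. s \<cdot> (r \<cdot> x) =\<^bsub>X\<^esub> x) \<rightarrow>
          (\<Pi> R\<in>(Z \<rightarrow> Z \<rightarrow> U j). \<Pi> to\<in>(\<Pi> z\<in>Z. \<Pi> z'\<in>Z. R \<cdot> z \<cdot> z' \<rightarrow> f \<cdot> (s \<cdot> z) =\<^bsub>Y\<^esub> f \<cdot> (s \<cdot> z')).
            \<Pi> fr\<in>(\<Pi> z\<in>Z. \<Pi> z'\<in>Z. f \<cdot> (s \<cdot> z) =\<^bsub>Y\<^esub> f \<cdot> (s \<cdot> z') \<rightarrow> R \<cdot> z \<cdot> z').
            (\<Pi> z\<in>Z. \<Pi> z'\<in>Z. \<Pi> c\<in>R \<cdot> z \<cdot> z'. fr \<cdot> z \<cdot> z' \<cdot> (to \<cdot> z \<cdot> z' \<cdot> c) =\<^bsub>R \<cdot> z \<cdot> z'\<^esub> c) \<rightarrow>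
            isSmall (max i j) (image k l X Y f))))))"

lemmas [ty_apply] = ty_small_image_kernel_def[THEN fun_cong]

lemma inh_small_image_kernel [inh]: "inhabited \<Theta> (ty_small_image_kernel i j k l)"
  by (rule inhabitedI[where
      Ts="[ty_kernel_eqrel i j l, ty_small_image_eqrel i j k l]" and
      e="let KE = bvar 0; SIE = bvar 1 in
         \<^bold>\<lambda>QQ hh st id un ind X Y f sY Z s r eps R to fr ret. SIE \<cdot> QQ \<cdot> hh \<cdot> st \<cdot> id \<cdot> un \<cdot> ind \<cdot>
           X \<cdot> Y \<cdot> f \<cdot> sY \<cdot> Z \<cdot> s \<cdot> r \<cdot> eps \<cdot> R \<cdot> to \<cdot> fr \<cdot>
           (KE \<cdot> Z \<cdot> Y \<cdot> (\<^bold>\<lambda>z. f \<cdot> (s \<cdot> z)) \<cdot> sY \<cdot> R \<cdot> to \<cdot> fr \<cdot> ret)"])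
    (simp_all only: elab_eval ty_apply inh cong: elab_cong)

definition ty_small_image_retract :: "nat \<Rightarrow> nat \<Rightarrow> nat \<Rightarrow> nat \<Rightarrow> stm" where
  "ty_small_image_retract i j k l =
    (given_quotients i j k l
      ((\<Pi> X\<in>U k. \<Pi> Y\<in>U l. \<Pi> f\<in>(X \<rightarrow> Y). isLocallySmall j Y \<rightarrow> isSet Y \<rightarrow>
        (\<Pi> Z\<in>U i. \<Pi> s\<in>(Z \<rightarrow> X). \<Pi> r\<in>(X \<rightarrow> Z). (\<Pi> x\<in>X. s \<cdot> (r \<cdot> x) =\<^bsub>X\<^esub> x) \<rightarrow>
          isSmall (max i j) (image k l X Y f)))))"

lemmas [ty_apply] = ty_small_image_retract_def[THEN fun_cong]

text \<open>The relation on \<open>Z\<close> is the small copy of \<open>f (s z) = f (s z')\<close>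
  that local smallness of \<open>Y\<close> supplies. It takes values in \<open>U j\<close>, so its
  quotient lies in \<open>U (max i j)\<close>.\<close>

lemma inh_small_image_retract [inh]: "inhabited \<Theta> (ty_small_image_retract i j k l)"
  by (rule inhabitedI[where
      Ts="[ty_small_image_kernel i j k l, ty_equiv_inverse j l]" and
      e="let SIK = bvar 0; INV = bvar 1 in
         \<^bold>\<lambda>QQ hh st id un ind X Y f ls sY Z s r eps.
           let L = (\<lambda>z z'. ls \<cdot> (f \<cdot> (s \<cdot> z)) \<cdot> (f \<cdot> (s \<cdot> z')));
           E = (\<lambda>z z'. INV \<cdot> (FST (L z z')) \<cdot> (f \<cdot> (s \<cdot> z) =\<^bsub>Y\<^esub> f \<cdot> (s \<cdot> z')) \<cdot> (SND (L z z'))) in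
           SIK \<cdot> QQ \<cdot> hh \<cdot> st \<cdot> id \<cdot> un \<cdot> ind \<cdot> X \<cdot> Y \<cdot> f \<cdot> sY \<cdot> Z \<cdot> s \<cdot> r \<cdot> eps \<cdot>
           (\<^bold>\<lambda>z z'. FST (L z z')) \<cdot> (\<^bold>\<lambda>z z'. FST (E z z')) \<cdot> (\<^bold>\<lambda>z z'. FST (SND (E z z'))) \<cdot>
           (\<^bold>\<lambda>z z'. SND (SND (SND (E z z'))))"])
    (simp_all only: elab_eval ty_apply inh cong: elab_cong)

definition ty_replacement :: "nat \<Rightarrow> nat \<Rightarrow> nat \<Rightarrow> nat \<Rightarrow> stm" where
  "ty_replacement i j k l = (given_quotients i j k l (replacement_type i j k l))"

lemmas [ty_apply] = ty_replacement_def[THEN fun_cong]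

lemma inh_replacement [inh]: "inhabited \<Theta> (ty_replacement i j k l)"
  by (rule inhabitedI[where
      Ts="[ty_small_image_retract i j k l, ty_equiv_inverse i k]" and
      e="let SIR = bvar 0; INV = bvar 1 in
         \<^bold>\<lambda>QQ hh st id un ind X Y f sm ls sY. let E = INV \<cdot> (FST sm) \<cdot> X \<cdot> (SND sm) in SIR \<cdot> QQ \<cdot>
           hh \<cdot> st \<cdot> id \<cdot> un \<cdot> ind \<cdot> X \<cdot> Y \<cdot> f \<cdot> ls \<cdot> sY \<cdot> (FST sm) \<cdot> (FST E) \<cdot> (FST (SND E)) \<cdot>
           (FST (SND (SND E)))"])
    (simp_all only: elab_eval ty_apply inh cong: elab_cong)


section \<open>Closed terms and choice\<close>

text \<open>The generic value of a closed function of three arguments, in the context of these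
  arguments: a type, a relation and a proof that it is an equivalence relation.\<close>

abbreviation app3 :: "tm \<Rightarrow> tm" where
  "app3 t \<equiv> App (App (App t (Var (Suc (Suc 0)))) (Var (Suc 0))) (Var 0)"

lemma less_3_cases: "n < Suc (Suc (Suc 0)) \<Longrightarrow> n = 0 \<or> n = Suc 0 \<or> n = Suc (Suc 0)"
  by auto

text \<open>Three successive applications instantiate each binder by the variable it stands for, so
  on a term with no other free variables the composite substitution is the identity.\<close>

lemma app3_sub:
  assumes "scoped (Suc (Suc (Suc 0))) b"
  shows "inst (Var 0) (sub (up (Var (Suc 0) .: Var)) (sub (up (up (Var (Suc (Suc 0)) .: Var))) b)) = b"
  unfolding sub_sub using assms by (rule sub_scoped) (auto dest!: less_3_cases)

lemma app3_typing:
  assumes c: "\<Theta>; [] \<turnstile> c : Pi D1 (Pi D2 (Pi D3 S))"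
  shows "\<Theta>; [D3, D2, D1] \<turnstile> app3 c : S"
proof -
  obtain i where P: "\<Theta>; [] \<turnstile> Pi D1 (Pi D2 (Pi D3 S)) : Univ i" using typing_valid[OF c] ..
  obtain i1 j1 where D1: "\<Theta>; [] \<turnstile> D1 : Univ i1" and P1: "\<Theta>; [D1] \<turnstile> Pi D2 (Pi D3 S) : Univ j1"
    using Pi_inv[OF P] by blast
  obtain i2 j2 where D2: "\<Theta>; [D1] \<turnstile> D2 : Univ i2" and P2: "\<Theta>; [D2, D1] \<turnstile> Pi D3 S : Univ j2"
    using Pi_inv[OF P1] by blast
  obtain i3 j3 where D3: "\<Theta>; [D2, D1] \<turnstile> D3 : Univ i3" and S: "\<Theta>; [D3, D2, D1] \<turnstile> S : Univ j3"
    using Pi_inv[OF P2] by blast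
  let ?\<Gamma> = "[D3, D2, D1]" and ?s = "Var (Suc (Suc 0)) .: Var"
  have wf: "wf \<Theta> ?\<Gamma>" using typing_wf[OF S] .
  have "\<Theta>; ?\<Gamma> \<turnstile> Var (Suc (Suc 0)) : D1"
    using t_Var[OF wf, of "Suc (Suc 0)"] by (simp add: ren_closed[OF D1])
  from t_App[OF typing_closed[OF c wf] this]
  have 1: "\<Theta>; ?\<Gamma> \<turnstile> App c (Var (Suc (Suc 0))) : Pi (sub ?s D2) (Pi (sub (up ?s) D3) (sub (up (up ?s)) S))"
    by simp
  have "ren (\<lambda>m. m + Suc (Suc 0)) D2 = sub ?s D2"
    unfolding ren_eq_sub using typing_scoped[OF D2] by (rule sub_cong_scoped) simp
  then have "\<Theta>; ?\<Gamma> \<turnstile> Var (Suc 0) : sub ?s D2" using t_Var[OF wf, of "Suc 0"] by simp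
  from t_App[OF 1 this] have 2: "\<Theta>; ?\<Gamma> \<turnstile> App (App c (Var (Suc (Suc 0)))) (Var (Suc 0)) :
      Pi (inst (Var (Suc 0)) (sub (up ?s) D3)) (sub (up (Var (Suc 0) .: Var)) (sub (up (up ?s)) S))"
    by simp
  have "ren (\<lambda>m. m + Suc 0) D3 = inst (Var (Suc 0)) (sub (up ?s) D3)"
    unfolding ren_eq_sub sub_sub using typing_scoped[OF D3] by (rule sub_cong_scoped) (auto simp: less_Suc_eq)
  then have "\<Theta>; ?\<Gamma> \<turnstile> Var 0 : inst (Var (Suc 0)) (sub (up ?s) D3)" using t_Var[OF wf, of 0] by simp
  from t_App[OF 2 this] show ?thesis using typing_scoped[OF S] by (simp add: app3_sub)
qed

lemma app3_beta:
  assumes "scoped (Suc (Suc (Suc 0))) b"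
  shows "app3 (Lam D1 (Lam D2 (Lam D3 b))) \<simeq> b"
proof -
  let ?s = "Var (Suc (Suc 0)) .: Var"
  have 1: "App (Lam D1 (Lam D2 (Lam D3 b))) (Var (Suc (Suc 0))) \<simeq> Lam (sub ?s D2) (Lam (sub (up ?s) D3) (sub (up (up ?s)) b))"
    using c_beta[of D1 "Lam D2 (Lam D3 b)"] by simp
  have 2: "App (App (Lam D1 (Lam D2 (Lam D3 b))) (Var (Suc (Suc 0)))) (Var (Suc 0)) \<simeq>
      Lam (inst (Var (Suc 0)) (sub (up ?s) D3)) (sub (up (Var (Suc 0) .: Var)) (sub (up (up ?s)) b))"
    using c_trans[OF c_App[OF 1 c_refl[of "Var (Suc 0)"]] c_beta] by simp
  show ?thesis using c_trans[OF c_App[OF 2 c_refl[of "Var 0"]] c_beta] app3_sub[OF assms] by simp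
qed

text \<open>The distributivity of products over sums, stated for closed terms because
  \<open>small_set_quotients\<close> asks for closed \<open>Q\<close> and \<open>h\<close>. Both
  functions abstract a projection of \<open>app3 c\<close>. The type of the second one mentions the
  first projection, which is replaced by \<open>app3 f\<close> through beta conversion.\<close>

lemma closed_choice:
  assumes c: "\<Theta>; [] \<turnstile> c : Pi D1 (Pi D2 (Pi D3 (Sg A B)))"
  obtains f g where "\<Theta>; [] \<turnstile> f : Pi D1 (Pi D2 (Pi D3 A))" "\<Theta>; [] \<turnstile> g : Pi D1 (Pi D2 (Pi D3 (inst (app3 f) B)))"
proof -
  obtain i where P: "\<Theta>; [] \<turnstile> Pi D1 (Pi D2 (Pi D3 (Sg A B))) : Univ i" using typing_valid[OF c] ..
  obtain i1 j1 where D1: "\<Theta>; [] \<turnstile> D1 : Univ i1" and P1: "\<Theta>; [D1] \<turnstile> Pi D2 (Pi D3 (Sg A B)) : Univ j1"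
    using Pi_inv[OF P] by blast
  obtain i2 j2 where D2: "\<Theta>; [D1] \<turnstile> D2 : Univ i2" and P2: "\<Theta>; [D2, D1] \<turnstile> Pi D3 (Sg A B) : Univ j2"
    using Pi_inv[OF P1] by blast
  obtain i3 j3 where D3: "\<Theta>; [D2, D1] \<turnstile> D3 : Univ i3" and S: "\<Theta>; [D3, D2, D1] \<turnstile> Sg A B : Univ j3"
    using Pi_inv[OF P2] by blast
  have lam: "\<Theta>; [] \<turnstile> Lam D1 (Lam D2 (Lam D3 b)) : Pi D1 (Pi D2 (Pi D3 T))" if b: "\<Theta>; [D3, D2, D1] \<turnstile> b : T" for b T
  proof -
    obtain k where T: "\<Theta>; [D3, D2, D1] \<turnstile> T : Univ k" using typing_valid[OF b] ..
    note T2 = t_Pi[OF D3 T] note T1 = t_Pi[OF D2 T2]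
    show ?thesis by (rule t_Lam[OF D1 T1 t_Lam[OF D2 T2 t_Lam[OF D3 T b]]])
  qed
  note p = app3_typing[OF c]
  let ?b = "Split (ren Suc A) (Var (Suc 0)) (app3 c)"
  let ?f = "Lam D1 (Lam D2 (Lam D3 ?b))"
  have f: "\<Theta>; [] \<turnstile> ?f : Pi D1 (Pi D2 (Pi D3 A))" by (rule lam[OF typing_fst[OF p]])
  obtain k where B: "\<Theta>; A # [D3, D2, D1] \<turnstile> B : Univ k" using Sg_inv[OF S] by blast
  have "app3 ?f \<simeq> ?b" using typing_scoped[OF typing_fst[OF p]] by (intro app3_beta) simp
  from conv_inst[OF c_sym[OF this]] have "inst ?b B \<simeq> inst (app3 ?f) B" .
  from lam[OF t_Conv[OF typing_snd[OF p] typing_inst_Univ[OF B app3_typing[OF f]] this]]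
  have "\<Theta>; [] \<turnstile> Lam D1 (Lam D2 (Lam D3 (Split (snd_motive A B) (Var 0) (app3 c)))) : Pi D1 (Pi D2 (Pi D3 (inst (app3 ?f) B)))" .
  with f show ?thesis by (rule that)
qed

lemma wk_closed: "\<Theta>; [] \<turnstile> t : A \<Longrightarrow> \<lceil>t\<rceil> d = t"
  by (simp add: wk_def ren_closed)

text \<open>\<open>B\<close> is an arbitrary HOL function on terms in scope, and nothing forces it
  to commute with substitution. The last premise asks for this, and evaluation discharges it in each
  use.\<close>

lemma closed_app:
  assumes "\<Theta> \<tturnstile> t : PI A B" "\<Theta> \<tturnstile> u : A" "inst u (B (bvar 0) (Suc 0)) = B \<lceil>u\<rceil> 0"
  shows "\<Theta> \<tturnstile> App t u : B \<lceil>u\<rceil>"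
  using t_App[of \<Theta> "[]" t "A 0" "B (bvar 0) (Suc 0)" u] assms by (simp add: closed_of_type_def PI_def)

text \<open>In the premise on \<open>B\<close>, the variable of level three at depth four is the one
  bound by the sum type; instantiating it must give \<open>f\<close> applied to the three arguments,
  at depth three.\<close>

lemma eqrel_choice:
  assumes c: "\<Theta> \<tturnstile> c : for_eqrels i j (\<lambda>X R e. SG (A X R e) (B X R e))"
    and B: "\<And>f. (\<And>s. sub s f = f) \<Longrightarrow> (\<And>r. ren r f = f) \<Longrightarrow> (\<And>d. \<lceil>f\<rceil> d = f) \<Longrightarrow>
      inst (app3 f) (B (bvar 0) (bvar (Suc 0)) (bvar (Suc (Suc 0))) (bvar (Suc (Suc (Suc 0)))) (Suc (Suc (Suc (Suc 0))))) =
      B (bvar 0) (bvar (Suc 0)) (bvar (Suc (Suc 0))) (\<lceil>f\<rceil> \<cdot> bvar 0 \<cdot> bvar (Suc 0) \<cdot> bvar (Suc (Suc 0))) (Suc (Suc (Suc 0)))"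
  obtains f g where "\<Theta> \<tturnstile> f : for_eqrels i j A" "\<Theta> \<tturnstile> g : for_eqrels i j (\<lambda>X R e. B X R e (\<lceil>f\<rceil> \<cdot> X \<cdot> R \<cdot> e))"
proof -
  obtain f g where f: "\<Theta>; [] \<turnstile> f : for_eqrels i j A 0"
    and g: "\<Theta>; [] \<turnstile> g : PI (U i) (\<lambda>X. \<Pi> R\<in>(X \<rightarrow> X \<rightarrow> U j). \<Pi> e\<in>isEqRel X R. (\<lambda>d. inst (app3 f) (B X R e (bvar d) (Suc d)))) 0"
    using closed_choice[of \<Theta> c] c unfolding closed_of_type_def for_eqrels_def PI_def SG_def by metis
  have "inst (app3 f) (B (bvar 0) (bvar (Suc 0)) (bvar (Suc (Suc 0))) (bvar (Suc (Suc (Suc 0)))) (Suc (Suc (Suc (Suc 0))))) =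
      B (bvar 0) (bvar (Suc 0)) (bvar (Suc (Suc 0))) (\<lceil>f\<rceil> \<cdot> bvar 0 \<cdot> bvar (Suc 0) \<cdot> bvar (Suc (Suc 0))) (Suc (Suc (Suc 0)))"
    by (rule B) (simp_all add: sub_closed[OF f] ren_closed[OF f] wk_closed[OF f])
  then have "\<Theta> \<tturnstile> g : for_eqrels i j (\<lambda>X R e. B X R e (\<lceil>f\<rceil> \<cdot> X \<cdot> R \<cdot> e))"
    using g by (simp only: closed_of_type_def for_eqrels_def PI_def)
  with f show ?thesis using that by (simp add: closed_of_type_def)
qed

lemmas closed_eval = stm_apply def_apply sub.simps ren.simps scons_0 scons_Suc up_0 up_Suc upr_0 upr_Suc nat_simps


section \<open>Set replacement and set quotients\<close>

lemma replacement_imp_quotients: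
  assumes "set_replacement \<Theta>"
  shows "small_set_quotients \<Theta>"
  unfolding small_set_quotients_def
proof (intro allI)
  fix i j
  obtain c where c: "\<Theta> \<tturnstile> c : for_eqrels i j (\<lambda>X R e. SG (U (max i j)) (\<lambda>Q. \<Sigma> h\<in>(X \<rightarrow> Q). quotient_props i j X R Q h))"
    using inh_quotient[OF assms, of i j] by (auto simp: inhabited_def ty_quotient_def)
  \<comment> \<open>Two rounds of choice split off \<open>Q\<close> and then \<open>h\<close>. The
    remaining term \<open>pr\<close> proves the four properties and is shared by all universes
    \<open>w\<close>.\<close>
  obtain Q g where Q: "\<Theta> \<tturnstile> Q : for_eqrels i j (\<lambda>X R e. U (max i j))"
    and g: "\<Theta> \<tturnstile> g : for_eqrels i j (\<lambda>X R e. SG (X \<rightarrow> \<lceil>Q\<rceil> \<cdot> X \<cdot> R \<cdot> e) (\<lambda>h. quotient_props i j X R (\<lceil>Q\<rceil> \<cdot> X \<cdot> R \<cdot> e) h))"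
    by (rule eqrel_choice[OF c]) (simp_all only: closed_eval)
  have clQ: "sub s Q = Q" "ren r Q = Q" "\<lceil>Q\<rceil> d = Q" for s r d
    using Q unfolding closed_of_type_def by (auto intro: sub_closed ren_closed wk_closed)
  obtain h pr where h: "\<Theta> \<tturnstile> h : for_eqrels i j (\<lambda>X R e. X \<rightarrow> \<lceil>Q\<rceil> \<cdot> X \<cdot> R \<cdot> e)"
    and pr: "\<Theta> \<tturnstile> pr : for_eqrels i j (\<lambda>X R e. quotient_props i j X R (\<lceil>Q\<rceil> \<cdot> X \<cdot> R \<cdot> e) (\<lceil>h\<rceil> \<cdot> X \<cdot> R \<cdot> e))"
    by (rule eqrel_choice[OF g]) (simp_all only: closed_eval clQ)
  have clh: "sub s h = h" "ren r h = h" "\<lceil>h\<rceil> d = h" for s r d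
    using h unfolding closed_of_type_def by (auto intro: sub_closed ren_closed wk_closed)
  show "\<exists>Q h. \<Theta> \<tturnstile> Q : for_eqrels i j (\<lambda>X R e. U (max i j)) \<and>
     \<Theta> \<tturnstile> h : for_eqrels i j (\<lambda>X R e. X \<rightarrow> \<lceil>Q\<rceil> \<cdot> X \<cdot> R \<cdot> e) \<and>
     inhabited \<Theta> (for_eqrels i j (\<lambda>X R e. isSet (\<lceil>Q\<rceil> \<cdot> X \<cdot> R \<cdot> e))) \<and>
     inhabited \<Theta> (for_eqrels i j (\<lambda>X R e. identifies X R (\<lceil>Q\<rceil> \<cdot> X \<cdot> R \<cdot> e) (\<lceil>h\<rceil> \<cdot> X \<cdot> R \<cdot> e))) \<and>
     (\<forall>w. inhabited \<Theta> (for_eqrels i j (\<lambda>X R e.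
        quotient_universal w X R (\<lceil>Q\<rceil> \<cdot> X \<cdot> R \<cdot> e) (\<lceil>h\<rceil> \<cdot> X \<cdot> R \<cdot> e)))) \<and>
     (\<forall>w. inhabited \<Theta> (for_eqrels i j (\<lambda>X R e.
        quotient_induction w X (\<lceil>Q\<rceil> \<cdot> X \<cdot> R \<cdot> e) (\<lceil>h\<rceil> \<cdot> X \<cdot> R \<cdot> e))))"
  proof (intro exI conjI allI)
    show "\<Theta> \<tturnstile> Q : for_eqrels i j (\<lambda>X R e. U (max i j))" by (rule Q)
    show "\<Theta> \<tturnstile> h : for_eqrels i j (\<lambda>X R e. X \<rightarrow> \<lceil>Q\<rceil> \<cdot> X \<cdot> R \<cdot> e)" by (rule h)
    show "inhabited \<Theta> (for_eqrels i j (\<lambda>X R e. isSet (\<lceil>Q\<rceil> \<cdot> X \<cdot> R \<cdot> e)))"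
    proof -
      obtain t where t: "\<Theta> \<tturnstile> t : ty_choice_set i j" using inh_choice_set unfolding inhabited_def by blast
      have "\<Theta> \<tturnstile> App (App (App t Q) h) pr : for_eqrels i j (\<lambda>X R e. isSet (\<lceil>Q\<rceil> \<cdot> X \<cdot> R \<cdot> e))"
        by (rule closed_app[OF closed_app[OF closed_app[OF t[unfolded ty_choice_set_def] Q] h] pr])
          (simp_all only: closed_eval clQ clh)
      then show ?thesis unfolding inhabited_def by blast
    qed
    show "inhabited \<Theta> (for_eqrels i j (\<lambda>X R e. identifies X R (\<lceil>Q\<rceil> \<cdot> X \<cdot> R \<cdot> e) (\<lceil>h\<rceil> \<cdot> X \<cdot> R \<cdot> e)))"
    proof -
      obtain t where t: "\<Theta> \<tturnstile> t : ty_choice_identifies i j" using inh_choice_identifies unfolding inhabited_def by blast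
      have "\<Theta> \<tturnstile> App (App (App t Q) h) pr : for_eqrels i j (\<lambda>X R e. identifies X R (\<lceil>Q\<rceil> \<cdot> X \<cdot> R \<cdot> e) (\<lceil>h\<rceil> \<cdot> X \<cdot> R \<cdot> e))"
        by (rule closed_app[OF closed_app[OF closed_app[OF t[unfolded ty_choice_identifies_def] Q] h] pr])
          (simp_all only: closed_eval clQ clh)
      then show ?thesis unfolding inhabited_def by blast
    qed
    show "inhabited \<Theta> (for_eqrels i j (\<lambda>X R e. quotient_universal w X R (\<lceil>Q\<rceil> \<cdot> X \<cdot> R \<cdot> e) (\<lceil>h\<rceil> \<cdot> X \<cdot> R \<cdot> e)))" for w
    proof -
      obtain t where t: "\<Theta> \<tturnstile> t : ty_choice_universal i j w" using inh_choice_universal unfolding inhabited_def by blast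
      have "\<Theta> \<tturnstile> App (App (App t Q) h) pr : for_eqrels i j (\<lambda>X R e. quotient_universal w X R (\<lceil>Q\<rceil> \<cdot> X \<cdot> R \<cdot> e) (\<lceil>h\<rceil> \<cdot> X \<cdot> R \<cdot> e))"
        by (rule closed_app[OF closed_app[OF closed_app[OF t[unfolded ty_choice_universal_def] Q] h] pr])
          (simp_all only: closed_eval clQ clh)
      then show ?thesis unfolding inhabited_def by blast
    qed
    show "inhabited \<Theta> (for_eqrels i j (\<lambda>X R e. quotient_induction w X (\<lceil>Q\<rceil> \<cdot> X \<cdot> R \<cdot> e) (\<lceil>h\<rceil> \<cdot> X \<cdot> R \<cdot> e)))" for w
    proof -
      obtain t where t: "\<Theta> \<tturnstile> t : ty_choice_induction i j w" using inh_choice_induction unfolding inhabited_def by blast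
      have "\<Theta> \<tturnstile> App (App (App t Q) h) pr : for_eqrels i j (\<lambda>X R e. quotient_induction w X (\<lceil>Q\<rceil> \<cdot> X \<cdot> R \<cdot> e) (\<lceil>h\<rceil> \<cdot> X \<cdot> R \<cdot> e))"
        by (rule closed_app[OF closed_app[OF closed_app[OF t[unfolded ty_choice_induction_def] Q] h] pr])
          (simp_all only: closed_eval clQ clh)
      then show ?thesis unfolding inhabited_def by blast
    qed
  qed
qed

lemma quotients_imp_replacement:
  assumes "small_set_quotients \<Theta>"
  shows "set_replacement \<Theta>"
  unfolding set_replacement_def
proof (intro allI)
  fix i j k l
  obtain Q h where Q: "\<Theta> \<tturnstile> Q : for_eqrels i j (\<lambda>X R e. U (max i j))"
    and h: "\<Theta> \<tturnstile> h : for_eqrels i j (\<lambda>X R e. X \<rightarrow> \<lceil>Q\<rceil> \<cdot> X \<cdot> R \<cdot> e)"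
    and st: "inhabited \<Theta> (for_eqrels i j (\<lambda>X R e. isSet (\<lceil>Q\<rceil> \<cdot> X \<cdot> R \<cdot> e)))"
    and id: "inhabited \<Theta> (for_eqrels i j (\<lambda>X R e. identifies X R (\<lceil>Q\<rceil> \<cdot> X \<cdot> R \<cdot> e) (\<lceil>h\<rceil> \<cdot> X \<cdot> R \<cdot> e)))"
    and un: "\<And>w. inhabited \<Theta> (for_eqrels i j (\<lambda>X R e. quotient_universal w X R (\<lceil>Q\<rceil> \<cdot> X \<cdot> R \<cdot> e) (\<lceil>h\<rceil> \<cdot> X \<cdot> R \<cdot> e)))"
    and ind: "\<And>w. inhabited \<Theta> (for_eqrels i j (\<lambda>X R e. quotient_induction w X (\<lceil>Q\<rceil> \<cdot> X \<cdot> R \<cdot> e) (\<lceil>h\<rceil> \<cdot> X \<cdot> R \<cdot> e)))"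
    using assms unfolding small_set_quotients_def by blast
  obtain a where a: "\<Theta> \<tturnstile> a : for_eqrels i j (\<lambda>X R e. isSet (\<lceil>Q\<rceil> \<cdot> X \<cdot> R \<cdot> e))" using st unfolding inhabited_def ..
  obtain b where b: "\<Theta> \<tturnstile> b : for_eqrels i j (\<lambda>X R e. identifies X R (\<lceil>Q\<rceil> \<cdot> X \<cdot> R \<cdot> e) (\<lceil>h\<rceil> \<cdot> X \<cdot> R \<cdot> e))"
    using id unfolding inhabited_def ..
  obtain u where u: "\<Theta> \<tturnstile> u : for_eqrels i j (\<lambda>X R e. quotient_universal (max k l) X R (\<lceil>Q\<rceil> \<cdot> X \<cdot> R \<cdot> e) (\<lceil>h\<rceil> \<cdot> X \<cdot> R \<cdot> e))"
    using un unfolding inhabited_def by blast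
  obtain v where v: "\<Theta> \<tturnstile> v : for_eqrels i j (\<lambda>X R e. quotient_induction (max (max i j) (max k l)) X (\<lceil>Q\<rceil> \<cdot> X \<cdot> R \<cdot> e) (\<lceil>h\<rceil> \<cdot> X \<cdot> R \<cdot> e))"
    using ind unfolding inhabited_def by blast
  obtain t where t: "\<Theta> \<tturnstile> t : ty_replacement i j k l" using inh_replacement unfolding inhabited_def by blast
  have clQ: "sub s Q = Q" "ren r Q = Q" "\<lceil>Q\<rceil> d = Q" for s r d
    using Q unfolding closed_of_type_def by (auto intro: sub_closed ren_closed wk_closed)
  have clh: "sub s h = h" "ren r h = h" "\<lceil>h\<rceil> d = h" for s r d
    using h unfolding closed_of_type_def by (auto intro: sub_closed ren_closed wk_closed)
  note t2 = closed_app[OF closed_app[OF t[unfolded ty_replacement_def given_quotients_def] Q] h]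
  have "\<Theta> \<tturnstile> App (App (App (App (App (App t Q) h) a) b) u) v : replacement_type i j k l"
    by (rule closed_app[OF closed_app[OF closed_app[OF closed_app[OF t2 a] b] u] v])
      (simp_all only: closed_eval clQ clh)
  then show "inhabited \<Theta> (replacement_type i j k l)" unfolding inhabited_def by blast
qed

theorem theorem3p27:
  fixes \<Theta> :: "nat \<Rightarrow> tm option"
  shows "set_replacement \<Theta> \<longleftrightarrow> small_set_quotients \<Theta>"
  using replacement_imp_quotients quotients_imp_replacement by blast

end
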